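(* There exists a constant $C>0$ such that for every $\tau>0$, all $m,n\in\mathbb N$ with $m\ne2$, every $\chi\in[0,1]$ and every $\Phi\in\Gamma_nL^2_\tau$ whose Fourier transform satisfies $\mathrm{Supp}(\hat\Phi)\subset\{p_{1:n}:|\sqrt{R_\tau}\,p_{1:n}|^2\le\tau\chi\}$, it holds that $$\big\|\sqrt{m!}\,\mathcal A^{\tau,m}\Phi\big\|_{\Gamma H^{-1}_\tau}\le C\big(n^3m^3+\chi\,4^n\,m^n\big)\,\big\|(-\nu_\tau\mathcal L_0^{\mathfrak e_1})^{1/2}\Phi\big\|_\tau^{\alpha}\,\|\Phi\|_{\Gamma H^1_\tau}^{1-\alpha}$$ for any $\alpha\in(0,1)$.
   Context: **Scaling.** Fix $\rho:\mathbb R^2\to\mathbb R$ smooth, compactly supported, non-negative, even, $\int\rho=1$, $\|\rho\|_{L^2(\mathbb R^2)}=1$. Fourier transform on $\mathbb R^d$: $\mathcal F\varphi(p)=\hat\varphi(p)=(2\pi)^{-d/2}\int\varphi(x)e^{-\iota p\cdot x}dx$, $\iota=\sqrt{-1}$. For $\tau>0$: $\nu_\tau=(1\vee\log\tau)^{-2/3}$, $R_\tau=\mathrm{diag}(\nu_\tau,1)$, $\Theta_\tau(p)=(2\pi\hat\rho(\tau^{-1/2}R_\tau^{1/2}p))^2$, and $\Xi^\tau_n(dp_{1:n})=\prod_{i=1}^n\Theta_\tau(p_i)\,dp_{1:n}$ on $\mathbb R^{2n}$. **Notation.** $\mathfrak e_1,\mathfrak e_2$ is the canonical basis of $\mathbb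 R^2$; $p_{1:n}=(p_1,\dots,p_n)$, $p_i\in\mathbb R^2$; for a finite index set $I$, $p_{[I]}=\sum_{i\in I}p_i$, $|\mathfrak e_1\cdot p_{I}|^2=\sum_{i\in I}|\mathfrak e_1\cdot p_i|^2$ and $|\sqrt{R_\tau}p_{1:n}|^2=\sum_i|\sqrt{R_\tau}p_i|^2$. $\mathbb N=\{1,2,\dots\}$. **Fock spaces.** $\Gamma_nL^2_\tau$ is the space of functions on $(\mathbb R^2)^n$ symmetric in their $n$ variables with $\|f\|_{L^2_\tau}^2=\int|\hat f|^2d\Xi^\tau_n<\infty$; $\Gamma L^2_\tau=\bigoplus_{n\ge0}\Gamma_nL^2_\tau$ with $\|f\|_\tau^2=\sum_nn!\|f_n\|^2_{L^2_\tau}$. For $\gamma\in\mathbb R$, $\|f\|^2_{\Gamma H^\gamma_\tau}=\sum_nn!\int(1+\tfrac12|\sqrt{R_\tau}p_{1:n}|^2)^\gamma|\hat f_n(p_{1:n})|^2\,\Xi^\tau_n(dp_{1:n})$. $\mathcal L_0^{\mathfrak e_1}$ is the Fourier multiplier $-\frac12|\mathfrak e_1\cdot p_{1:n}|^2$. **Operators $\mathcal A^{\tau,m}$.** $\mathcal A^{\tau,m}=\sum_{j=0}^{m-1}\mathcal A^{\tau,m}_{m-2j-1}$, where, for $\psi\in\Gamma_nL^2_\tau$ with compactly supported Fourier transform and $a=m-2j-1$: $\mathcal A^{\tau,m}_a\psi=0$ if $j+1>n$; otherwise, for $m=1$ (so $a=0$), $$\mathcal F(\mathcal A^{\tau,1}_0\psi)(p_{1:n})=-\iota\,\tau^{1/2}\nu_\tau^{1/2}\Big(\sum_{i=1}^n(\mathfrak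 e_1\cdot p_i)(\Theta_\tau(p_i)-1)\Big)\hat\psi(p_{1:n}),$$ and for $m\ge2$ $$\mathcal F(\mathcal A^{\tau,m}_a\psi)(p_{1:n+a})=-\iota\,\frac{\tau^{1-\frac m2}\nu_\tau^{\frac{1+m}4}}{(2\pi)^{m-1}}\frac{n!}{(n+a)!\,(j+1)!}\sum_{I}(\mathfrak e_1\cdot p_{[I]})\int_{r_{[1:j+1]}=p_{[I]}}\Xi^\tau_{j+1}(dr_{1:j+1})\,\hat\psi(r_{1:j+1},p_{1:n+a\setminus I}),$$ the sum being over subsets $I\subset\{1,\dots,n+a\}$ of cardinality $m-j$; here $\int_{r_{[1:j+1]}=p}\Xi^\tau_{j+1}(dr_{1:j+1})g(r_{1:j+1})$ means $\int_{\mathbb R^{2j}}g(r_{1:j+1})\prod_{i=1}^{j+1}\Theta_\tau(r_i)\,dr_{1:j}$ with $r_{j+1}=p-r_{[1:j]}$. $p_{1:n+a\setminus I}$ denotes the variables with index not in $I$.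
   Formalization: The constant C may depend on α (for each α∈(0,1) there is a C, uniform in τ, m, n, χ, Φ); a C uniform in all α∈(0,1) is impossible, since α→1 would give an endpoint bound that fails by a factor of log τ in the squared norms for m=n=3. *)

theory Defs
  imports "HOL-Analysis.Analysis"
begin

section \<open>The mollifier\<close>

text \<open>\<open>Ck k f\<close>: \<open>f\<close> and all its iterated partial derivatives up to order \<open>k\<close> exist and are
  continuous.\<close>

fun Ck :: "nat \<Rightarrow> (real^2 \<Rightarrow> real) \<Rightarrow> bool" where
  "Ck 0 f \<longleftrightarrow> continuous_on UNIV f"
| "Ck (Suc k) f \<longleftrightarrow> (\<forall>x. f differentiable (at x)) \<and>
     (\<forall>i. Ck k (\<lambda>x. frechet_derivative f (at x) (axis i 1)))"

definition smooth :: "(real^2 \<Rightarrow> real) \<Rightarrow> bool" where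
  "smooth f \<longleftrightarrow> (\<forall>k. Ck k f)"

definition mollifier :: "(real^2 \<Rightarrow> real) \<Rightarrow> bool" where
  "mollifier \<rho> \<longleftrightarrow> smooth \<rho> \<and> compact (closure {x. \<rho> x \<noteq> 0}) \<and> (\<forall>x. \<rho> x \<ge> 0) \<and>
     (\<forall>x. \<rho> (- x) = \<rho> x) \<and> (LINT x|lborel. \<rho> x) = 1 \<and> sqrt (LINT x|lborel. (\<rho> x)\<^sup>2) = 1"

definition fourier :: "('a::euclidean_space \<Rightarrow> complex) \<Rightarrow> 'a \<Rightarrow> complex" where
  "fourier \<phi> p = complex_of_real ((2 * pi) powr (- real DIM('a) / 2)) *
     (LINT x|lborel. \<phi> x * exp (- \<i> * complex_of_real (p \<bullet> x)))"

section \<open>Scaling\<close>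

definition nu :: "real \<Rightarrow> real" where
  "nu \<tau> = (max 1 (ln \<tau>)) powr (- 2 / 3)"

definition R_mat :: "real \<Rightarrow> real^2^2" where
  "R_mat \<tau> = (\<chi> i j. if i = j then (if i = 1 then nu \<tau> else 1) else 0)"

definition R_sqrt :: "real \<Rightarrow> real^2^2" where
  "R_sqrt \<tau> = (\<chi> i j. if i = j then (if i = 1 then sqrt (nu \<tau>) else 1) else 0)"

lemma R_sqrt_mult_self: "R_sqrt \<tau> ** R_sqrt \<tau> = R_mat \<tau>"
proof -
  have "nu \<tau> \<ge> 0" by (simp add: nu_def)
  then show ?thesis
    by (simp add: R_sqrt_def R_mat_def matrix_matrix_mult_def vec_eq_iff forall_2 sum_2)
qed

text \<open>The transform of an even real function is real, so taking the real part loses nothing.\<close>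

definition Theta :: "(real^2 \<Rightarrow> real) \<Rightarrow> real \<Rightarrow> real^2 \<Rightarrow> real" where
  "Theta \<rho> \<tau> p =
     Re ((2 * pi * fourier (\<lambda>x. complex_of_real (\<rho> x)) (\<tau> powr (- 1 / 2) *\<^sub>R (R_sqrt \<tau> *v p)))\<^sup>2)"

text \<open>A point \<open>p\<^sub>1\<^sub>:\<^sub>n\<close> of \<open>(\<real>\<^sup>2)\<^sup>n\<close> is an extensional function on \<open>{1..n}\<close>.\<close>

definition leb :: "nat \<Rightarrow> (nat \<Rightarrow> real^2) measure" where
  "leb n = (\<Pi>\<^sub>M i\<in>{1..n}. lborel)"

definition Xi :: "(real^2 \<Rightarrow> real) \<Rightarrow> real \<Rightarrow> nat \<Rightarrow> (nat \<Rightarrow> real^2) measure" where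
  "Xi \<rho> \<tau> n = density (leb n) (\<lambda>p. ennreal (\<Prod>i=1..n. Theta \<rho> \<tau> (p i)))"

definition e1 :: "real^2" where
  "e1 = axis 1 1"

definition e1_normsq :: "nat \<Rightarrow> (nat \<Rightarrow> real^2) \<Rightarrow> real" where
  "e1_normsq n p = (\<Sum>i=1..n. \<bar>e1 \<bullet> p i\<bar>\<^sup>2)"

definition R_normsq :: "real \<Rightarrow> nat \<Rightarrow> (nat \<Rightarrow> real^2) \<Rightarrow> real" where
  "R_normsq \<tau> n p = (\<Sum>i=1..n. (norm (R_sqrt \<tau> *v p i))\<^sup>2)"

section \<open>Fock spaces\<close>

text \<open>Every norm and operator here is given through Fourier transforms, and an element of
  \<open>\<Gamma>\<^sub>nL\<^sup>2\<^sub>\<tau>\<close> is represented by its Fourier transform: a measurable, symmetric function in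
  \<open>L\<^sup>2(\<Xi>\<^sub>n)\<close>, determined up to \<open>\<Xi>\<^sub>n\<close>-null sets. (The Fourier transform of a symmetric function is
  symmetric and conversely.) No integrability of the inverse transform is required. A Fock space
  vector is the sequence of the Fourier transforms of its components.\<close>

type_synonym chaos = "(nat \<Rightarrow> real^2) \<Rightarrow> complex"
type_synonym fock = "nat \<Rightarrow> chaos"

definition GammaL2 :: "(real^2 \<Rightarrow> real) \<Rightarrow> real \<Rightarrow> nat \<Rightarrow> chaos set" where
  "GammaL2 \<rho> \<tau> n = {f. f \<in> borel_measurable (leb n) \<and>
     (\<forall>\<pi>. \<pi> permutes {1..n} \<longrightarrow> (AE p in Xi \<rho> \<tau> n. f (p \<circ> \<pi>) = f p)) \<and>
     (\<integral>\<^sup>+p. ennreal ((cmod (f p))\<^sup>2) \<partial>Xi \<rho> \<tau> n) < \<infinity>}"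

definition homogeneous :: "nat \<Rightarrow> chaos \<Rightarrow> fock" where
  "homogeneous n f = (\<lambda>k. if k = n then f else (\<lambda>_. 0))"

definition fock_scale :: "real \<Rightarrow> fock \<Rightarrow> fock" where
  "fock_scale c \<phi> = (\<lambda>n p. complex_of_real c * \<phi> n p)"

definition L2_normsq :: "(real^2 \<Rightarrow> real) \<Rightarrow> real \<Rightarrow> fock \<Rightarrow> ennreal" where
  "L2_normsq \<rho> \<tau> \<phi> =
     (\<Sum>n. ennreal (fact n) * (\<integral>\<^sup>+p. ennreal ((cmod (\<phi> n p))\<^sup>2) \<partial>Xi \<rho> \<tau> n))"

definition H_normsq :: "(real^2 \<Rightarrow> real) \<Rightarrow> real \<Rightarrow> real \<Rightarrow> fock \<Rightarrow> ennreal" where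
  "H_normsq \<rho> \<tau> \<gamma> \<phi> =
     (\<Sum>n. ennreal (fact n) *
        (\<integral>\<^sup>+p. ennreal ((1 + R_normsq \<tau> n p / 2) powr \<gamma> * (cmod (\<phi> n p))\<^sup>2) \<partial>Xi \<rho> \<tau> n))"

text \<open>The real-valued norms are meaningful only where the squared norm is finite
  (\<open>enn2real\<close> sends \<open>\<infinity>\<close> to \<open>0\<close>).\<close>

definition L2_norm :: "(real^2 \<Rightarrow> real) \<Rightarrow> real \<Rightarrow> fock \<Rightarrow> real" where
  "L2_norm \<rho> \<tau> \<phi> = sqrt (enn2real (L2_normsq \<rho> \<tau> \<phi>))"

definition H_norm :: "(real^2 \<Rightarrow> real) \<Rightarrow> real \<Rightarrow> real \<Rightarrow> fock \<Rightarrow> real" where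
  "H_norm \<rho> \<tau> \<gamma> \<phi> = sqrt (enn2real (H_normsq \<rho> \<tau> \<gamma> \<phi>))"

section \<open>Operators\<close>

definition multiplier :: "(nat \<Rightarrow> (nat \<Rightarrow> real^2) \<Rightarrow> real) \<Rightarrow> fock \<Rightarrow> fock" where
  "multiplier \<sigma> \<phi> = (\<lambda>n p. complex_of_real (\<sigma> n p) * \<phi> n p)"

definition L0_e1_symbol :: "nat \<Rightarrow> (nat \<Rightarrow> real^2) \<Rightarrow> real" where
  "L0_e1_symbol n p = - (1 / 2) * e1_normsq n p"

definition sqrt_neg_nu_L0_e1 :: "real \<Rightarrow> fock \<Rightarrow> fock" where
  "sqrt_neg_nu_L0_e1 \<tau> = multiplier (\<lambda>n p. sqrt (- nu \<tau> * L0_e1_symbol n p))"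

text \<open>\<open>\<integral>\<^bsub>r\<^sub>[\<^sub>1\<^sub>:\<^sub>j\<^sub>+\<^sub>1\<^sub>]=q\<^esub> \<Xi>\<^sub>j\<^sub>+\<^sub>1(dr) g(r)\<close>; for \<open>j = 0\<close> it is \<open>\<Theta>(q) g(q)\<close>.\<close>

definition fibre_integral ::
  "(real^2 \<Rightarrow> real) \<Rightarrow> real \<Rightarrow> nat \<Rightarrow> real^2 \<Rightarrow> ((nat \<Rightarrow> real^2) \<Rightarrow> complex) \<Rightarrow> complex" where
  "fibre_integral \<rho> \<tau> j q g =
     (LINT r|leb j.
        (let r' = r(Suc j := q - (\<Sum>i=1..j. r i))
         in g r' * complex_of_real (\<Prod>i=1..Suc j. Theta \<rho> \<tau> (r' i))))"

text \<open>The \<open>n\<close>-tuple \<open>(r\<^sub>1\<^sub>:\<^sub>j\<^sub>+\<^sub>1, p\<^bsub>1:k \<setminus> I\<^esub>)\<close>, the remaining variables in increasing order of index.\<close>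

definition joined_args ::
  "nat \<Rightarrow> nat \<Rightarrow> nat \<Rightarrow> nat set \<Rightarrow> (nat \<Rightarrow> real^2) \<Rightarrow> (nat \<Rightarrow> real^2) \<Rightarrow> (nat \<Rightarrow> real^2)" where
  "joined_args j n k I r p = (\<lambda>i\<in>{1..n}. if i \<le> j + 1 then r i
     else p (sorted_list_of_set ({1..k} - I) ! (i - (j + 2))))"

text \<open>\<open>A_chaos \<rho> \<tau> m j n\<close> is \<open>\<A>\<^sup>\<tau>\<^sup>,\<^sup>m\<^sub>a\<close> with \<open>a = m - 2j - 1\<close> on the \<open>n\<close>-th chaos, with values in the
  chaos of order \<open>k = n + a\<close>. The subtraction on \<open>nat\<close> is exact when \<open>j < m\<close> and \<open>j + 1 \<le> n\<close>.\<close>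

definition A_chaos :: "(real^2 \<Rightarrow> real) \<Rightarrow> real \<Rightarrow> nat \<Rightarrow> nat \<Rightarrow> nat \<Rightarrow> chaos \<Rightarrow> chaos" where
  "A_chaos \<rho> \<tau> m j n \<psi> = (\<lambda>p.
     if j + 1 > n then 0
     else if m = 1 then
       - \<i> * complex_of_real (\<tau> powr (1 / 2) * nu \<tau> powr (1 / 2) *
          (\<Sum>i=1..n. (e1 \<bullet> p i) * (Theta \<rho> \<tau> (p i) - 1))) * \<psi> p
     else
       (let k = n + m - (2 * j + 1) in
        - \<i> * complex_of_real
            (\<tau> powr (1 - real m / 2) * nu \<tau> powr ((1 + real m) / 4) / (2 * pi) ^ (m - 1) *
             (fact n / (fact k * fact (j + 1)))) *
        (\<Sum>I\<in>{I. I \<subseteq> {1..k} \<and> card I = m - j}.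
           complex_of_real (e1 \<bullet> (\<Sum>i\<in>I. p i)) *
           fibre_integral \<rho> \<tau> j (\<Sum>i\<in>I. p i) (\<lambda>r. \<psi> (joined_args j n k I r p)))))"

text \<open>The \<open>k\<close>-th component of \<open>\<A>\<^sup>\<tau>\<^sup>,\<^sup>m\<phi>\<close> collects, for each \<open>j\<close>, the contribution of the chaos of
  order \<open>n = k - a = k + 2j + 1 - m\<close>.\<close>

definition A_op :: "(real^2 \<Rightarrow> real) \<Rightarrow> real \<Rightarrow> nat \<Rightarrow> fock \<Rightarrow> fock" where
  "A_op \<rho> \<tau> m \<phi> = (\<lambda>k p.
     \<Sum>j\<in>{j. j < m \<and> m \<le> k + 2 * j + 1}.
       (let n = k + 2 * j + 1 - m in A_chaos \<rho> \<tau> m j n (\<phi> n) p))"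

end

theory Submission
  imports Defs "HOL-Probability.Characteristic_Functions"
begin

text \<open>After the rescaling \<open>u = \<tau>\<^sup>-\<^sup>1\<^sup>/\<^sup>2 R\<^sup>1\<^sup>/\<^sup>2 p\<close> all powers of \<open>\<tau>\<close> and \<open>\<nu>\<close> cancel, because
  Plancherel's inequality bounds the mass of \<open>\<Theta>\<close> by exactly \<open>(2\<pi>)\<^sup>2 \<tau> \<nu>\<^sup>-\<^sup>1\<^sup>/\<^sup>2\<close>. Write \<open>d = j + 1\<close> for the
  number of incoming and \<open>l = m - j\<close> for the number of outgoing momenta of a term, both with total
  \<open>q\<close>. Cauchy--Schwarz on the incoming fibre reduces everything to bounding
  \<open>(e1 \<bullet> q)\<^sup>2\<close> times the integral of \<open>1 / |u|\<^sup>2\<close> over the outgoing fibre times the integral of an inverse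
  weight over the incoming fibre. For \<open>l \<ge> 3\<close> the outgoing integral converges uniformly in \<open>q\<close>. For
  \<open>l \<le> 2\<close> it is singular at \<open>q = 0\<close>, but then \<open>d \<ge> 2\<close> because \<open>m \<noteq> 2\<close>, and interpolating with \<open>\<alpha> < 1\<close>
  lets the incoming integral and \<open>(e1 \<bullet> q)\<^sup>2\<close> absorb the singularity. The support condition confines
  the incoming momenta to a disc of area proportional to \<open>\<xi>\<close>; this smallness compensates for the
  combinatorial factors that are exponential in \<open>n\<close>. It is available whenever \<open>d \<ge> 2\<close>; for \<open>d = 1\<close>
  the diagonal terms have no such factor, and in the off-diagonal ones an outgoing momentum is
  confined instead. Since the estimate for a larger \<open>\<alpha>\<close> implies the one for a smaller \<open>\<alpha>\<close>, one may
  assume \<open>\<alpha> \<ge> 1/2\<close>. For \<open>m = 1\<close> the operator is a multiplier, small because \<open>|\<Theta> - 1|\<close> is at most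
  proportional to \<open>|u|\<close>.\<close>

text \<open>Terms with different \<open>j\<close> land in different chaoses, so their squared norms
  simply add up. At most \<open>n\<close> values of \<open>j\<close> occur; each term is therefore
  bounded by the square of the claimed factor divided by \<open>n\<close>. The factorials of the
  Fock norms, the prefactor of the operator and Cauchy--Schwarz over the subsets \<open>I\<close>
  combine into m!/(d! l!) times the binomials of \<open>n\<close> over \<open>d\<close> and of the
  target order over \<open>l\<close>, which is at most 4^n m^(n-1). A term without any gain in \<xi>
  is thus affordable only if its own count is polynomial in \<open>n\<close>; this forces the
  separate treatment of d = 1, and of l = 2, where the gain is weaker than a full power of \<xi>.

  The singular weights are products of powers of the two coordinates rather than powers of the norm.
  Every integral then reduces to one dimension, at the price of lower bounds that hold only off the
  axes, that is, almost everywhere. The right-hand side of the theorem enters as a pointwise weight,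
  the geometric mean of the symbols of its two norms, which Hoelder's inequality turns into the
  product of the norms only at the end.\<close>

abbreviation Theta_prod :: "(real^2 \<Rightarrow> real) \<Rightarrow> real \<Rightarrow> nat \<Rightarrow> (nat \<Rightarrow> real^2) \<Rightarrow> real" where
  "Theta_prod \<rho> \<tau> n p \<equiv> \<Prod>i=1..n. Theta \<rho> \<tau> (p i)"

abbreviation complete_fibre :: "nat \<Rightarrow> real^2 \<Rightarrow> (nat \<Rightarrow> real^2) \<Rightarrow> (nat \<Rightarrow> real^2)" where
  "complete_fibre j q r \<equiv> r(Suc j := q - (\<Sum>i=1..j. r i))"

abbreviation bessel_weight :: "real \<Rightarrow> nat \<Rightarrow> (nat \<Rightarrow> real^2) \<Rightarrow> real" where
  "bessel_weight \<tau> n p \<equiv> (1 + R_normsq \<tau> n p / 2) powr - 1"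

abbreviation chaos_dual_normsq ::
    "(real^2 \<Rightarrow> real) \<Rightarrow> real \<Rightarrow> nat \<Rightarrow> nat \<Rightarrow> nat \<Rightarrow> chaos \<Rightarrow> nat \<Rightarrow> ennreal" where
  "chaos_dual_normsq \<rho> \<tau> m j n \<psi> k \<equiv>
    (\<integral>\<^sup>+p. ennreal (bessel_weight \<tau> k p * (cmod (A_chaos \<rho> \<tau> m j n \<psi> p))\<^sup>2) \<partial>Xi \<rho> \<tau> k)"

section \<open>Plancherel's inequality in the plane\<close>

text \<open>A non-integrable function has Bochner integral \<open>0\<close>, so the bound needs no
  integrability. Fibre integrals can therefore be estimated before anything is known about their
  convergence.\<close>

lemma norm_integral_le_nn_integral:
  fixes f :: "'a \<Rightarrow> 'b::{banach, second_countable_topology}"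
  shows "ennreal (norm (integral\<^sup>L M f)) \<le> (\<integral>\<^sup>+x. ennreal (norm (f x)) \<partial>M)"
proof (cases "integrable M f")
  case True
  then show ?thesis
    by (metis integral_norm_bound_ennreal)
next
  case False
  then show ?thesis by (simp add: not_integrable_integral_eq)
qed

section \<open>Lebesgue measure on the plane as a product of two lines\<close>

lemma borel_measurable_vector2 [measurable (raw)]:
  fixes f g :: "'a \<Rightarrow> real"
  assumes [measurable]: "f \<in> borel_measurable M" "g \<in> borel_measurable M"
  shows "(\<lambda>x. vector [f x, g x] :: real^2) \<in> borel_measurable M"
proof -
  have "(\<lambda>x. vector [f x, g x] :: real^2) = (\<lambda>x. f x *\<^sub>R axis 1 1 + g x *\<^sub>R axis 2 1)"
    by (auto simp: fun_eq_iff vec_eq_iff forall_2 axis_def)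
  then show ?thesis by simp
qed

text \<open>Lebesgue measure is determined by its values on open boxes, and the preimage of a box
  under the coordinate map is a product of two intervals.\<close>

lemma lborel_real2:
  "(lborel :: (real^2) measure) = distr (lborel \<Otimes>\<^sub>M lborel) borel (\<lambda>z. vector [fst z, snd z])"
proof (rule lborel_eqI)
  fix l u :: "real^2"
  assume le: "\<And>b. b \<in> Basis \<Longrightarrow> l \<bullet> b \<le> u \<bullet> b"
  have le': "l $ i \<le> u $ i" for i
    using le[of "axis i 1"] by (simp add: inner_axis)
  have eq: "(\<lambda>z. vector [fst z, snd z] :: real^2) -` box l u = {l$1<..<u$1} \<times> {l$2<..<u$2}"
    by (auto simp: mem_box_cart forall_2)
  have "(\<Prod>b\<in>Basis. (u - l) \<bullet> b) = (\<Prod>i\<in>UNIV. (u - l) $ i)"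
  proof -
    have "(Basis :: (real^2) set) = (\<lambda>i. axis i 1) ` UNIV"
      by (auto simp: Basis_vec_def)
    then have "(\<Prod>b\<in>Basis. (u - l) \<bullet> b) = (\<Prod>b\<in>(\<lambda>i::2. axis i 1) ` UNIV. (u - l) \<bullet> b)"
      by simp
    moreover have "inj (\<lambda>i::2. axis i (1::real))"
      by (auto simp: inj_on_def axis_eq_axis)
    ultimately show ?thesis
      by (simp add: prod.reindex inner_axis)
  qed
  also have "\<dots> = (u$1 - l$1) * (u$2 - l$2)"
    by (simp add: UNIV_2)
  finally have p: "(\<Prod>b\<in>Basis. (u - l) \<bullet> b) = (u$1 - l$1) * (u$2 - l$2)" .
  show "emeasure (distr (lborel \<Otimes>\<^sub>M lborel) borel (\<lambda>z. vector [fst z, snd z])) (box l u)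
      = ennreal (\<Prod>b\<in>Basis. (u - l) \<bullet> b)"
    using le' unfolding p
    by (subst emeasure_distr)
       (auto simp: eq space_pair_measure lborel.emeasure_pair_measure_Times ennreal_mult)
qed simp

lemma nn_integral_real2:
  assumes [measurable]: "f \<in> borel_measurable (borel :: (real^2) measure)"
  shows "(\<integral>\<^sup>+u. f u \<partial>lborel) = (\<integral>\<^sup>+x. \<integral>\<^sup>+y. f (vector [x, y]) \<partial>lborel \<partial>lborel)"
  by (subst lborel_real2) (simp add: nn_integral_distr lborel.nn_integral_fst[symmetric])

lemma nn_integral_real2_prod:
  assumes [measurable]: "f \<in> borel_measurable (borel :: real measure)" "g \<in> borel_measurable (borel :: real measure)"
  shows "(\<integral>\<^sup>+u. f (u$1) * g (u$2) \<partial>(lborel :: (real^2) measure)) =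
    (\<integral>\<^sup>+x. f x \<partial>lborel) * (\<integral>\<^sup>+x. g x \<partial>lborel)"
proof -
  have "(\<integral>\<^sup>+u. f (u$1) * g (u$2) \<partial>(lborel :: (real^2) measure)) =
      (\<integral>\<^sup>+x. f x * (\<integral>\<^sup>+y. g y \<partial>lborel) \<partial>lborel)"
    by (subst nn_integral_real2) (simp_all add: nn_integral_cmult)
  then show ?thesis by (simp add: nn_integral_multc)
qed

lemma integral_real2_prod:
  fixes f g :: "real \<Rightarrow> complex"
  assumes f: "integrable lborel f" and g: "integrable lborel g"
  shows "integrable lborel (\<lambda>u::real^2. f (u$1) * g (u$2))"
    and "(LINT u|lborel. f ((u::real^2)$1) * g (u$2)) = (LINT x|lborel. f x) * (LINT x|lborel. g x)"
proof -
  have [measurable]: "f \<in> borel_measurable borel" "g \<in> borel_measurable borel"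
    using f g by auto
  have i: "integrable (lborel \<Otimes>\<^sub>M lborel) (\<lambda>z. f (fst z) * g (snd z))"
    by (rule lborel_pair.Fubini_integrable)
       (auto simp: norm_mult intro!: integrable_norm f g)
  show "integrable lborel (\<lambda>u::real^2. f (u$1) * g (u$2))"
    by (subst lborel_real2) (simp add: integrable_distr_eq i)
  have "(LINT u|lborel. f ((u::real^2)$1) * g (u$2)) = (LINT z|(lborel \<Otimes>\<^sub>M lborel). f (fst z) * g (snd z))"
    by (subst lborel_real2) (simp add: integral_distr)
  also have "\<dots> = (LINT x|lborel. LINT y|lborel. f x * g y)"
    using lborel_pair.integral_fst'[OF i] by simp
  finally show "(LINT u|lborel. f ((u::real^2)$1) * g (u$2)) = (LINT x|lborel. f x) * (LINT x|lborel. g x)"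
    by simp
qed

section \<open>Gaussian integrals in one and two dimensions\<close>

lemma gauss_char1:
  fixes z e :: real
  assumes e: "e > 0"
  shows "integrable lborel (\<lambda>u. complex_of_real (exp (- e * u\<^sup>2 / 2)) * iexp (u * z))" (is ?A)
    and "(LINT u|lborel. complex_of_real (exp (- e * u\<^sup>2 / 2)) * iexp (u * z))
        = complex_of_real (sqrt (2 * pi / e) * exp (- z\<^sup>2 / (2 * e)))" (is ?B)
proof -
  have "integrable lborel (\<lambda>u. sqrt (2 * pi) * std_normal_density (0 + sqrt e * u))"
    using e by (intro integrable_mult_right lborel_integrable_real_affine) auto
  then have i: "integrable lborel (\<lambda>u. exp (- e * u\<^sup>2 / 2))"
    using e by (simp add: std_normal_density_def power_mult_distrib)
  show ?A
    by (rule Bochner_Integration.integrable_bound[OF i]) (auto simp: norm_mult)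
  let ?f = "\<lambda>x. std_normal_density x *\<^sub>R iexp (z / sqrt e * x)"
  \<comment> \<open>The characteristic function of the standard normal law at
    \<open>z / sqrt e\<close>; the substitution \<open>x = sqrt e * u\<close> then produces the
    variance \<open>1 / e\<close>.\<close>
  have "complex_of_real (exp (- z\<^sup>2 / (2 * e))) = char std_normal_distribution (z / sqrt e)"
    using e by (simp add: char_std_normal_distribution power_divide)
  also have "\<dots> = (LINT x|lborel. ?f x)"
    unfolding char_def by (subst integral_density) auto
  also have "\<dots> = sqrt e *\<^sub>R (LINT u|lborel. ?f (0 + sqrt e * u))"
    using e by (subst lborel_integral_real_affine[of "sqrt e" _ 0]) auto
  also have "(\<lambda>u. ?f (0 + sqrt e * u)) =
     (\<lambda>u. complex_of_real (1 / sqrt (2 * pi)) * (complex_of_real (exp (- e * u\<^sup>2 / 2)) * iexp (u * z)))"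
    using e by (auto simp: fun_eq_iff std_normal_density_def power_mult_distrib scaleR_conv_of_real mult_ac)
  also have "sqrt e *\<^sub>R (LINT u|lborel. complex_of_real (1 / sqrt (2 * pi)) * (complex_of_real (exp (- e * u\<^sup>2 / 2)) * iexp (u * z)))
    = complex_of_real (sqrt e / sqrt (2 * pi)) * (LINT u|lborel. complex_of_real (exp (- e * u\<^sup>2 / 2)) * iexp (u * z))"
    by (simp add: scaleR_conv_of_real)
  finally show ?B using e
    by (simp add: real_sqrt_divide field_simps)
qed

text \<open>The integrand is the real part of a product of two one-dimensional Gaussian characters,
  one for each coordinate.\<close>

lemma gauss_char2:
  fixes z :: "real^2" and e :: real
  assumes e: "e > 0"
  shows "integrable lborel (\<lambda>u::real^2. exp (- e * (norm u)\<^sup>2 / 2) * cos (u \<bullet> z))" (is ?A)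
    and "(LINT u|lborel. exp (- e * (norm u)\<^sup>2 / 2) * cos (u \<bullet> z))
        = 2 * pi / e * exp (- (norm z)\<^sup>2 / (2 * e))" (is ?B)
proof -
  let ?g = "\<lambda>z (u::real). complex_of_real (exp (- e * u\<^sup>2 / 2)) * iexp (u * z)"
  have n2: "(norm v)\<^sup>2 = (v$1)\<^sup>2 + (v$2)\<^sup>2" for v :: "real^2"
    unfolding power2_norm_eq_inner by (simp add: inner_vec_def sum_2 power2_eq_square)
  have eq: "exp (- e * (norm u)\<^sup>2 / 2) * cos (u \<bullet> z) = Re (?g (z$1) (u$1) * ?g (z$2) (u$2))" for u :: "real^2"
  proof -
    have "?g (z$1) (u$1) * ?g (z$2) (u$2) = complex_of_real (exp (- e * (u$1)\<^sup>2 / 2) * exp (- e * (u$2)\<^sup>2 / 2)) * (iexp (u$1 * z$1) * iexp (u$2 * z$2))"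
      by simp
    also have "iexp (u$1 * z$1) * iexp (u$2 * z$2) = cis (u \<bullet> z)"
      by (simp add: exp_add[symmetric] inner_vec_def sum_2 cis_conv_exp distrib_left)
    also have "exp (- e * (u$1)\<^sup>2 / 2) * exp (- e * (u$2)\<^sup>2 / 2) = exp (- e * (norm u)\<^sup>2 / 2)"
      by (simp add: exp_add[symmetric] n2 algebra_simps add_divide_distrib)
    finally show ?thesis by simp
  qed
  note i = integral_real2_prod[OF gauss_char1(1)[OF e, of "z$1"] gauss_char1(1)[OF e, of "z$2"]]
  show ?A unfolding eq by (intro integrable_Re i)
  have "(LINT u|lborel. exp (- e * (norm u)\<^sup>2 / 2) * cos (u \<bullet> z)) = Re (LINT u|lborel. ?g (z$1) ((u::real^2)$1) * ?g (z$2) (u$2))"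
    unfolding eq by (rule integral_Re[OF i(1)])
  also have "\<dots> = (sqrt (2 * pi / e) * exp (- (z$1)\<^sup>2 / (2 * e))) * (sqrt (2 * pi / e) * exp (- (z$2)\<^sup>2 / (2 * e)))"
    unfolding i(2) gauss_char1(2)[OF e] by (simp only: of_real_mult[symmetric] Re_complex_of_real)
  also have "\<dots> = (sqrt (2 * pi / e))\<^sup>2 * (exp (- (z$1)\<^sup>2 / (2 * e)) * exp (- (z$2)\<^sup>2 / (2 * e)))"
    by (simp only: power2_eq_square[of "sqrt _"] mult_ac)
  also have "\<dots> = 2 * pi / e * exp (- (norm z)\<^sup>2 / (2 * e))"
    using e by (simp add: exp_add[symmetric] n2 algebra_simps add_divide_distrib diff_divide_distrib)
  finally show ?B .
qed

text \<open>This is \<open>gauss_char2\<close> with \<open>1 / e\<close> in place of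
  \<open>e\<close>, at frequency zero. The mass does not depend on \<open>e\<close>, so the
  regularisation below can be removed at no cost.\<close>

lemma gauss_mass2:
  fixes e :: real
  assumes e: "e > 0"
  shows "(\<integral>\<^sup>+z. ennreal (2 * pi / e * exp (- (norm (z::real^2))\<^sup>2 / (2 * e))) \<partial>lborel) = ennreal ((2 * pi)\<^sup>2)"
proof -
  have 1: "1 / e > 0" using e by simp
  have i: "integrable lborel (\<lambda>u::real^2. exp (- (norm u)\<^sup>2 / (2 * e)))"
    using gauss_char2(1)[OF 1, of 0] by (simp add: mult.commute)
  have "(\<integral>\<^sup>+z. ennreal (2 * pi / e * exp (- (norm (z::real^2))\<^sup>2 / (2 * e))) \<partial>lborel)
    = ennreal (LINT z|lborel. 2 * pi / e * exp (- (norm (z::real^2))\<^sup>2 / (2 * e)))"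
    using e i by (intro nn_integral_eq_integral integrable_mult_right) auto
  also have "\<dots> = ennreal (2 * pi / e * (2 * pi * e))"
    using gauss_char2(2)[OF 1, of 0] e by (simp add: mult.commute)
  finally show ?thesis using e by (simp add: power2_eq_square)
qed

lemma ennreal_half_add:
  assumes "a \<ge> 0" "b \<ge> 0"
  shows "ennreal (1/2) * (ennreal a + ennreal b) = ennreal ((a + b) / 2)"
proof -
  have "ennreal (1/2) * (ennreal a + ennreal b) = ennreal (1/2) * ennreal (a + b)"
    using assms by simp
  also have "\<dots> = ennreal (1/2 * (a + b))"
    using assms by (intro ennreal_mult[symmetric]) auto
  finally show ?thesis by simp
qed

lemma integrable_pair_mult:
  fixes f :: "'a::euclidean_space \<Rightarrow> real" and g :: "'b::euclidean_space \<Rightarrow> real"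
  assumes f: "integrable lborel f" and g: "integrable lborel g"
  shows "integrable (lborel \<Otimes>\<^sub>M lborel) (\<lambda>(x, y). f x * g y)"
proof -
  have [measurable]: "f \<in> borel_measurable borel" "g \<in> borel_measurable borel"
    using f g by auto
  show ?thesis
    by (rule lborel_pair.Fubini_integrable)
       (auto simp: abs_mult intro!: integrable_abs f g)
qed

lemma nn_integral_lborel_shift:
  fixes c :: "'a::euclidean_space"
  assumes [measurable]: "f \<in> borel_measurable borel"
  shows "(\<integral>\<^sup>+x. f (x + c) \<partial>lborel) = (\<integral>\<^sup>+x. f x \<partial>lborel)"
    and "(\<integral>\<^sup>+x. f (c - x) \<partial>lborel) = (\<integral>\<^sup>+x. f x \<partial>lborel)"
proof -
  have shift: "(\<integral>\<^sup>+x. g x \<partial>lborel) = (\<integral>\<^sup>+x. g (c + x) \<partial>lborel)"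
    if [measurable]: "g \<in> borel_measurable borel" for g :: "'a \<Rightarrow> ennreal"
    by (subst lborel_distr_plus[of c, symmetric]) (simp add: nn_integral_distr)
  show "(\<integral>\<^sup>+x. f (x + c) \<partial>lborel) = (\<integral>\<^sup>+x. f x \<partial>lborel)"
    using shift[of f] by (simp add: add.commute)
  have "(\<integral>\<^sup>+x. f x \<partial>lborel) = (\<integral>\<^sup>+x. f x \<partial>density (distr lborel borel (\<lambda>x. c + (- 1) *\<^sub>R x)) (\<lambda>_. ennreal (\<bar>- 1\<bar> ^ DIM('a))))"
    by (subst lborel_affine[of "- 1" c]) auto
  then show "(\<integral>\<^sup>+x. f (c - x) \<partial>lborel) = (\<integral>\<^sup>+x. f x \<partial>lborel)"
    by (simp add: nn_integral_density nn_integral_distr)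
qed

text \<open>One half of Plancherel's theorem. Inserting the factor \<open>exp (- e * (norm u)\<^sup>2 / 2)\<close>
  makes Fubini applicable and turns the left side into the quadratic form of a heat kernel of total
  mass \<open>(2 * pi)\<^sup>2\<close>; the bound is then Young's inequality, uniformly in \<open>e\<close>.\<close>

lemma cosine_transform_L2_le:
  fixes \<rho> :: "real^2 \<Rightarrow> real"
  assumes i: "integrable lborel \<rho>" and nn: "\<And>x. \<rho> x \<ge> 0"
  shows "(\<integral>\<^sup>+u. ennreal ((LINT x|lborel. \<rho> x * cos (u \<bullet> x))\<^sup>2) \<partial>lborel) \<le>
    ennreal ((2 * pi)\<^sup>2) * (\<integral>\<^sup>+x. ennreal ((\<rho> x)\<^sup>2) \<partial>lborel)"
proof -
  have [measurable]: "\<rho> \<in> borel_measurable borel" using i by auto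
  define c where "c u = (LINT x|lborel. \<rho> x * cos (u \<bullet> x))" for u
  have c_meas [measurable]: "c \<in> borel_measurable borel"
    unfolding c_def by measurable
  define m where "m = (LINT x|lborel. \<rho> x)"
  have ic: "integrable lborel (\<lambda>x. \<rho> x * cos (u \<bullet> x))" for u
    by (rule Bochner_Integration.integrable_bound[OF i])
       (auto simp: abs_mult nn intro!: mult_left_le)
  have c_le: "\<bar>c u\<bar> \<le> m" for u
  proof -
    have "\<bar>c u\<bar> \<le> (LINT x|lborel. \<bar>\<rho> x * cos (u \<bullet> x)\<bar>)"
      unfolding c_def using integral_norm_bound[of lborel "\<lambda>x. \<rho> x * cos (u \<bullet> x)"] by simp
    also have "\<dots> \<le> m" unfolding m_def
      by (intro integral_mono i integrable_abs ic) (auto simp: abs_mult nn intro!: mult_left_le)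
    finally show ?thesis .
  qed
  have bound: "(\<integral>\<^sup>+u. ennreal ((c u)\<^sup>2 * exp (- e * (norm u)\<^sup>2 / 2)) \<partial>lborel)
      \<le> ennreal ((2 * pi)\<^sup>2) * (\<integral>\<^sup>+x. ennreal ((\<rho> x)\<^sup>2) \<partial>lborel)"
    if e: "e > 0" for e
  proof -
    define G where "G u = exp (- e * (norm u)\<^sup>2 / 2)" for u :: "real^2"
    have [measurable]: "G \<in> borel_measurable borel" unfolding G_def by measurable
    have G_pos: "G u > 0" for u by (simp add: G_def)
    have iG: "integrable lborel G"
      using gauss_char2(1)[OF e, of 0] by (simp add: G_def[abs_def])
    define \<gamma> where "\<gamma> z = 2 * pi / e * exp (- (norm z)\<^sup>2 / (2 * e))" for z :: "real^2"
    have [measurable]: "\<gamma> \<in> borel_measurable borel" unfolding \<gamma>_def by measurable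
    have \<gamma>_pos: "\<gamma> z > 0" for z using e by (simp add: \<gamma>_def)
    \<comment> \<open>The product of the cosines of \<open>u \<bullet> x\<close> and
      \<open>u \<bullet> y\<close> is half the sum of the cosines of
      \<open>u \<bullet> (x - y)\<close> and \<open>u \<bullet> (x + y)\<close>, and the Gaussian
      integral of each of these is the heat kernel \<open>\<gamma>\<close>.\<close>
    define K where "K x y = (\<gamma> (x - y) + \<gamma> (x + y)) / 2" for x y
    have [measurable]: "(\<lambda>(x,y). K x y) \<in> borel_measurable (borel \<Otimes>\<^sub>M borel)"
      unfolding K_def by measurable
    have K_pos: "K x y > 0" for x y using \<gamma>_pos by (simp add: K_def add_pos_pos)
    have K_sym: "K x y = K y x" for x y
      by (simp add: K_def \<gamma>_def norm_minus_commute add.commute)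
    have K: "(LINT u|lborel. G u * cos (u \<bullet> x) * cos (u \<bullet> y)) = K x y" for x y
    proof -
      have "(LINT u|lborel. G u * cos (u \<bullet> x) * cos (u \<bullet> y)) =
        (LINT u|lborel. (exp (- e * (norm u)\<^sup>2 / 2) * cos (u \<bullet> (x - y)) + exp (- e * (norm u)\<^sup>2 / 2) * cos (u \<bullet> (x + y))) / 2)"
        by (intro Bochner_Integration.integral_cong)
           (auto simp: G_def inner_diff_right inner_add_right cos_add cos_diff field_simps)
      also have "\<dots> = K x y"
        using gauss_char2[OF e, of "x - y"] gauss_char2[OF e, of "x + y"]
        by (simp add: K_def \<gamma>_def)
      finally show ?thesis .
    qed
    have K_mass: "(\<integral>\<^sup>+y. ennreal (K x y) \<partial>lborel) = ennreal ((2 * pi)\<^sup>2)" for x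
    proof -
      have "(\<integral>\<^sup>+y. ennreal (K x y) \<partial>lborel) = (\<integral>\<^sup>+y. ennreal (1/2) * (ennreal (\<gamma> (x - y)) + ennreal (\<gamma> (y + x))) \<partial>lborel)"
        using \<gamma>_pos[THEN less_imp_le] ennreal_half_add
        by (intro nn_integral_cong) (simp add: K_def add.commute)
      also have "\<dots> = ennreal (1/2) * ((\<integral>\<^sup>+y. ennreal (\<gamma> (x - y)) \<partial>lborel) + (\<integral>\<^sup>+y. ennreal (\<gamma> (y + x)) \<partial>lborel))"
        by (simp add: nn_integral_cmult nn_integral_add)
      also have "\<dots> = ennreal (1/2) * ((\<integral>\<^sup>+y. ennreal (\<gamma> y) \<partial>lborel) + (\<integral>\<^sup>+y. ennreal (\<gamma> y) \<partial>lborel))"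
        by (simp add: nn_integral_lborel_shift[where f="\<lambda>z. ennreal (\<gamma> z)"])
      also have "\<dots> = ennreal ((2 * pi)\<^sup>2)"
        using gauss_mass2[OF e] ennreal_half_add[of "(2 * pi)\<^sup>2" "(2 * pi)\<^sup>2"]
        by (simp add: \<gamma>_def)
      finally show ?thesis .
    qed
    have m0: "m \<ge> 0" unfolding m_def by (intro Bochner_Integration.integral_nonneg) (auto simp: nn)
    have step1: "(LINT u|lborel. (c u)\<^sup>2 * G u) = (LINT x|lborel. \<rho> x * (LINT u|lborel. c u * G u * cos (u \<bullet> x)))"
    proof -
      have "integrable (lborel \<Otimes>\<^sub>M lborel) (\<lambda>(x, u). \<rho> x * (c u * G u * cos (u \<bullet> x)))"
      proof (rule Bochner_Integration.integrable_bound[OF integrable_pair_mult[OF i integrable_mult_right[OF iG, of m]]])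
        have "\<bar>\<rho> x * (c u * G u * cos (u \<bullet> x))\<bar> \<le> \<bar>\<rho> x * (m * G u)\<bar>" for x u
        proof -
          have "\<bar>c u\<bar> * (G u * \<bar>cos (u \<bullet> x)\<bar>) \<le> m * G u"
            using c_le[of u] G_pos[of u] m0 by (intro mult_mono mult_left_le) auto
          then show ?thesis
            using nn[of x] G_pos[of u] m0 by (auto simp: abs_mult mult.assoc intro!: mult_left_mono)
        qed
        then show "AE z in lborel \<Otimes>\<^sub>M lborel. norm (case z of (x, u) \<Rightarrow> \<rho> x * (c u * G u * cos (u \<bullet> x))) \<le> norm (case z of (x, u) \<Rightarrow> \<rho> x * (m * G u))"
          by (auto simp: case_prod_beta)
      qed measurable
      from lborel_pair.Fubini_integral[OF this]
      have "(LINT u|lborel. LINT x|lborel. \<rho> x * (c u * G u * cos (u \<bullet> x))) = (LINT x|lborel. LINT u|lborel. \<rho> x * (c u * G u * cos (u \<bullet> x)))"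
        by simp
      moreover have "(LINT x|lborel. \<rho> x * (c u * G u * cos (u \<bullet> x))) = (c u)\<^sup>2 * G u" for u
      proof -
        have "(LINT x|lborel. \<rho> x * (c u * G u * cos (u \<bullet> x))) = (LINT x|lborel. (c u * G u) * (\<rho> x * cos (u \<bullet> x)))"
          by (simp add: mult_ac)
        also have "\<dots> = c u * G u * c u" by (simp add: c_def)
        finally show ?thesis by (simp add: power2_eq_square mult_ac)
      qed
      ultimately show ?thesis by simp
    qed
    have step2: "(LINT u|lborel. c u * G u * cos (u \<bullet> x)) = (LINT y|lborel. \<rho> y * K x y)" for x
    proof -
      have "integrable (lborel \<Otimes>\<^sub>M lborel) (\<lambda>(y, u). \<rho> y * (G u * cos (u \<bullet> x) * cos (u \<bullet> y)))"
      proof (rule Bochner_Integration.integrable_bound[OF integrable_pair_mult[OF i iG]])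
        have "\<bar>\<rho> y * (G u * cos (u \<bullet> x) * cos (u \<bullet> y))\<bar> \<le> \<bar>\<rho> y * G u\<bar>" for y u
          using nn[of y] G_pos[of u]
          by (auto simp: abs_mult mult.assoc intro!: mult_left_mono mult_left_le mult_le_one)
        then show "AE z in lborel \<Otimes>\<^sub>M lborel. norm (case z of (y, u) \<Rightarrow> \<rho> y * (G u * cos (u \<bullet> x) * cos (u \<bullet> y))) \<le> norm (case z of (y, u) \<Rightarrow> \<rho> y * G u)"
          by (auto simp: case_prod_beta)
      qed measurable
      from lborel_pair.Fubini_integral[OF this]
      have "(LINT u|lborel. LINT y|lborel. \<rho> y * (G u * cos (u \<bullet> x) * cos (u \<bullet> y))) = (LINT y|lborel. \<rho> y * K x y)"
        by (simp add: K)
      moreover have "(LINT y|lborel. \<rho> y * (G u * cos (u \<bullet> x) * cos (u \<bullet> y))) = c u * G u * cos (u \<bullet> x)" for u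
      proof -
        have "(LINT y|lborel. \<rho> y * (G u * cos (u \<bullet> x) * cos (u \<bullet> y))) = (LINT y|lborel. (G u * cos (u \<bullet> x)) * (\<rho> y * cos (u \<bullet> y)))"
          by (simp only: mult_ac)
        also have "\<dots> = (G u * cos (u \<bullet> x)) * c u"
          by (subst integral_mult_right_zero) (simp add: c_def)
        finally show ?thesis by (simp only: mult_ac)
      qed
      ultimately show ?thesis by simp
    qed
    have "integrable lborel (\<lambda>u. (c u)\<^sup>2 * G u)"
    proof (rule Bochner_Integration.integrable_bound[OF integrable_mult_right[OF iG, of "m\<^sup>2"]])
      show "AE u in lborel. norm ((c u)\<^sup>2 * G u) \<le> norm (m\<^sup>2 * G u)"
        using G_pos c_le by (auto simp: abs_mult less_imp_le intro!: mult_right_mono abs_le_square_iff[THEN iffD1] order.trans[OF c_le])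
    qed simp
    then have "(\<integral>\<^sup>+u. ennreal ((c u)\<^sup>2 * G u) \<partial>lborel) = ennreal (LINT u|lborel. (c u)\<^sup>2 * G u)"
      by (rule nn_integral_eq_integral) (use G_pos in \<open>auto simp: less_imp_le\<close>)
    also have "\<dots> = ennreal (norm (LINT x|lborel. \<rho> x * (LINT y|lborel. \<rho> y * K x y)))"
    proof -
      have "(LINT x|lborel. \<rho> x * (LINT y|lborel. \<rho> y * K x y)) \<ge> 0"
        using nn K_pos by (intro Bochner_Integration.integral_nonneg mult_nonneg_nonneg) (auto simp: less_imp_le intro!: Bochner_Integration.integral_nonneg)
      then show ?thesis by (simp add: step1 step2)
    qed
    also have "\<dots> \<le> (\<integral>\<^sup>+x. ennreal (norm (\<rho> x * (LINT y|lborel. \<rho> y * K x y))) \<partial>lborel)"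
      by (rule norm_integral_le_nn_integral)
    also have "\<dots> \<le> (\<integral>\<^sup>+x. ennreal (\<rho> x) * (\<integral>\<^sup>+y. ennreal (norm (\<rho> y * K x y)) \<partial>lborel) \<partial>lborel)"
    proof (intro nn_integral_mono)
      fix x
      have "norm (\<rho> x * (LINT y|lborel. \<rho> y * K x y)) = \<rho> x * norm (LINT y|lborel. \<rho> y * K x y)"
        unfolding norm_mult using nn[of x] by simp
      then show "ennreal (norm (\<rho> x * (LINT y|lborel. \<rho> y * K x y))) \<le> ennreal (\<rho> x) * (\<integral>\<^sup>+y. ennreal (norm (\<rho> y * K x y)) \<partial>lborel)"
        using nn[of x] norm_integral_le_nn_integral[of lborel "\<lambda>y. \<rho> y * K x y"]
        by (simp only: ennreal_mult norm_ge_zero) (intro mult_left_mono, auto)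
    qed
    also have "\<dots> = (\<integral>\<^sup>+x. \<integral>\<^sup>+y. ennreal (\<rho> x) * ennreal (\<rho> y * K x y) \<partial>lborel \<partial>lborel)"
      using nn K_pos by (simp add: nn_integral_cmult abs_mult less_imp_le)
    also have "\<dots> \<le> (\<integral>\<^sup>+x. \<integral>\<^sup>+y. ennreal (1/2) * (ennreal ((\<rho> x)\<^sup>2) * ennreal (K x y) + ennreal ((\<rho> y)\<^sup>2) * ennreal (K x y)) \<partial>lborel \<partial>lborel)"
    proof (intro nn_integral_mono)
      fix x y
      have "\<rho> x * \<rho> y \<le> ((\<rho> x)\<^sup>2 + (\<rho> y)\<^sup>2) / 2"
        using sum_squares_bound[of "\<rho> x" "\<rho> y"] by simp
      then have "\<rho> x * \<rho> y * K x y \<le> ((\<rho> x)\<^sup>2 + (\<rho> y)\<^sup>2) / 2 * K x y"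
        using K_pos[of x y] by (intro mult_right_mono) auto
      moreover have "ennreal (1/2) * (ennreal ((\<rho> x)\<^sup>2) * ennreal (K x y) + ennreal ((\<rho> y)\<^sup>2) * ennreal (K x y))
          = ennreal (((\<rho> x)\<^sup>2 * K x y + (\<rho> y)\<^sup>2 * K x y) / 2)"
        using K_pos[of x y] by (subst ennreal_half_add[symmetric]) (auto simp: ennreal_mult)
      moreover have "ennreal (\<rho> x) * ennreal (\<rho> y * K x y) = ennreal (\<rho> x * \<rho> y * K x y)"
        using nn K_pos[of x y] by (simp add: ennreal_mult[symmetric] mult.assoc)
      ultimately show "ennreal (\<rho> x) * ennreal (\<rho> y * K x y) \<le> ennreal (1/2) * (ennreal ((\<rho> x)\<^sup>2) * ennreal (K x y) + ennreal ((\<rho> y)\<^sup>2) * ennreal (K x y))"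
        by (simp add: ennreal_leI field_simps del: times_divide_eq_left)
    qed
    also have "\<dots> = ennreal (1/2) * ((\<integral>\<^sup>+x. \<integral>\<^sup>+y. ennreal ((\<rho> x)\<^sup>2) * ennreal (K x y) \<partial>lborel \<partial>lborel) + (\<integral>\<^sup>+x. \<integral>\<^sup>+y. ennreal ((\<rho> y)\<^sup>2) * ennreal (K x y) \<partial>lborel \<partial>lborel))"
      by (simp add: nn_integral_cmult nn_integral_add)
    \<comment> \<open>By the symmetry of \<open>K\<close> and Tonelli the two terms coincide, and
      each is the squared norm of \<rho> times the mass of \<open>K\<close>.\<close>
    also have "(\<integral>\<^sup>+x. \<integral>\<^sup>+y. ennreal ((\<rho> y)\<^sup>2) * ennreal (K x y) \<partial>lborel \<partial>lborel) = (\<integral>\<^sup>+x. \<integral>\<^sup>+y. ennreal ((\<rho> x)\<^sup>2) * ennreal (K x y) \<partial>lborel \<partial>lborel)"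
      by (subst lborel_pair.Fubini') (simp_all add: K_sym)
    also have "(\<integral>\<^sup>+x. \<integral>\<^sup>+y. ennreal ((\<rho> x)\<^sup>2) * ennreal (K x y) \<partial>lborel \<partial>lborel) = (\<integral>\<^sup>+x. ennreal ((\<rho> x)\<^sup>2) \<partial>lborel) * ennreal ((2 * pi)\<^sup>2)"
      by (simp add: nn_integral_cmult K_mass nn_integral_multc)
    also have "ennreal (1/2) * ((\<integral>\<^sup>+x. ennreal ((\<rho> x)\<^sup>2) \<partial>lborel) * ennreal ((2 * pi)\<^sup>2) + (\<integral>\<^sup>+x. ennreal ((\<rho> x)\<^sup>2) \<partial>lborel) * ennreal ((2 * pi)\<^sup>2))
        = ennreal (1/2) * 2 * (ennreal ((2 * pi)\<^sup>2) * (\<integral>\<^sup>+x. ennreal ((\<rho> x)\<^sup>2) \<partial>lborel))"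
      by (simp only: mult_2[symmetric] mult_ac)
    also have "ennreal (1/2) * 2 = 1"
      using ennreal_half_add[of 1 1] by (simp only: ennreal_1 one_add_one) simp
    finally show ?thesis by (simp add: G_def)
  qed
  \<comment> \<open>Fatou's lemma removes the Gaussian factor along
    \<open>e = 1 / (n + 1)\<close>.\<close>
  have "(\<integral>\<^sup>+u. ennreal ((c u)\<^sup>2) \<partial>lborel) = (\<integral>\<^sup>+u. liminf (\<lambda>n. ennreal ((c u)\<^sup>2 * exp (- (1 / real (Suc n)) * (norm u)\<^sup>2 / 2))) \<partial>lborel)"
  proof (intro nn_integral_cong)
    fix u :: "real^2"
    have l: "(\<lambda>n. 1 / real (Suc n)) \<longlonglongrightarrow> 0"
      using LIMSEQ_inverse_real_of_nat by (simp add: inverse_eq_divide)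
    have "(\<lambda>n. (c u)\<^sup>2 * exp (- (1 / real (Suc n)) * (norm u)\<^sup>2 / 2)) \<longlonglongrightarrow> (c u)\<^sup>2 * exp (- 0 * (norm u)\<^sup>2 / 2)"
      by (intro tendsto_intros l) auto
    then have "(\<lambda>n. ennreal ((c u)\<^sup>2 * exp (- (1 / real (Suc n)) * (norm u)\<^sup>2 / 2))) \<longlonglongrightarrow> ennreal ((c u)\<^sup>2)"
      by (intro tendsto_ennrealI) simp
    from lim_imp_Liminf[OF trivial_limit_sequentially this]
    show "ennreal ((c u)\<^sup>2) = liminf (\<lambda>n. ennreal ((c u)\<^sup>2 * exp (- (1 / real (Suc n)) * (norm u)\<^sup>2 / 2)))" ..
  qed
  also have "\<dots> \<le> liminf (\<lambda>n. \<integral>\<^sup>+u. ennreal ((c u)\<^sup>2 * exp (- (1 / real (Suc n)) * (norm u)\<^sup>2 / 2)) \<partial>lborel)"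
    by (rule nn_integral_liminf) measurable
  also have "\<dots> \<le> liminf (\<lambda>n. ennreal ((2 * pi)\<^sup>2) * (\<integral>\<^sup>+x. ennreal ((\<rho> x)\<^sup>2) \<partial>lborel))"
    by (intro Liminf_mono eventuallyI bound) simp
  finally show ?thesis by (simp add: c_def Liminf_const)
qed

section \<open>The mollifier after rescaling\<close>

lemma e1_inner [simp]: "e1 \<bullet> p = p $ 1"
  by (simp add: e1_def inner_axis')

lemma norm_real2_sq: "(norm (v :: real^2))\<^sup>2 = (v$1)\<^sup>2 + (v$2)\<^sup>2"
  unfolding power2_norm_eq_inner by (simp add: inner_vec_def sum_2 power2_eq_square)

definition rescale :: "real \<Rightarrow> real^2 \<Rightarrow> real^2" where
  "rescale \<tau> p = \<tau> powr (- 1 / 2) *\<^sub>R (R_sqrt \<tau> *v p)"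

text \<open>For even \<rho> this is the whole Fourier integral, since the sine part cancels. The
  missing normalisation \<open>1 / (2 * pi)\<close> is exactly what the factor \<open>2 * pi\<close>
  in \<open>Theta\<close> compensates.\<close>

definition cosine_transform :: "(real^2 \<Rightarrow> real) \<Rightarrow> real^2 \<Rightarrow> real" where
  "cosine_transform \<rho> u = (LINT x|lborel. \<rho> x * cos (u \<bullet> x))"

lemma nu_pos: "nu \<tau> > 0"
  by (simp add: nu_def)

lemma R_sqrt_mult: "R_sqrt \<tau> *v p = vector [sqrt (nu \<tau>) * p$1, p$2]"
  by (simp add: R_sqrt_def matrix_vector_mult_def vec_eq_iff forall_2 sum_2)

lemma rescale_nth:
  "rescale \<tau> p $ 1 = \<tau> powr (- 1 / 2) * sqrt (nu \<tau>) * p$1"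
  "rescale \<tau> p $ 2 = \<tau> powr (- 1 / 2) * p$2"
  by (simp_all add: rescale_def R_sqrt_mult)

lemma rescale_eq: "rescale \<tau> p = vector [\<tau> powr (- 1 / 2) * sqrt (nu \<tau>) * p$1, \<tau> powr (- 1 / 2) * p$2]"
  by (simp add: vec_eq_iff forall_2 rescale_nth)

lemma rescale_sum: "rescale \<tau> (\<Sum>i\<in>A. p i) = (\<Sum>i\<in>A. rescale \<tau> (p i))"
  by (simp add: vec_eq_iff forall_2 rescale_nth sum_distrib_left)

lemma borel_measurable_rescale [measurable]: "rescale \<tau> \<in> borel_measurable borel"
  unfolding rescale_eq[abs_def] by measurable

lemma powr_neg_half_sq:
  assumes "(\<tau>::real) > 0"
  shows "\<tau> * (\<tau> powr - (1 / 2))\<^sup>2 = 1"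
proof -
  have "(\<tau> powr - (1 / 2))\<^sup>2 = \<tau> powr (- 1)"
    using assms by (simp add: powr_power)
  then show ?thesis using assms by (simp add: powr_minus_divide)
qed

lemma norm_R_sqrt_sq: "\<tau> > 0 \<Longrightarrow> (norm (R_sqrt \<tau> *v p))\<^sup>2 = \<tau> * (norm (rescale \<tau> p))\<^sup>2"
  by (simp add: rescale_def power_mult_distrib powr_neg_half_sq mult.assoc[symmetric])

lemma nu_e1_sq: "\<tau> > 0 \<Longrightarrow> nu \<tau> * (p$1)\<^sup>2 = \<tau> * (rescale \<tau> p $ 1)\<^sup>2"
  using nu_pos[of \<tau>]
  by (simp add: rescale_nth power_mult_distrib powr_neg_half_sq mult.assoc[symmetric])

text \<open>The two axes are scaled separately; the inverse of the product of the two scaling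
  factors is \<open>\<tau> / sqrt (nu \<tau>)\<close>.\<close>

lemma nn_integral_rescale:
  assumes \<tau>: "\<tau> > 0" and [measurable]: "f \<in> borel_measurable borel"
  shows "(\<integral>\<^sup>+p. f (rescale \<tau> p) \<partial>lborel) = ennreal (\<tau> / sqrt (nu \<tau>)) * (\<integral>\<^sup>+u. f u \<partial>lborel)"
proof -
  define a where "a = \<tau> powr (- 1 / 2) * sqrt (nu \<tau>)"
  define b where "b = \<tau> powr (- 1 / 2)"
  have ab: "a > 0" "b > 0" using \<tau> nu_pos[of \<tau>] by (auto simp: a_def b_def)
  have aff: "(\<integral>\<^sup>+x. g (c * x) \<partial>lborel) = ennreal (1 / c) * (\<integral>\<^sup>+x. g x \<partial>lborel)"
    if c: "c > 0" and [measurable]: "g \<in> borel_measurable borel" for c :: real and g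
  proof -
    have "ennreal (1 / c) * (\<integral>\<^sup>+x. g x \<partial>lborel) = ennreal (1 / c) * (ennreal c * (\<integral>\<^sup>+x. g (c * x) \<partial>lborel))"
      using c by (subst nn_integral_real_affine[of g c 0]) auto
    also have "\<dots> = (\<integral>\<^sup>+x. g (c * x) \<partial>lborel)"
      using c by (simp add: mult.assoc[symmetric] ennreal_mult[symmetric])
    finally show ?thesis ..
  qed
  have "(\<integral>\<^sup>+p. f (rescale \<tau> p) \<partial>lborel) = (\<integral>\<^sup>+x. \<integral>\<^sup>+y. f (vector [a * x, b * y]) \<partial>lborel \<partial>lborel)"
    by (subst nn_integral_real2) (simp_all add: rescale_eq a_def b_def)
  also have "\<dots> = (\<integral>\<^sup>+x. ennreal (1 / b) * (\<integral>\<^sup>+y. f (vector [a * x, y]) \<partial>lborel) \<partial>lborel)"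
    using ab by (subst aff) auto
  also have "\<dots> = ennreal (1 / b) * (\<integral>\<^sup>+x. \<integral>\<^sup>+y. f (vector [a * x, y]) \<partial>lborel \<partial>lborel)"
    by (simp add: nn_integral_cmult)
  also have "(\<integral>\<^sup>+x. \<integral>\<^sup>+y. f (vector [a * x, y]) \<partial>lborel \<partial>lborel) = ennreal (1 / a) * (\<integral>\<^sup>+x. \<integral>\<^sup>+y. f (vector [x, y]) \<partial>lborel \<partial>lborel)"
    using ab by (subst aff[where g="\<lambda>x. \<integral>\<^sup>+y. f (vector [x, y]) \<partial>lborel"]) auto
  also have "ennreal (1 / b) * (ennreal (1 / a) * (\<integral>\<^sup>+x. \<integral>\<^sup>+y. f (vector [x, y]) \<partial>lborel \<partial>lborel))
     = ennreal (1 / (a * b)) * (\<integral>\<^sup>+u. f u \<partial>lborel)"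
    using ab by (simp add: nn_integral_real2 mult.assoc[symmetric] ennreal_mult[symmetric] mult.commute)
  also have "1 / (a * b) = \<tau> / sqrt (nu \<tau>)"
    using powr_neg_half_sq[OF \<tau>] nu_pos[of \<tau>] \<tau>
    by (simp add: a_def b_def field_simps power2_eq_square)
  finally show ?thesis .
qed

section \<open>The Fourier transform of the mollifier\<close>

lemma mollifierD:
  assumes "mollifier \<rho>"
  shows "integrable lborel \<rho>" "\<And>x. \<rho> x \<ge> 0" "\<And>x. \<rho> (- x) = \<rho> x" "(LINT x|lborel. \<rho> x) = 1"
    "(\<integral>\<^sup>+x. ennreal ((\<rho> x)\<^sup>2) \<partial>lborel) = 1"
    "\<exists>B\<ge>0. \<forall>x. \<rho> x \<noteq> 0 \<longrightarrow> norm x \<le> B"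
proof -
  show 1: "\<And>x. \<rho> x \<ge> 0" "\<And>x. \<rho> (- x) = \<rho> x" "(LINT x|lborel. \<rho> x) = 1"
    using assms by (auto simp: mollifier_def)
  \<comment> \<open>The integral equals \<open>1\<close>, whereas a non-integrable function would
    receive the default value \<open>0\<close>. The same argument serves for the square of
    \<rho>.\<close>
  show "integrable lborel \<rho>"
    using 1(3) not_integrable_integral_eq by fastforce
  have 2: "(LINT x|lborel. (\<rho> x)\<^sup>2) = 1"
    using assms by (simp add: mollifier_def)
  then have "integrable lborel (\<lambda>x. (\<rho> x)\<^sup>2)"
    using not_integrable_integral_eq by fastforce
  then show "(\<integral>\<^sup>+x. ennreal ((\<rho> x)\<^sup>2) \<partial>lborel) = 1"
    using 2 by (subst nn_integral_eq_integral) auto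
  have "bounded (closure {x. \<rho> x \<noteq> 0})"
    using assms compact_imp_bounded by (auto simp: mollifier_def)
  then obtain B where "\<forall>x\<in>closure {x. \<rho> x \<noteq> 0}. norm x \<le> B"
    by (auto simp: bounded_iff)
  then have "\<forall>x. \<rho> x \<noteq> 0 \<longrightarrow> norm x \<le> max 0 B"
    using closure_subset[of "{x. \<rho> x \<noteq> 0}"] by fastforce
  then show "\<exists>B\<ge>0. \<forall>x. \<rho> x \<noteq> 0 \<longrightarrow> norm x \<le> B"
    by (intro exI[of _ "max 0 B"]) auto
qed

lemma Theta_eq:
  assumes "mollifier \<rho>"
  shows "Theta \<rho> \<tau> p = (cosine_transform \<rho> (rescale \<tau> p))\<^sup>2"
proof -
  note \<rho> = mollifierD[OF assms]
  have [measurable]: "\<rho> \<in> borel_measurable borel" using \<rho>(1) by auto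
  have i: "integrable lborel (\<lambda>x. complex_of_real (\<rho> x) * exp (- \<i> * complex_of_real (u \<bullet> x)))" for u
    by (rule Bochner_Integration.integrable_bound[OF \<rho>(1)]) (auto simp: norm_mult)
  have "fourier (\<lambda>x. complex_of_real (\<rho> x)) u = complex_of_real (cosine_transform \<rho> u / (2 * pi))" for u
  proof -
    let ?z = "LINT x|lborel. complex_of_real (\<rho> x) * exp (- \<i> * complex_of_real (u \<bullet> x))"
    have re: "Re ?z = cosine_transform \<rho> u"
      unfolding cosine_transform_def
      by (subst integral_Re[OF i, symmetric]) (simp add: Re_exp)
    \<comment> \<open>The substitution of \<open>- x\<close> for \<open>x\<close> turns the
      imaginary part into its own negative, because \<rho> is even and the sine is odd.\<close>
    have "Im ?z = (LINT x|lborel. - \<rho> x * sin (u \<bullet> x))"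
      by (subst integral_Im[OF i, symmetric]) (simp add: Im_exp)
    also have "\<dots> = (LINT x|density (distr lborel borel (\<lambda>x. 0 + (- 1) *\<^sub>R x)) (\<lambda>_. ennreal (\<bar>- 1\<bar> ^ DIM(real^2))). - \<rho> x * sin (u \<bullet> x))"
      by (subst lborel_affine[of "- 1" 0]) auto
    also have "\<dots> = (LINT x|lborel. \<rho> x * sin (u \<bullet> x))"
      by (simp add: integral_density integral_distr \<rho>(3) density_1)
    also have "\<dots> = - (LINT x|lborel. - \<rho> x * sin (u \<bullet> x))"
      by simp
    also have "(LINT x|lborel. - \<rho> x * sin (u \<bullet> x)) = Im ?z"
      by (subst integral_Im[OF i, symmetric]) (simp add: Im_exp)
    finally have im: "Im ?z = 0" by linarith
    have "?z = complex_of_real (cosine_transform \<rho> u)"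
      using re im by (simp add: complex_eq_iff)
    then show ?thesis
      by (simp add: fourier_def powr_minus field_simps)
  qed
  then show ?thesis
    unfolding Theta_def rescale_def[symmetric] by (simp add: power_divide[symmetric])
qed

lemma borel_measurable_cosine_transform:
  assumes [measurable]: "\<rho> \<in> borel_measurable borel"
  shows "cosine_transform \<rho> \<in> borel_measurable borel"
  unfolding cosine_transform_def[abs_def] by measurable

lemma mollifier_cosine_transform:
  assumes "mollifier \<rho>"
  shows "cosine_transform \<rho> \<in> borel_measurable borel"
    and "(cosine_transform \<rho> u)\<^sup>2 \<le> 1"
    and "(\<integral>\<^sup>+u. ennreal ((cosine_transform \<rho> u)\<^sup>2) \<partial>lborel) \<le> ennreal ((2 * pi)\<^sup>2)"
    and "\<exists>L\<ge>0. \<forall>u. \<bar>(cosine_transform \<rho> u)\<^sup>2 - 1\<bar> \<le> L * norm u"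
proof -
  note \<rho> = mollifierD[OF assms]
  have [measurable]: "\<rho> \<in> borel_measurable borel" using \<rho>(1) by auto
  let ?c = "cosine_transform \<rho>"
  show "?c \<in> borel_measurable borel"
    by (rule borel_measurable_cosine_transform) simp
  have ic: "integrable lborel (\<lambda>x. \<rho> x * cos (u \<bullet> x))" for u
    by (rule Bochner_Integration.integrable_bound[OF \<rho>(1)])
       (auto simp: abs_mult \<rho>(2) intro!: mult_left_le)
  have c1: "\<bar>?c u\<bar> \<le> 1" for u
  proof -
    have "\<bar>?c u\<bar> \<le> (LINT x|lborel. \<bar>\<rho> x * cos (u \<bullet> x)\<bar>)"
      unfolding cosine_transform_def using integral_norm_bound[of lborel "\<lambda>x. \<rho> x * cos (u \<bullet> x)"] by simp
    also have "\<dots> \<le> (LINT x|lborel. \<rho> x)"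
      by (intro integral_mono \<rho>(1) integrable_abs ic) (auto simp: abs_mult \<rho>(2) intro!: mult_left_le)
    finally show ?thesis by (simp add: \<rho>(4))
  qed
  then show "(?c u)\<^sup>2 \<le> 1" by (simp add: abs_square_le_1)
  show "(\<integral>\<^sup>+u. ennreal ((?c u)\<^sup>2) \<partial>lborel) \<le> ennreal ((2 * pi)\<^sup>2)"
    using cosine_transform_L2_le[OF \<rho>(1,2)] by (simp add: cosine_transform_def \<rho>(5))
  obtain B where B: "B \<ge> 0" "\<And>x. \<rho> x \<noteq> 0 \<Longrightarrow> norm x \<le> B" using \<rho>(6) by blast
  \<comment> \<open>Here \<open>B\<close> is the radius of a ball containing the support of \<rho>,
    so \<open>1 - c\<close> is at most \<open>B\<close> times the norm of \<open>u\<close>; the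
    factor \<open>2\<close> bounds \<open>c + 1\<close>.\<close>
  have "\<bar>(?c u)\<^sup>2 - 1\<bar> \<le> (2 * B) * norm u" for u
  proof -
    have "1 - ?c u = (LINT x|lborel. \<rho> x * (1 - cos (u \<bullet> x)))"
      using ic[of u] \<rho>(1,4) by (simp add: cosine_transform_def right_diff_distrib)
    also have "\<dots> \<le> (LINT x|lborel. \<rho> x * (norm u * B))"
    proof (intro integral_mono)
      show "integrable lborel (\<lambda>x. \<rho> x * (1 - cos (u \<bullet> x)))"
        using ic[of u] \<rho>(1) by (simp add: right_diff_distrib)
      show "integrable lborel (\<lambda>x. \<rho> x * (norm u * B))" using \<rho>(1) by simp
      fix x
      have "1 - cos (u \<bullet> x) = 2 * (sin ((u \<bullet> x) / 2))\<^sup>2"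
        using cos_double_sin[of "(u \<bullet> x) / 2"] by simp
      \<comment> \<open>One of the two sine factors is discarded: a bound linear in the angle is
        what is wanted.\<close>
      also have "\<dots> \<le> 2 * \<bar>sin ((u \<bullet> x) / 2)\<bar>"
        using mult_left_le[OF abs_sin_le_one[of "(u \<bullet> x) / 2"], of "\<bar>sin ((u \<bullet> x) / 2)\<bar>"]
        by (simp only: power2_eq_square abs_mult_self_eq abs_ge_zero) simp
      also have "\<dots> \<le> \<bar>u \<bullet> x\<bar>"
        using abs_sin_x_le_abs_x[of "(u \<bullet> x) / 2"] by simp
      also have "\<dots> \<le> norm u * norm x" by (rule Cauchy_Schwarz_ineq2)
      finally have 1: "1 - cos (u \<bullet> x) \<le> norm u * norm x" .
      show "\<rho> x * (1 - cos (u \<bullet> x)) \<le> \<rho> x * (norm u * B)"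
      proof (cases "\<rho> x = 0")
        case False
        then have "norm u * norm x \<le> norm u * B" using B by (intro mult_left_mono) auto
        with 1 show ?thesis using \<rho>(2)[of x] by (intro mult_left_mono) auto
      qed simp
    qed
    also have "\<dots> = norm u * B" by (simp add: \<rho>(4))
    finally have 1: "1 - ?c u \<le> norm u * B" .
    have "\<bar>(?c u)\<^sup>2 - 1\<bar> = \<bar>?c u + 1\<bar> * \<bar>?c u - 1\<bar>"
      by (simp add: abs_mult[symmetric] power2_eq_square algebra_simps)
    also have "\<dots> \<le> 2 * (norm u * B)"
      using c1[of u] 1 by (intro mult_mono) auto
    finally show ?thesis by (simp add: mult_ac)
  qed
  then show "\<exists>L\<ge>0. \<forall>u. \<bar>(?c u)\<^sup>2 - 1\<bar> \<le> L * norm u"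
    using B(1) by (intro exI[of _ "2 * B"]) auto
qed

section \<open>Integrals of coordinate powers over discs\<close>

lemma nn_integral_abs_powr:
  fixes s a :: real
  assumes a: "0 \<le> a" "a < 1" and s: "s \<ge> 0"
  shows "(\<integral>\<^sup>+x. indicator {- s..s} x * ennreal (\<bar>x\<bar> powr (- a)) \<partial>lborel) \<le> ennreal (2 / (1 - a) * s powr (1 - a))"
proof -
  let ?f = "\<lambda>x::real. if x \<in> {0..s} then x powr (- a) else 0"
  have "(?f has_integral (s powr (1 - a) / (1 - a))) UNIV"
    using has_integral_powr_from_0[of "- a" s] a s has_integral_restrict_UNIV[of "{0..s}" "\<lambda>x. x powr (- a)"] by simp
  then have 1: "(\<integral>\<^sup>+x. ennreal (?f x) \<partial>lborel) = ennreal (s powr (1 - a) / (1 - a))"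
    by (intro nn_integral_has_integral_lborel) auto
  have "(\<integral>\<^sup>+x. indicator {- s..s} x * ennreal (\<bar>x\<bar> powr (- a)) \<partial>lborel) \<le> (\<integral>\<^sup>+x. ennreal (?f x) + ennreal (?f (0 - x)) \<partial>lborel)"
    by (intro nn_integral_mono) (auto simp: indicator_def)
  also have "\<dots> = (\<integral>\<^sup>+x. ennreal (?f x) \<partial>lborel) + (\<integral>\<^sup>+x. ennreal (?f (0 - x)) \<partial>lborel)"
    by (intro nn_integral_add) auto
  also have "\<dots> = ennreal (s powr (1 - a) / (1 - a)) + ennreal (s powr (1 - a) / (1 - a))"
    by (subst nn_integral_lborel_shift(2)[where f="\<lambda>x. ennreal (?f x)"]) (simp, simp only: 1)
  also have "\<dots> = ennreal (2 / (1 - a) * s powr (1 - a))"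
    using a by (subst ennreal_plus[symmetric]) auto
  finally show ?thesis .
qed

text \<open>The disc is enlarged to the square of half-width \<open>sqrt \<xi>\<close>, on which the
  integrand factorises. The exponent of \<xi> is the one dictated by scaling: the area contributes
  \<open>1\<close> and the singularities remove \<open>(a + c) / 2\<close>.\<close>

lemma nn_integral_disc_powr:
  fixes a c \<xi> :: real
  assumes a: "0 \<le> a" "a < 1" and c: "0 \<le> c" "c < 1" and \<xi>: "\<xi> \<ge> 0"
  shows "(\<integral>\<^sup>+u. indicator {u. (norm u)\<^sup>2 \<le> \<xi>} u * ennreal (\<bar>u$1\<bar> powr (- a) * \<bar>u$2\<bar> powr (- c)) \<partial>(lborel::(real^2) measure))
    \<le> ennreal (4 / ((1 - a) * (1 - c)) * \<xi> powr (1 - (a + c) / 2))"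
proof -
  let ?s = "sqrt \<xi>"
  have s: "?s \<ge> 0" using \<xi> by simp
  have "(\<integral>\<^sup>+u. indicator {u. (norm u)\<^sup>2 \<le> \<xi>} u * ennreal (\<bar>u$1\<bar> powr (- a) * \<bar>u$2\<bar> powr (- c)) \<partial>(lborel::(real^2) measure))
    \<le> (\<integral>\<^sup>+u. (indicator {- ?s..?s} (u$1) * ennreal (\<bar>u$1\<bar> powr (- a))) * (indicator {- ?s..?s} (u$2) * ennreal (\<bar>u$2\<bar> powr (- c))) \<partial>(lborel::(real^2) measure))"
  proof (intro nn_integral_mono)
    fix u :: "real^2"
    have "\<bar>u$1\<bar> \<le> ?s" "\<bar>u$2\<bar> \<le> ?s" if "(norm u)\<^sup>2 \<le> \<xi>"
      using that unfolding norm_real2_sq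
      by (auto intro!: real_le_rsqrt) (smt (verit) zero_le_power2)+
    then show "indicator {u. (norm u)\<^sup>2 \<le> \<xi>} u * ennreal (\<bar>u$1\<bar> powr (- a) * \<bar>u$2\<bar> powr (- c))
      \<le> (indicator {- ?s..?s} (u$1) * ennreal (\<bar>u$1\<bar> powr (- a))) * (indicator {- ?s..?s} (u$2) * ennreal (\<bar>u$2\<bar> powr (- c)))"
      by (auto simp: indicator_def ennreal_mult abs_le_iff)
  qed
  also have "\<dots> = (\<integral>\<^sup>+x. indicator {- ?s..?s} x * ennreal (\<bar>x\<bar> powr (- a)) \<partial>lborel) * (\<integral>\<^sup>+x. indicator {- ?s..?s} x * ennreal (\<bar>x\<bar> powr (- c)) \<partial>lborel)"
    by (rule nn_integral_real2_prod) auto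
  also have "\<dots> \<le> ennreal (2 / (1 - a) * ?s powr (1 - a)) * ennreal (2 / (1 - c) * ?s powr (1 - c))"
    by (intro mult_mono nn_integral_abs_powr a c s) auto
  also have "\<dots> = ennreal (4 / ((1 - a) * (1 - c)) * (?s powr (1 - a) * ?s powr (1 - c)))"
    using a c by (subst ennreal_mult[symmetric]) auto
  also have "?s powr (1 - a) * ?s powr (1 - c) = \<xi> powr (1 - (a + c) / 2)"
  proof -
    have "?s powr x = \<xi> powr (x / 2)" for x
      using \<xi> by (simp add: powr_half_sqrt[symmetric] powr_powr)
    moreover have "(1 - a) / 2 + (1 - c) / 2 = 1 - (a + c) / 2" by (simp add: field_simps)
    ultimately show ?thesis by (simp only: powr_add[symmetric])
  qed
  finally show ?thesis .
qed

section \<open>Disintegration over fibres of fixed total momentum\<close>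

abbreviation PiR2 :: "nat set \<Rightarrow> (nat \<Rightarrow> real^2) measure" where
  "PiR2 A \<equiv> PiM A (\<lambda>_. lborel)"

interpretation PiR2: product_sigma_finite "\<lambda>_::nat. lborel :: (real^2) measure"
  by standard

lemma measurable_PiR2_component:
  assumes "i \<in> A" and g: "g \<in> measurable borel N"
  shows "(\<lambda>p. g (p i)) \<in> measurable (PiR2 A) N"
proof (rule measurable_compose[OF _ g])
  show "(\<lambda>p. p i) \<in> measurable (PiR2 A) borel"
    using measurable_component_singleton[OF assms(1), of "\<lambda>_. lborel :: (real^2) measure"]
    by (subst measurable_cong_sets[OF refl sets_lborel[symmetric]])
qed

lemma sigma_finite_PiR2: "finite A \<Longrightarrow> sigma_finite_measure (PiR2 A)"
  by (rule PiR2.sigma_finite)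

text \<open>The coordinate \<open>i0\<close> is singled out because it is the one to be traded for a
  total momentum, among the arguments of \<open>f\<close> in \<open>nn_integral_leb_glue\<close> and
  among the outgoing momenta in \<open>nn_integral_joined_args\<close>.\<close>

lemma nn_integral_PiR2_split:
  assumes fin: "finite A" "finite B" and disj: "A \<inter> B = {}" "i0 \<notin> A" "i0 \<notin> B"
    and f [measurable]: "f \<in> borel_measurable (PiR2 (A \<union> insert i0 B))"
  shows "(\<integral>\<^sup>+p. f p \<partial>PiR2 (A \<union> insert i0 B)) =
    (\<integral>\<^sup>+x. \<integral>\<^sup>+t. \<integral>\<^sup>+y. f (merge A (insert i0 B) (x, y(i0 := t))) \<partial>PiR2 B \<partial>lborel \<partial>PiR2 A)"
proof -
  have "(\<integral>\<^sup>+p. f p \<partial>PiR2 (A \<union> insert i0 B)) =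
    (\<integral>\<^sup>+x. \<integral>\<^sup>+y. f (merge A (insert i0 B) (x, y)) \<partial>PiR2 (insert i0 B) \<partial>PiR2 A)"
    using fin disj f by (intro PiR2.product_nn_integral_fold) auto
  also have "\<dots> = (\<integral>\<^sup>+x. \<integral>\<^sup>+t. \<integral>\<^sup>+y. f (merge A (insert i0 B) (x, y(i0 := t))) \<partial>PiR2 B \<partial>lborel \<partial>PiR2 A)"
  proof (intro nn_integral_cong)
    fix x assume x: "x \<in> space (PiR2 A)"
    have "(\<lambda>y. f (merge A (insert i0 B) (x, y))) \<in> borel_measurable (PiR2 (insert i0 B))"
      using x by measurable
    then show "(\<integral>\<^sup>+y. f (merge A (insert i0 B) (x, y)) \<partial>PiR2 (insert i0 B)) =
      (\<integral>\<^sup>+t. \<integral>\<^sup>+y. f (merge A (insert i0 B) (x, y(i0 := t))) \<partial>PiR2 B \<partial>lborel)"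
      using fin disj by (subst PiR2.product_nn_integral_insert_rev) auto
  qed
  finally show ?thesis .
qed

text \<open>The product measure is determined by finite rectangles, and a bijection of the indices
  only permutes the factors. It is needed to rename the momenta outside \<open>I\<close> as the
  trailing arguments of a function on the \<open>n\<close>-th chaos.\<close>

lemma distr_PiR2_reindex:
  assumes h: "bij_betw h A B" and fin: "finite A"
  shows "distr (PiR2 B) (PiR2 A) (\<lambda>y. \<lambda>i\<in>A. y (h i)) = PiR2 A"
proof (rule PiR2.PiM_eqI)
  have finB: "finite B" using h fin bij_betw_finite by blast
  have hB: "h i \<in> B" if "i \<in> A" for i using h that by (auto simp: bij_betw_def)
  have m: "(\<lambda>y. \<lambda>i\<in>A. y (h i)) \<in> measurable (PiR2 B) (PiR2 A)"
    by (intro measurable_restrict measurable_component_singleton hB)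
  fix S :: "nat \<Rightarrow> (real^2) set" assume S: "\<And>i. i \<in> A \<Longrightarrow> S i \<in> sets lborel"
  define g where "g = the_inv_into A h"
  have g: "g b \<in> A" "h (g b) = b" if "b \<in> B" for b
    using that h by (auto simp: g_def bij_betw_def the_inv_into_into f_the_inv_into_f)
  have gh: "g (h i) = i" if "i \<in> A" for i
    using that h by (auto simp: g_def bij_betw_def the_inv_into_f_f)
  have eq: "(\<lambda>y. \<lambda>i\<in>A. y (h i)) -` Pi\<^sub>E A S \<inter> space (PiR2 B) = Pi\<^sub>E B (\<lambda>b. S (g b))"
  proof -
    have "x (h i) \<in> S i" if "\<And>b. b \<in> B \<Longrightarrow> x b \<in> S (g b)" "i \<in> A" for x i
      using that(1)[OF hB[OF that(2)]] gh[OF that(2)] by simp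
    moreover have "x b \<in> S (g b)" if "\<And>i. i \<in> A \<Longrightarrow> x (h i) \<in> S i" "b \<in> B" for x b
      using that(1)[OF g(1)[OF that(2)]] g(2)[OF that(2)] by simp
    ultimately show ?thesis
      using hB g by (auto simp: space_PiM PiE_iff extensional_def)
  qed
  have "emeasure (distr (PiR2 B) (PiR2 A) (\<lambda>y. \<lambda>i\<in>A. y (h i))) (Pi\<^sub>E A S) = emeasure (PiR2 B) (Pi\<^sub>E B (\<lambda>b. S (g b)))"
    using S fin by (subst emeasure_distr[OF m]) (auto simp: eq intro!: sets_PiM_I_finite)
  also have "\<dots> = (\<Prod>b\<in>B. emeasure lborel (S (g b)))"
    using S g finB by (intro PiR2.emeasure_PiM) auto
  also have "\<dots> = (\<Prod>i\<in>A. emeasure lborel (S i))"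
    using prod.reindex_bij_betw[OF h, of "\<lambda>b. emeasure lborel (S (g b))"] gh by (simp cong: prod.cong)
  finally show "emeasure (distr (PiR2 B) (PiR2 A) (\<lambda>y. \<lambda>i\<in>A. y (h i))) (Pi\<^sub>E A S) = (\<Prod>i\<in>A. emeasure lborel (S i))" .
qed (use fin in auto)

section \<open>Coordinates adapted to a fibre\<close>

definition glue :: "nat \<Rightarrow> nat \<Rightarrow> real^2 \<Rightarrow> (nat \<Rightarrow> real^2) \<Rightarrow> (nat \<Rightarrow> real^2) \<Rightarrow> (nat \<Rightarrow> real^2)" where
  "glue j n q r z = (\<lambda>i\<in>{1..n}. if i \<le> j then r i else if i = Suc j then q - (\<Sum>i=1..j. r i) else z i)"

lemma measurable_glue [measurable (raw)]:
  assumes j: "j < n" and [measurable]: "q \<in> borel_measurable M"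
    and r: "r \<in> measurable M (PiR2 {1..j})" and z: "z \<in> measurable M (PiR2 {Suc (Suc j)..n})"
  shows "(\<lambda>x. glue j n (q x) (r x) (z x)) \<in> measurable M (PiR2 {1..n})"
proof -
  have r': "(\<lambda>x. r x i) \<in> borel_measurable M" if "i \<in> {1..j}" for i
    using measurable_compose[OF r measurable_component_singleton[OF that]] by simp
  have z': "(\<lambda>x. z x i) \<in> borel_measurable M" if "i \<in> {Suc (Suc j)..n}" for i
    using measurable_compose[OF z measurable_component_singleton[OF that]] by simp
  show ?thesis
    unfolding glue_def
  proof (intro measurable_restrict)
    fix i assume i: "i \<in> {1..n}"
    consider "i \<in> {1..j}" | "i = Suc j" | "i \<in> {Suc (Suc j)..n}" using i by fastforce
    then show "(\<lambda>x. if i \<le> j then r x i else if i = Suc j then q x - sum (r x) {1..j} else z x i) \<in> measurable M lborel"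
      by cases (use r' z' in auto)
  qed
qed

text \<open>Replacing the entry \<open>j + 1\<close> by the total \<open>q\<close> of the first
  \<open>j + 1\<close> entries is a translation for fixed \<open>r\<close>, so no Jacobian
  appears.\<close>

lemma nn_integral_leb_glue:
  assumes j: "j < n" and [measurable]: "f \<in> borel_measurable (leb n)"
  shows "(\<integral>\<^sup>+x. f x \<partial>leb n) = (\<integral>\<^sup>+q. \<integral>\<^sup>+z. \<integral>\<^sup>+r. f (glue j n q r z) \<partial>leb j \<partial>PiR2 {Suc (Suc j)..n} \<partial>lborel)"
proof -
  let ?A = "{1..j}" and ?B = "{Suc (Suc j)..n}"
  interpret A: sigma_finite_measure "PiR2 ?A" by (rule sigma_finite_PiR2) simp
  interpret B: sigma_finite_measure "PiR2 ?B" by (rule sigma_finite_PiR2) simp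
  interpret AB: pair_sigma_finite "PiR2 ?A" "PiR2 ?B" ..
  interpret Al: pair_sigma_finite "PiR2 ?A" "lborel :: (real^2) measure" ..
  have [measurable]: "f \<in> borel_measurable (PiR2 {1..n})" using assms by (simp add: leb_def)
  have un: "{1..n} = ?A \<union> insert (Suc j) ?B" using j by auto
  have f': "f \<in> borel_measurable (PiR2 (?A \<union> insert (Suc j) ?B))"
    using assms(2) by (simp only: un[symmetric] leb_def)
  have "(\<integral>\<^sup>+x. f x \<partial>leb n) = (\<integral>\<^sup>+r. \<integral>\<^sup>+t. \<integral>\<^sup>+z. f (merge ?A (insert (Suc j) ?B) (r, z(Suc j := t))) \<partial>PiR2 ?B \<partial>lborel \<partial>PiR2 ?A)"
    unfolding leb_def un by (rule nn_integral_PiR2_split[OF _ _ _ _ _ f']) auto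
  also have "\<dots> = (\<integral>\<^sup>+r. \<integral>\<^sup>+t. \<integral>\<^sup>+z. f (glue j n (t + (\<Sum>i=1..j. r i)) r z) \<partial>PiR2 ?B \<partial>lborel \<partial>PiR2 ?A)"
    using j by (intro nn_integral_cong arg_cong[of _ _ f]) (auto simp: glue_def merge_def fun_eq_iff)
  also have "\<dots> = (\<integral>\<^sup>+r. \<integral>\<^sup>+q. \<integral>\<^sup>+z. f (glue j n q r z) \<partial>PiR2 ?B \<partial>lborel \<partial>PiR2 ?A)"
  proof (rule nn_integral_cong)
    fix r assume r: "r \<in> space (PiR2 ?A)"
    have "(\<lambda>q. \<integral>\<^sup>+z. f (glue j n q r z) \<partial>PiR2 ?B) \<in> borel_measurable borel"
      using j r by measurable
    from nn_integral_lborel_shift(1)[OF this]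
    show "(\<integral>\<^sup>+t. \<integral>\<^sup>+z. f (glue j n (t + (\<Sum>i=1..j. r i)) r z) \<partial>PiR2 ?B \<partial>lborel) = (\<integral>\<^sup>+q. \<integral>\<^sup>+z. f (glue j n q r z) \<partial>PiR2 ?B \<partial>lborel)" .
  qed
  also have "\<dots> = (\<integral>\<^sup>+q. \<integral>\<^sup>+r. \<integral>\<^sup>+z. f (glue j n q r z) \<partial>PiR2 ?B \<partial>PiR2 ?A \<partial>lborel)"
    using j by (intro Al.Fubini'[symmetric]) measurable
  also have "\<dots> = (\<integral>\<^sup>+q. \<integral>\<^sup>+z. \<integral>\<^sup>+r. f (glue j n q r z) \<partial>PiR2 ?A \<partial>PiR2 ?B \<partial>lborel)"
    using j by (intro nn_integral_cong AB.Fubini'[symmetric]) measurable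
  finally show ?thesis by (simp add: leb_def)
qed

definition rest_index :: "nat \<Rightarrow> nat \<Rightarrow> nat set \<Rightarrow> nat \<Rightarrow> nat" where
  "rest_index j k I i = sorted_list_of_set ({1..k} - I) ! (i - (j + 2))"

definition rest :: "nat \<Rightarrow> nat \<Rightarrow> nat \<Rightarrow> nat set \<Rightarrow> (nat \<Rightarrow> real^2) \<Rightarrow> (nat \<Rightarrow> real^2)" where
  "rest j n k I p = (\<lambda>i\<in>{Suc (Suc j)..n}. p (rest_index j k I i))"

text \<open>The right side separates the three inputs: the total momentum, the fibre point and the
  untouched momenta. Joint measurability is clear in this form.\<close>

lemma joined_args_eq_glue:
  "joined_args j n k I (complete_fibre j q r) p = glue j n q r (rest j n k I p)"
  by (auto simp: joined_args_def glue_def rest_def rest_index_def fun_eq_iff)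

text \<open>The equation \<open>k + Suc j = n + l\<close> says that replacing \<open>j + 1\<close>
  incoming by \<open>l\<close> outgoing momenta leaves the number of untouched momenta the same on
  both sides. It is stated without subtraction on \<open>nat\<close>.\<close>

lemma bij_betw_rest_index:
  assumes j: "j < n" and I: "I \<subseteq> {1..k}" "card I = l" and k: "k + Suc j = n + l"
  shows "bij_betw (rest_index j k I) {Suc (Suc j)..n} ({1..k} - I)"
proof -
  define C where "C = {1..k} - I"
  have "card C = n - Suc j"
    using I k finite_subset[OF I(1)] by (simp add: C_def card_Diff_subset)
  then have "bij_betw (\<lambda>i. i - (j + 2)) {Suc (Suc j)..n} {..<card C}"
    using j by (intro bij_betwI[where g="\<lambda>i. i + (j + 2)"]) auto
  moreover have "bij_betw ((!) (sorted_list_of_set C)) {..<card C} C"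
    by (intro bij_betw_nth) (auto simp: C_def)
  ultimately show ?thesis
    using bij_betw_trans[of "\<lambda>i. i - (j + 2)" "{Suc (Suc j)..n}" "{..<card C}"]
    by (auto simp: rest_index_def[abs_def] comp_def C_def)
qed

text \<open>The fibre variables \<open>r\<close> and the total momentum \<open>q = p\<^bsub>[I]\<^esub>\<close> together make up the first
  \<open>j + 1\<close> arguments of \<open>f\<close>, so only the variables in \<open>I - {i0}\<close> decouple.\<close>

lemma nn_integral_joined_args:
  assumes j: "j < n" and I: "I \<subseteq> {1..k}" "card I = l" "i0 \<in> I" and k: "k + Suc j = n + l"
    and G [measurable]: "\<And>i. G i \<in> borel_measurable borel"
    and f [measurable]: "f \<in> borel_measurable (leb n)"
  shows "(\<integral>\<^sup>+p. (\<Prod>i\<in>I - {i0}. G i (p i)) *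
        (\<integral>\<^sup>+r. f (joined_args j n k I (complete_fibre j (\<Sum>i\<in>I. p i) r) p) \<partial>leb j) \<partial>leb k)
     = (\<Prod>i\<in>I - {i0}. \<integral>\<^sup>+u. G i u \<partial>lborel) * (\<integral>\<^sup>+x. f x \<partial>leb n)"
proof -
  define A where "A = I - {i0}"
  define C where "C = {1..k} - I"
  define B where "B = {Suc (Suc j)..n}"
  define h where "h = rest_index j k I"
  have finI: "finite I" using I finite_subset by blast
  have fin: "finite A" "finite C" "finite B" using finI by (auto simp: A_def C_def B_def)
  have h: "bij_betw h B C"
    unfolding h_def B_def C_def by (rule bij_betw_rest_index[OF j I(1,2) k])
  have hC: "h i \<in> C" if "i \<in> B" for i using h that by (auto simp: bij_betw_def)
  have un: "{1..k} = A \<union> insert i0 C" "A \<inter> C = {}" "i0 \<notin> A" "i0 \<notin> C"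
    using I by (auto simp: A_def C_def)
  interpret A: sigma_finite_measure "PiR2 A" by (rule sigma_finite_PiR2) (simp add: fin)
  interpret B: sigma_finite_measure "PiR2 B" by (rule sigma_finite_PiR2) (simp add: fin)
  interpret C: sigma_finite_measure "PiR2 C" by (rule sigma_finite_PiR2) (simp add: fin)
  interpret J: sigma_finite_measure "PiR2 {1..j}" by (rule sigma_finite_PiR2) simp
  have [measurable]: "f \<in> borel_measurable (PiR2 {1..n})" using f by (simp add: leb_def)
  define pull where "pull = rest j n k I"
  have pull_def: "pull y = (\<lambda>i\<in>B. y (h i))" for y :: "nat \<Rightarrow> real^2"
    by (simp add: pull_def rest_def h_def B_def)
  have pull [measurable]: "pull \<in> measurable (PiR2 C) (PiR2 {Suc (Suc j)..n})"
    unfolding pull_def[abs_def] B_def[symmetric]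
    by (intro measurable_restrict measurable_component_singleton hC)
  have joined: "joined_args j n k I (complete_fibre j q r) p = glue j n q r (pull p)" for q r p
    unfolding joined_args_eq_glue by (simp add: pull_def rest_def h_def B_def)
  have pull_cong: "glue j n q r (pull p) = glue j n q r (pull y)" if "\<And>i. i \<in> C \<Longrightarrow> p i = y i" for q r p y
    using that hC by (auto simp: glue_def pull_def B_def fun_eq_iff)
  define H where "H q y = (\<integral>\<^sup>+r. f (glue j n q r (pull y)) \<partial>PiR2 {1..j})" for q y
  have H_cong: "H q p = H q y" if "\<And>i. i \<in> C \<Longrightarrow> p i = y i" for q p y
    unfolding H_def using pull_cong[OF that] by (simp only:)
  have H [measurable]: "(\<lambda>z. H (fst z) (snd z)) \<in> borel_measurable (borel \<Otimes>\<^sub>M PiR2 C)"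
    unfolding H_def using j by measurable
  have H2 [measurable]: "(\<lambda>q. \<integral>\<^sup>+y. H q y \<partial>PiR2 C) \<in> borel_measurable borel"
    unfolding H_def using j by measurable
  have H1: "H q \<in> borel_measurable (PiR2 C)" for q
    unfolding H_def[abs_def] using j by measurable
  \<comment> \<open>\<open>H q p\<close> reads \<open>p\<close> only on \<open>C\<close>, so one may
    restrict \<open>p\<close> to \<open>C\<close> before applying the joint measurability of
    \<open>H\<close>.\<close>
  have HK: "(\<lambda>p. H (\<Sum>i\<in>I. p i) p) \<in> borel_measurable (PiR2 {1..k})"
  proof -
    have "(\<lambda>p. H (\<Sum>i\<in>I. p i) (restrict p C)) \<in> borel_measurable (PiR2 {1..k})"
    proof (rule measurable_compose[OF _ H, where f="\<lambda>p. (\<Sum>i\<in>I. p i, restrict p C)", simplified])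
      have "(\<lambda>p. \<Sum>i\<in>I. p i) \<in> borel_measurable (PiR2 {1..k})"
        using I by (intro borel_measurable_sum measurable_component_singleton[where M="\<lambda>_. lborel", simplified]) auto
      moreover have "(\<lambda>p. restrict p C) \<in> measurable (PiR2 {1..k}) (PiR2 C)"
        by (rule measurable_restrict_subset) (auto simp: C_def)
      ultimately show "(\<lambda>p. (\<Sum>i\<in>I. p i, restrict p C)) \<in> measurable (PiR2 {1..k}) (borel \<Otimes>\<^sub>M PiR2 C)"
        by measurable
    qed
    moreover have "H q (restrict p C) = H q p" for q p
      by (rule H_cong) simp
    ultimately show ?thesis by (simp only:)
  qed
  have "(\<integral>\<^sup>+p. (\<Prod>i\<in>A. G i (p i)) * H (\<Sum>i\<in>I. p i) p \<partial>PiR2 {1..k}) =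
    (\<integral>\<^sup>+x. \<integral>\<^sup>+t. \<integral>\<^sup>+y. (\<Prod>i\<in>A. G i (merge A (insert i0 C) (x, y(i0 := t)) i)) * H (\<Sum>i\<in>I. merge A (insert i0 C) (x, y(i0 := t)) i) (merge A (insert i0 C) (x, y(i0 := t))) \<partial>PiR2 C \<partial>lborel \<partial>PiR2 A)"
    unfolding un(1)
  proof (rule nn_integral_PiR2_split)
    have "(\<lambda>p. \<Prod>i\<in>A. G i (p i)) \<in> borel_measurable (PiR2 {1..k})"
      using un by (intro borel_measurable_prod_ennreal measurable_PiR2_component G) auto
    then show "(\<lambda>p. (\<Prod>i\<in>A. G i (p i)) * H (\<Sum>i\<in>I. p i) p) \<in> borel_measurable (PiR2 (A \<union> insert i0 C))"
      unfolding un(1)[symmetric] using HK by measurable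
  qed (use un fin in auto)
  also have "\<dots> = (\<integral>\<^sup>+x. \<integral>\<^sup>+t. \<integral>\<^sup>+y. (\<Prod>i\<in>A. G i (x i)) * H (t + (\<Sum>i\<in>A. x i)) y \<partial>PiR2 C \<partial>lborel \<partial>PiR2 A)"
  proof (intro nn_integral_cong)
    fix x y :: "nat \<Rightarrow> real^2" and t :: "real^2"
    let ?m = "merge A (insert i0 C) (x, y(i0 := t))"
    have mA: "?m i = x i" if "i \<in> A" for i using that by (simp add: merge_def)
    have mC: "?m i = y i" if "i \<in> C" for i using that un by (auto simp: merge_def)
    have "(\<Sum>i\<in>I. ?m i) = ?m i0 + (\<Sum>i\<in>A. ?m i)"
      unfolding A_def using finI I by (intro sum.remove) auto
    also have "\<dots> = t + (\<Sum>i\<in>A. x i)"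
      using un by (simp add: mA merge_def)
    finally show "(\<Prod>i\<in>A. G i (?m i)) * H (\<Sum>i\<in>I. ?m i) ?m = (\<Prod>i\<in>A. G i (x i)) * H (t + (\<Sum>i\<in>A. x i)) y"
      by (simp add: mA H_cong[of ?m y, OF mC])
  qed
  also have "\<dots> = (\<integral>\<^sup>+x. (\<Prod>i\<in>A. G i (x i)) * (\<integral>\<^sup>+t. \<integral>\<^sup>+y. H (t + (\<Sum>i\<in>A. x i)) y \<partial>PiR2 C \<partial>lborel) \<partial>PiR2 A)"
  proof (rule nn_integral_cong)
    fix x
    have "(\<lambda>t. \<integral>\<^sup>+y. H (t + (\<Sum>i\<in>A. x i)) y \<partial>PiR2 C) \<in> borel_measurable lborel"
      by (rule measurable_compose[OF _ H2]) simp
    then show "(\<integral>\<^sup>+t. \<integral>\<^sup>+y. (\<Prod>i\<in>A. G i (x i)) * H (t + (\<Sum>i\<in>A. x i)) y \<partial>PiR2 C \<partial>lborel) =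
      (\<Prod>i\<in>A. G i (x i)) * (\<integral>\<^sup>+t. \<integral>\<^sup>+y. H (t + (\<Sum>i\<in>A. x i)) y \<partial>PiR2 C \<partial>lborel)"
      by (simp only: nn_integral_cmult[OF H1] nn_integral_cmult)
  qed
  \<comment> \<open>Translation invariance in \<open>t\<close> removes the sum over
    \<open>A\<close>; from here on the integral over \<open>A\<close> no longer interacts with the
    rest.\<close>
  also have "\<dots> = (\<integral>\<^sup>+x. (\<Prod>i\<in>A. G i (x i)) * (\<integral>\<^sup>+q. \<integral>\<^sup>+y. H q y \<partial>PiR2 C \<partial>lborel) \<partial>PiR2 A)"
    by (simp only: nn_integral_lborel_shift(1)[OF H2])
  also have "\<dots> = (\<integral>\<^sup>+x. (\<Prod>i\<in>A. G i (x i)) \<partial>PiR2 A) * (\<integral>\<^sup>+q. \<integral>\<^sup>+y. H q y \<partial>PiR2 C \<partial>lborel)"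
  proof (rule nn_integral_multc)
    show "(\<lambda>x. \<Prod>i\<in>A. G i (x i)) \<in> borel_measurable (PiR2 A)"
      by (intro borel_measurable_prod_ennreal measurable_PiR2_component G)
  qed
  also have "(\<integral>\<^sup>+x. (\<Prod>i\<in>A. G i (x i)) \<partial>PiR2 A) = (\<Prod>i\<in>A. \<integral>\<^sup>+u. G i u \<partial>lborel)"
    using fin by (intro PiR2.product_nn_integral_prod) auto
  also have "(\<integral>\<^sup>+q. \<integral>\<^sup>+y. H q y \<partial>PiR2 C \<partial>lborel) = (\<integral>\<^sup>+q. \<integral>\<^sup>+z. \<integral>\<^sup>+r. f (glue j n q r z) \<partial>PiR2 {1..j} \<partial>PiR2 B \<partial>lborel)"
  proof (rule nn_integral_cong)
    fix q :: "real^2"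
    have "(\<integral>\<^sup>+z. \<integral>\<^sup>+r. f (glue j n q r z) \<partial>PiR2 {1..j} \<partial>PiR2 B) = (\<integral>\<^sup>+z. \<integral>\<^sup>+r. f (glue j n q r z) \<partial>PiR2 {1..j} \<partial>distr (PiR2 C) (PiR2 B) pull)"
      unfolding pull_def[abs_def] using distr_PiR2_reindex[OF h] fin by simp
    also have "\<dots> = (\<integral>\<^sup>+y. H q y \<partial>PiR2 C)"
      unfolding H_def B_def using j by (intro nn_integral_distr) measurable
    finally show "(\<integral>\<^sup>+y. H q y \<partial>PiR2 C) = (\<integral>\<^sup>+z. \<integral>\<^sup>+r. f (glue j n q r z) \<partial>PiR2 {1..j} \<partial>PiR2 B)" ..
  qed
  also have "\<dots> = (\<integral>\<^sup>+x. f x \<partial>leb n)"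
    unfolding B_def by (subst nn_integral_leb_glue[OF j f]) (simp add: leb_def)
  finally show ?thesis
    unfolding joined H_def A_def leb_def .
qed

section \<open>Cauchy--Schwarz on a fibre\<close>

lemma ennreal_sq: "x \<ge> 0 \<Longrightarrow> (ennreal x)\<^sup>2 = ennreal (x\<^sup>2)"
  by (simp add: ennreal_power)

lemma borel_measurable_leb_component:
  assumes "i \<in> {1..n}"
  shows "(\<lambda>x. x i) \<in> borel_measurable (leb n)"
  unfolding leb_def using measurable_PiR2_component[OF assms measurable_ident] by (simp add: id_def)

lemma borel_measurable_complete_fibre:
  assumes "i \<in> {1..Suc j}"
  shows "(\<lambda>r. (complete_fibre j q r) i) \<in> borel_measurable (leb j)"
proof (cases "i = Suc j")
  case True
  then show ?thesis
    by (auto intro!: borel_measurable_diff borel_measurable_sum borel_measurable_leb_component)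
next
  case False
  then show ?thesis using assms borel_measurable_leb_component[of i j] by simp
qed

text \<open>Multiplying the integrand by the square root of a quantity that is at least
  \<open>1\<close> wherever \<open>g\<close> does not vanish allows it to be split into
  \<open>sqrt (P * H)\<close> and the square root of \<open>P\<close> times \<open>w\<close> times
  the square of \<open>cmod g\<close>. Only the first \<open>j\<close> entries are independent; the
  \<open>Theta\<close> factor at the determined entry is bounded by \<open>1\<close>, so the first
  integral is a product over single variables.\<close>

lemma fibre_integral_Cauchy_Schwarz:
  fixes h :: "nat \<Rightarrow> real^2 \<Rightarrow> real" and w :: "(nat \<Rightarrow> real^2) \<Rightarrow> real" and g :: "(nat \<Rightarrow> real^2) \<Rightarrow> complex"
    and q :: "real^2" and j :: nat
  assumes T [measurable]: "Theta \<rho> \<tau> \<in> borel_measurable borel"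
    and T01: "\<And>u. 0 \<le> Theta \<rho> \<tau> u" "\<And>u. Theta \<rho> \<tau> u \<le> 1"
    and h [measurable]: "\<And>i. h i \<in> borel_measurable borel" and h0: "\<And>i u. 0 \<le> h i u"
    and w0: "\<And>r. 0 \<le> w r"
  defines "ext \<equiv> \<lambda>r. (complete_fibre j q r)"
  assumes wm [measurable]: "(\<lambda>r. w (ext r)) \<in> borel_measurable (leb j)"
    and gm [measurable]: "(\<lambda>r. g (ext r)) \<in> borel_measurable (leb j)"
    and hw: "AE r in leb j. g (ext r) = 0 \<or> 1 \<le> (\<Prod>i=1..j. h i (r i)) * w (ext r)"
  shows "ennreal ((cmod (fibre_integral \<rho> \<tau> j q g))\<^sup>2) \<le>
    (\<Prod>i=1..j. \<integral>\<^sup>+u. ennreal (Theta \<rho> \<tau> u * h i u) \<partial>lborel) *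
    (\<integral>\<^sup>+r. ennreal ((\<Prod>i=1..Suc j. Theta \<rho> \<tau> (ext r i)) * (w (ext r) * (cmod (g (ext r)))\<^sup>2)) \<partial>leb j)"
proof -
  let ?T = "Theta \<rho> \<tau>"
  define P where "P r = (\<Prod>i=1..Suc j. ?T (ext r i))" for r
  define H where "H r = (\<Prod>i=1..j. h i (r i))" for r
  have P0: "P r \<ge> 0" for r unfolding P_def by (intro prod_nonneg) (auto simp: T01)
  have H0: "H r \<ge> 0" for r unfolding H_def by (intro prod_nonneg) (auto simp: h0)
  have ext_comp: "(\<lambda>r. ext r i) \<in> borel_measurable (leb j)" if "i \<in> {1..Suc j}" for i
    unfolding ext_def by (rule borel_measurable_complete_fibre[OF that])
  have Pm [measurable]: "P \<in> borel_measurable (leb j)"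
    unfolding P_def by (intro borel_measurable_prod measurable_compose[OF ext_comp T])
  have Hm [measurable]: "H \<in> borel_measurable (leb j)"
    unfolding H_def by (intro borel_measurable_prod measurable_compose[OF borel_measurable_leb_component h])
  have "ennreal (cmod (fibre_integral \<rho> \<tau> j q g)) \<le> (\<integral>\<^sup>+r. ennreal (cmod (g (ext r) * complex_of_real (P r))) \<partial>leb j)"
    unfolding fibre_integral_def Let_def P_def ext_def by (rule norm_integral_le_nn_integral)
  also have "\<dots> \<le> (\<integral>\<^sup>+r. ennreal (sqrt (P r * H r)) * ennreal (sqrt (P r * (w (ext r) * (cmod (g (ext r)))\<^sup>2))) \<partial>leb j)"
  proof (rule nn_integral_mono_AE, use hw in eventually_elim)
    fix r assume r: "g (ext r) = 0 \<or> 1 \<le> (\<Prod>i=1..j. h i (r i)) * w (ext r)"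
    have "cmod (g (ext r)) * P r \<le> sqrt (P r * H r) * sqrt (P r * (w (ext r) * (cmod (g (ext r)))\<^sup>2))"
    proof (cases "g (ext r) = 0")
      case False
      then have 1: "1 \<le> H r * w (ext r)" using r by (simp add: H_def)
      have "cmod (g (ext r)) * P r = cmod (g (ext r)) * P r * 1" by simp
      also have "\<dots> \<le> cmod (g (ext r)) * P r * sqrt (H r * w (ext r))"
        using 1 P0[of r] by (intro mult_left_mono) auto
      also have "\<dots> = sqrt ((cmod (g (ext r)))\<^sup>2 * (P r)\<^sup>2 * (H r * w (ext r)))"
        using P0[of r] by (simp add: real_sqrt_mult)
      also have "\<dots> = sqrt (P r * H r) * sqrt (P r * (w (ext r) * (cmod (g (ext r)))\<^sup>2))"
        by (simp only: real_sqrt_mult[symmetric] power2_eq_square mult_ac)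
      finally show ?thesis .
    qed simp
    then show "ennreal (cmod (g (ext r) * complex_of_real (P r))) \<le> ennreal (sqrt (P r * H r)) * ennreal (sqrt (P r * (w (ext r) * (cmod (g (ext r)))\<^sup>2)))"
      using P0[of r] H0[of r] w0[of "ext r"]
      by (subst ennreal_mult[symmetric]) (auto simp: norm_mult intro!: ennreal_leI)
  qed
  finally have "(ennreal (cmod (fibre_integral \<rho> \<tau> j q g)))\<^sup>2 \<le> (\<integral>\<^sup>+r. ennreal (sqrt (P r * H r)) * ennreal (sqrt (P r * (w (ext r) * (cmod (g (ext r)))\<^sup>2))) \<partial>leb j)\<^sup>2"
    by (intro power_mono) auto
  also have "\<dots> \<le> (\<integral>\<^sup>+r. (ennreal (sqrt (P r * H r)))\<^sup>2 \<partial>leb j) * (\<integral>\<^sup>+r. (ennreal (sqrt (P r * (w (ext r) * (cmod (g (ext r)))\<^sup>2))))\<^sup>2 \<partial>leb j)"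
    by (rule Cauchy_Schwarz_nn_integral) auto
  also have "\<dots> = (\<integral>\<^sup>+r. ennreal (P r * H r) \<partial>leb j) * (\<integral>\<^sup>+r. ennreal (P r * (w (ext r) * (cmod (g (ext r)))\<^sup>2)) \<partial>leb j)"
    using P0 H0 w0 by (simp add: ennreal_sq)
  also have "\<dots> \<le> (\<Prod>i=1..j. \<integral>\<^sup>+u. ennreal (?T u * h i u) \<partial>lborel) * (\<integral>\<^sup>+r. ennreal (P r * (w (ext r) * (cmod (g (ext r)))\<^sup>2)) \<partial>leb j)"
  proof (rule mult_right_mono)
    have "(\<integral>\<^sup>+r. ennreal (P r * H r) \<partial>leb j) \<le> (\<integral>\<^sup>+r. (\<Prod>i\<in>{1..j}. ennreal (?T (r i) * h i (r i))) \<partial>leb j)"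
    proof (rule nn_integral_mono)
      fix r
      have "P r = ?T (ext r (Suc j)) * (\<Prod>i=1..j. ?T (r i))"
      proof -
        have "(\<Prod>i=1..j. ?T (ext r i)) = (\<Prod>i=1..j. ?T (r i))"
          by (intro prod.cong) (auto simp: ext_def)
        then show ?thesis by (simp add: P_def mult.commute)
      qed
      also have "\<dots> \<le> 1 * (\<Prod>i=1..j. ?T (r i))"
        by (intro mult_right_mono T01 prod_nonneg)
      finally have "P r * H r \<le> (\<Prod>i=1..j. ?T (r i)) * H r"
        using H0[of r] by (intro mult_right_mono) auto
      then show "ennreal (P r * H r) \<le> (\<Prod>i\<in>{1..j}. ennreal (?T (r i) * h i (r i)))"
        by (subst prod_ennreal) (auto simp: T01 h0 H_def prod.distrib intro!: ennreal_leI)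
    qed
    also have "\<dots> = (\<Prod>i=1..j. \<integral>\<^sup>+u. ennreal (?T u * h i u) \<partial>lborel)"
      unfolding leb_def by (rule PiR2.product_nn_integral_prod) auto
    finally show "(\<integral>\<^sup>+r. ennreal (P r * H r) \<partial>leb j) \<le> (\<Prod>i=1..j. \<integral>\<^sup>+u. ennreal (?T u * h i u) \<partial>lborel)" .
  qed simp
  finally show ?thesis
    by (simp add: ennreal_sq P_def)
qed

lemma prod_joined_args:
  fixes T :: "real^2 \<Rightarrow> real"
  assumes j: "j < n" and I: "I \<subseteq> {1..k}" "card I = l" and k: "k + Suc j = n + l"
  shows "(\<Prod>i=1..n. T (joined_args j n k I r p i)) = (\<Prod>i=1..Suc j. T (r i)) * (\<Prod>i\<in>{1..k} - I. T (p i))"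
proof -
  have un: "{1..n} = {1..Suc j} \<union> {Suc (Suc j)..n}" using j by auto
  have "(\<Prod>i=1..n. T (joined_args j n k I r p i)) = (\<Prod>i=1..Suc j. T (joined_args j n k I r p i)) * (\<Prod>i\<in>{Suc (Suc j)..n}. T (joined_args j n k I r p i))"
    unfolding un by (rule prod.union_disjoint) auto
  also have "(\<Prod>i=1..Suc j. T (joined_args j n k I r p i)) = (\<Prod>i=1..Suc j. T (r i))"
    using j by (intro prod.cong) (auto simp: joined_args_def)
  also have "(\<Prod>i\<in>{Suc (Suc j)..n}. T (joined_args j n k I r p i)) = (\<Prod>i\<in>{Suc (Suc j)..n}. T (p (rest_index j k I i)))"
    by (intro prod.cong) (auto simp: joined_args_def rest_index_def)
  also have "\<dots> = (\<Prod>i\<in>{1..k} - I. T (p i))"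
    by (rule prod.reindex_bij_betw[OF bij_betw_rest_index[OF assms]])
  finally show ?thesis .
qed

lemma measurable_joined_args:
  assumes j: "j < n" and f: "f \<in> borel_measurable (leb n)"
  shows "(\<lambda>r. f (joined_args j n k I (complete_fibre j q r) p)) \<in> borel_measurable (leb j)"
  unfolding joined_args_eq_glue
proof (rule measurable_compose[OF _ f[unfolded leb_def]])
  show "(\<lambda>r. glue j n q r (rest j n k I p)) \<in> measurable (leb j) (PiR2 {1..n})"
    unfolding leb_def using j
    by (intro measurable_glue) (auto simp: space_PiM rest_def)
qed

text \<open>The kernel weight \<open>kap\<close> is dominated by a function of the total momentum times a product over
  all but one of the outgoing variables; Cauchy--Schwarz on the fibre distributes the weight
  \<open>1 \<le> (\<Prod>h) * w\<close> between the incoming fibre variables and \<open>\<psi>\<close>.\<close>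

lemma nn_integral_fibre_bound:
  fixes h g :: "nat \<Rightarrow> real^2 \<Rightarrow> real" and w kap :: "(nat \<Rightarrow> real^2) \<Rightarrow> real" and cq :: "real^2 \<Rightarrow> real"
    and \<psi> :: chaos
  assumes T [measurable]: "Theta \<rho> \<tau> \<in> borel_measurable borel"
    and T01: "\<And>u. 0 \<le> Theta \<rho> \<tau> u" "\<And>u. Theta \<rho> \<tau> u \<le> 1"
    and j: "j < n" and I: "I \<subseteq> {1..k}" "card I = l" "i0 \<in> I" and k: "k + Suc j = n + l"
    and \<psi> [measurable]: "\<psi> \<in> borel_measurable (leb n)"
    and h [measurable]: "\<And>i. h i \<in> borel_measurable borel" and h0: "\<And>i u. 0 \<le> h i u"
    and g [measurable]: "\<And>i. g i \<in> borel_measurable borel" and g0: "\<And>i u. 0 \<le> g i u"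
    and cq [measurable]: "cq \<in> borel_measurable borel" and cq0: "\<And>q. 0 \<le> cq q"
    and w [measurable]: "w \<in> borel_measurable (leb n)" and w0: "\<And>x. 0 \<le> w x"
    and kap0: "\<And>p. 0 \<le> kap p"
    and kap: "AE p in leb k. kap p \<le> cq (\<Sum>i\<in>I. p i) * (\<Prod>i\<in>I - {i0}. g i (p i))"
    and hw: "AE r in leb j. \<forall>x. (\<forall>i\<in>{1..j}. x i = r i) \<longrightarrow> \<psi> x = 0 \<or> 1 \<le> (\<Prod>i=1..j. h i (r i)) * w x"
  shows "(\<integral>\<^sup>+p. ennreal ((Theta_prod \<rho> \<tau> k p) * kap p *
        (cmod (fibre_integral \<rho> \<tau> j (\<Sum>i\<in>I. p i) (\<lambda>r. \<psi> (joined_args j n k I r p))))\<^sup>2) \<partial>leb k)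
    \<le> (\<Prod>i\<in>I - {i0}. \<integral>\<^sup>+u. ennreal (Theta \<rho> \<tau> u * g i u) \<partial>lborel) *
      (\<Prod>i=1..j. \<integral>\<^sup>+u. ennreal (Theta \<rho> \<tau> u * h i u) \<partial>lborel) *
      (\<integral>\<^sup>+x. ennreal ((Theta_prod \<rho> \<tau> n x) * (cq (\<Sum>i=1..Suc j. x i) * (w x * (cmod (\<psi> x))\<^sup>2))) \<partial>leb n)"
proof -
  let ?T = "Theta \<rho> \<tau>"
  define V where "V = (\<Prod>i=1..j. \<integral>\<^sup>+u. ennreal (?T u * h i u) \<partial>lborel)"
  define F where "F x = ennreal ((\<Prod>i=1..n. ?T (x i)) * (cq (\<Sum>i=1..Suc j. x i) * (w x * (cmod (\<psi> x))\<^sup>2)))" for x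
  have F [measurable]: "F \<in> borel_measurable (leb n)"
  proof -
    have "(\<lambda>x. \<Prod>i=1..n. ?T (x i)) \<in> borel_measurable (leb n)"
      by (intro borel_measurable_prod measurable_compose[OF borel_measurable_leb_component T])
    moreover have "(\<lambda>x. cq (\<Sum>i=1..Suc j. x i)) \<in> borel_measurable (leb n)"
      using j by (intro measurable_compose[OF _ cq] borel_measurable_sum borel_measurable_leb_component) auto
    ultimately show ?thesis unfolding F_def by measurable
  qed
  define J where "J p r = joined_args j n k I (complete_fibre j (\<Sum>i\<in>I. p i) r) p" for p r
  have finI: "finite I" using I finite_subset by blast
  have point: "ennreal ((\<Prod>i=1..k. ?T (p i)) * kap p *
        (cmod (fibre_integral \<rho> \<tau> j (\<Sum>i\<in>I. p i) (\<lambda>r. \<psi> (joined_args j n k I r p))))\<^sup>2)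
      \<le> (\<Prod>i\<in>I - {i0}. ennreal (?T (p i) * g i (p i))) * (\<integral>\<^sup>+r. V * F (J p r) \<partial>leb j)"
    if kp: "kap p \<le> cq (\<Sum>i\<in>I. p i) * (\<Prod>i\<in>I - {i0}. g i (p i))" for p
  proof -
    define q where "q = (\<Sum>i\<in>I. p i)"
    define f where "f = fibre_integral \<rho> \<tau> j q (\<lambda>r. \<psi> (joined_args j n k I r p))"
    define C where "C = (\<Prod>i\<in>{1..k} - I. ?T (p i))"
    define D where "D = (\<Prod>i\<in>I - {i0}. ?T (p i) * g i (p i))"
    have C0: "C \<ge> 0" and D0: "D \<ge> 0"
      unfolding C_def D_def by (auto intro!: prod_nonneg mult_nonneg_nonneg T01 g0)
    have Jr: "J p r = joined_args j n k I (complete_fibre j q r) p" for r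
      by (simp add: J_def q_def)
    have J_low: "J p r i = r i" if "i \<in> {1..j}" for r i
      using that j by (auto simp: J_def joined_args_def)
    have cs: "ennreal ((cmod f)\<^sup>2) \<le> V * (\<integral>\<^sup>+r. ennreal ((\<Prod>i=1..Suc j. ?T ((complete_fibre j q r) i)) *
        (w (J p r) * (cmod (\<psi> (J p r)))\<^sup>2)) \<partial>leb j)"
      unfolding f_def V_def Jr
    proof (rule fibre_integral_Cauchy_Schwarz[where w="\<lambda>r. w (joined_args j n k I r p)"])
      show "AE r in leb j. \<psi> (joined_args j n k I (r(Suc j := q - sum r {1..j})) p) = 0 \<or>
          1 \<le> (\<Prod>i = 1..j. h i (r i)) * w (joined_args j n k I (r(Suc j := q - sum r {1..j})) p)"
        using hw
      proof eventually_elim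
        case (elim r)
        then show ?case using J_low[of _ r] unfolding Jr by blast
      qed
    qed (fact T T01 h h0 w0 measurable_joined_args[OF j \<psi>] measurable_joined_args[OF j w])+
    have split: "(\<Prod>i=1..k. ?T (p i)) = ?T (p i0) * (\<Prod>i\<in>I - {i0}. ?T (p i)) * C"
    proof -
      have "(\<Prod>i=1..k. ?T (p i)) = (\<Prod>i\<in>I. ?T (p i)) * C"
        unfolding C_def using I(1) prod.subset_diff[of I "{1..k}" "\<lambda>i. ?T (p i)"] by (simp add: mult.commute)
      then show ?thesis using finI I(3) by (simp add: prod.remove)
    qed
    \<comment> \<open>The \<open>Theta\<close> factor of \<open>p i0\<close> is bounded by
      \<open>1\<close>: this variable is about to be replaced by the total momentum.\<close>
    have "(\<Prod>i=1..k. ?T (p i)) * kap p \<le> (1 * (\<Prod>i\<in>I - {i0}. ?T (p i)) * C) * (cq q * (\<Prod>i\<in>I - {i0}. g i (p i)))"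
      unfolding split using kp C0 kap0
      by (intro mult_mono mult_right_mono T01) (auto simp: q_def intro!: prod_nonneg mult_nonneg_nonneg T01)
    also have "\<dots> = D * (C * cq q)"
      by (simp add: D_def prod.distrib mult_ac)
    finally have "ennreal ((\<Prod>i=1..k. ?T (p i)) * kap p * (cmod f)\<^sup>2) \<le> ennreal (D * (C * cq q) * (cmod f)\<^sup>2)"
      by (intro ennreal_leI mult_right_mono) auto
    also have "\<dots> = ennreal D * (ennreal (C * cq q) * ennreal ((cmod f)\<^sup>2))"
      using C0 D0 cq0[of q] by (simp add: ennreal_mult mult_ac)
    also have "\<dots> \<le> ennreal D * (ennreal (C * cq q) * (V * (\<integral>\<^sup>+r. ennreal ((\<Prod>i=1..Suc j. ?T ((complete_fibre j q r) i)) *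
        (w (J p r) * (cmod (\<psi> (J p r)))\<^sup>2)) \<partial>leb j)))"
      by (intro mult_left_mono cs) auto
    also have "\<dots> = ennreal D * (V * (ennreal (C * cq q) * (\<integral>\<^sup>+r. ennreal ((\<Prod>i=1..Suc j. ?T ((complete_fibre j q r) i)) *
        (w (J p r) * (cmod (\<psi> (J p r)))\<^sup>2)) \<partial>leb j)))"
      by (simp only: mult_ac)
    also have "ennreal (C * cq q) * (\<integral>\<^sup>+r. ennreal ((\<Prod>i=1..Suc j. ?T ((complete_fibre j q r) i)) *
        (w (J p r) * (cmod (\<psi> (J p r)))\<^sup>2)) \<partial>leb j) = (\<integral>\<^sup>+r. F (J p r) \<partial>leb j)"
    proof -
      have Fm: "(\<lambda>r. F (J p r)) \<in> borel_measurable (leb j)"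
        unfolding Jr by (rule measurable_joined_args[OF j F])
      \<comment> \<open>\<open>cq\<close> depends only on the total momentum, which outgoing and
        incoming tuples share. This is how a weight on the output is carried over to the argument of
        \<open>\<psi>\<close>, together with the \<open>Theta\<close> factors of the untouched
        momenta.\<close>
      have FJ: "F (J p r) = ennreal (C * cq q) * ennreal ((\<Prod>i=1..Suc j. ?T ((complete_fibre j q r) i)) *
        (w (J p r) * (cmod (\<psi> (J p r)))\<^sup>2))" for r
      proof -
        let ?r = "(complete_fibre j q r)"
        have "(\<Sum>i=1..Suc j. J p r i) = (\<Sum>i=1..Suc j. ?r i)"
          using j by (intro sum.cong) (auto simp: Jr joined_args_def)
        also have "\<dots> = q" 
        proof -
          have "(\<Sum>i=1..j. ?r i) = (\<Sum>i=1..j. r i)" by (intro sum.cong) auto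
          then show ?thesis by simp
        qed
        finally have s: "(\<Sum>i=1..Suc j. J p r i) = q" .
        have "(\<Prod>i=1..n. ?T (J p r i)) = (\<Prod>i=1..Suc j. ?T (?r i)) * C"
          unfolding Jr C_def by (rule prod_joined_args[OF j I(1,2) k])
        then have "F (J p r) = ennreal ((C * cq q) * ((\<Prod>i=1..Suc j. ?T (?r i)) * (w (J p r) * (cmod (\<psi> (J p r)))\<^sup>2)))"
          unfolding F_def s by (simp add: mult_ac)
        also have "\<dots> = ennreal (C * cq q) * ennreal ((\<Prod>i=1..Suc j. ?T (?r i)) * (w (J p r) * (cmod (\<psi> (J p r)))\<^sup>2))"
          using C0 cq0[of q] w0 by (intro ennreal_mult mult_nonneg_nonneg prod_nonneg) (auto simp: T01)
        finally show ?thesis .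
      qed
      have wm: "(\<lambda>r. w (J p r)) \<in> borel_measurable (leb j)" "(\<lambda>r. \<psi> (J p r)) \<in> borel_measurable (leb j)"
        unfolding Jr by (intro measurable_joined_args[OF j] w \<psi>)+
      have "(\<lambda>r. \<Prod>i=1..Suc j. ?T ((complete_fibre j q r) i)) \<in> borel_measurable (leb j)"
        by (intro borel_measurable_prod measurable_compose[OF borel_measurable_complete_fibre T])
      then show ?thesis
        unfolding FJ
        by (intro nn_integral_cmult[symmetric] measurable_compose[OF _ measurable_ennreal]
            borel_measurable_times borel_measurable_power measurable_compose[OF wm(2) borel_measurable_norm] wm(1))
    qed
    also have "V * (\<integral>\<^sup>+r. F (J p r) \<partial>leb j) = (\<integral>\<^sup>+r. V * F (J p r) \<partial>leb j)"
      unfolding Jr by (intro nn_integral_cmult[symmetric] measurable_joined_args[OF j F])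
    also have "ennreal D = (\<Prod>i\<in>I - {i0}. ennreal (?T (p i) * g i (p i)))"
      unfolding D_def by (intro prod_ennreal[symmetric] mult_nonneg_nonneg T01 g0)
    finally show ?thesis by (simp only: f_def q_def)
  qed
  have "(\<integral>\<^sup>+p. ennreal ((\<Prod>i=1..k. ?T (p i)) * kap p *
        (cmod (fibre_integral \<rho> \<tau> j (\<Sum>i\<in>I. p i) (\<lambda>r. \<psi> (joined_args j n k I r p))))\<^sup>2) \<partial>leb k)
    \<le> (\<integral>\<^sup>+p. (\<Prod>i\<in>I - {i0}. ennreal (?T (p i) * g i (p i))) * (\<integral>\<^sup>+r. V * F (J p r) \<partial>leb j) \<partial>leb k)"
    by (rule nn_integral_mono_AE, use kap in eventually_elim) (rule point)
  also have "\<dots> = (\<Prod>i\<in>I - {i0}. \<integral>\<^sup>+u. ennreal (?T u * g i u) \<partial>lborel) * (\<integral>\<^sup>+x. V * F x \<partial>leb n)"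
    unfolding J_def by (rule nn_integral_joined_args[OF j I k]) measurable
  also have "(\<integral>\<^sup>+x. V * F x \<partial>leb n) = V * (\<integral>\<^sup>+x. F x \<partial>leb n)"
    by (rule nn_integral_cmult) measurable
  finally show ?thesis by (simp only: V_def F_def mult.assoc)
qed

section \<open>Weights and singular integrals\<close>

text \<open>For \<open>a = c\<close> and off the axes this dominates, inside the disc, the power
  \<open>-2 * a\<close> of the norm, because the product of the coordinates is at most the squared
  norm. Unlike that power it factorises over the coordinates.\<close>

definition disc_weight :: "real \<Rightarrow> real \<Rightarrow> real \<Rightarrow> real^2 \<Rightarrow> real" where
  "disc_weight \<xi> a c u = indicator {u. (norm u)\<^sup>2 \<le> \<xi>} u * (\<bar>u$1\<bar> powr (- a) * \<bar>u$2\<bar> powr (- c))"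

text \<open>A majorant, off the axes, of the power \<open>-2 * a\<close> of the norm on the whole
  plane: the singularity is kept inside the unit disc, and outside the constant \<open>1\<close>
  suffices.\<close>

definition riesz_weight :: "real \<Rightarrow> real^2 \<Rightarrow> real" where
  "riesz_weight a u = 1 + disc_weight 1 a a u"

text \<open>The bound of Plancherel's inequality for the total mass of \<open>Theta\<close>. It is
  the unit in which all one-variable integrals are measured, so that its powers can be cancelled in
  one place, \<open>prefactor_sq\<close>.\<close>

definition mass :: "real \<Rightarrow> real" where
  "mass \<tau> = (2 * pi)\<^sup>2 * (\<tau> / sqrt (nu \<tau>))"

lemma borel_measurable_disc_weight [measurable]: "disc_weight \<xi> a c \<in> borel_measurable borel"
  unfolding disc_weight_def[abs_def] by measurable

lemma borel_measurable_riesz_weight [measurable]: "riesz_weight a \<in> borel_measurable borel"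
  unfolding riesz_weight_def[abs_def] by measurable

lemma disc_weight_nonneg: "0 \<le> disc_weight \<xi> a c u"
  by (simp add: disc_weight_def)

lemma riesz_weight_ge_1: "1 \<le> riesz_weight a u"
  by (simp add: riesz_weight_def disc_weight_nonneg)

lemma abs_nth_mult_le_norm_sq: "\<bar>u$1\<bar> * \<bar>u$2\<bar> \<le> (norm (u::real^2))\<^sup>2"
proof -
  have "2 * (\<bar>u$1\<bar> * \<bar>u$2\<bar>) \<le> (norm u)\<^sup>2"
    using sum_squares_bound[of "\<bar>u$1\<bar>" "\<bar>u$2\<bar>"] by (simp add: norm_real2_sq mult.assoc)
  then show ?thesis using zero_le_mult_iff[of "\<bar>u$1\<bar>" "\<bar>u$2\<bar>"] by linarith
qed

lemma disc_weight_lower: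
  assumes u: "u$1 \<noteq> 0" "u$2 \<noteq> 0" and le: "(norm u)\<^sup>2 \<le> \<xi>" and a: "0 \<le> a" and X: "(norm u)\<^sup>2 \<le> X"
  shows "1 \<le> disc_weight \<xi> a a u * X powr a"
proof -
  have "1 = (\<bar>u$1\<bar> * \<bar>u$2\<bar>) powr (- a) * (\<bar>u$1\<bar> * \<bar>u$2\<bar>) powr a"
    using u by (simp add: powr_add[symmetric])
  also have "\<dots> \<le> (\<bar>u$1\<bar> * \<bar>u$2\<bar>) powr (- a) * X powr a"
    using a X abs_nth_mult_le_norm_sq[of u] by (intro mult_left_mono powr_mono2) auto
  finally show ?thesis using le by (simp add: disc_weight_def powr_mult)
qed

lemma riesz_weight_lower:
  assumes u: "u$1 \<noteq> 0" "u$2 \<noteq> 0" and a: "0 \<le> a"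
  shows "1 \<le> riesz_weight a u * ((norm u)\<^sup>2) powr a"
proof (cases "(norm u)\<^sup>2 \<le> 1")
  case True
  have "1 \<le> disc_weight 1 a a u * ((norm u)\<^sup>2) powr a"
    by (rule disc_weight_lower) (use assms True in auto)
  also have "\<dots> \<le> riesz_weight a u * ((norm u)\<^sup>2) powr a"
    by (intro mult_right_mono) (auto simp: riesz_weight_def)
  finally show ?thesis .
next
  case False
  then have "1 \<le> ((norm u)\<^sup>2) powr a" using a by (intro ge_one_powr_ge_zero) auto
  then show ?thesis using riesz_weight_ge_1[of a u]
    using mult_mono[of 1 "riesz_weight a u" 1 "((norm u)\<^sup>2) powr a"] by simp
qed

section \<open>Null sets and integrals against Theta\<close>

text \<open>Since \<open>0 powr a = 0\<close>, a weight with a negative exponent vanishes on the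
  axes instead of being infinite there. Its lower bounds are thus available only off the
  axes.\<close>

lemma AE_lborel_nth_nonzero: "AE u in (lborel :: (real^2) measure). u$1 \<noteq> 0 \<and> u$2 \<noteq> 0"
proof -
  have 1: "(\<integral>\<^sup>+u. indicator {0} (u$1) * 1 \<partial>(lborel :: (real^2) measure)) = 0"
    by (subst nn_integral_real2_prod[of "indicator {0}" "\<lambda>_. 1"]) auto
  have 2: "(\<integral>\<^sup>+u. 1 * indicator {0} (u$2) \<partial>(lborel :: (real^2) measure)) = 0"
    by (subst nn_integral_real2_prod[of "\<lambda>_. 1" "indicator {0}"]) auto
  have "AE u in (lborel :: (real^2) measure). u$1 \<noteq> 0"
    using 1 by (subst (asm) nn_integral_0_iff_AE) (auto simp: indicator_def)
  moreover have "AE u in (lborel :: (real^2) measure). u$2 \<noteq> 0"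
    using 2 by (subst (asm) nn_integral_0_iff_AE) (auto simp: indicator_def)
  ultimately show ?thesis by eventually_elim auto
qed

text \<open>The exceptional set of one coordinate lies in a rectangle with one null side, and there
  are finitely many coordinates.\<close>

lemma AE_leb_component:
  assumes P: "AE u in lborel. P u"
  shows "AE r in leb j. \<forall>i\<in>{1..j}. P (r i)"
proof (rule AE_finite_allI)
  fix i assume i: "i \<in> {1..j}"
  obtain N where N: "{u. \<not> P u} \<subseteq> N" "N \<in> sets lborel" "emeasure lborel N = 0"
    using P by (rule AE_E) auto
  have "emeasure (PiR2 {1..j}) (Pi\<^sub>E {1..j} (\<lambda>k. if k = i then N else UNIV)) = (\<Prod>k\<in>{1..j}. emeasure lborel (if k = i then N else UNIV))"
    using N by (intro PiR2.emeasure_PiM) auto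
  also have "\<dots> = 0" using i N by (intro prod_zero) (auto intro!: bexI[of _ i])
  finally have z: "emeasure (PiR2 {1..j}) (Pi\<^sub>E {1..j} (\<lambda>k. if k = i then N else UNIV)) = 0" .
  show "AE r in leb j. P (r i)"
    unfolding leb_def
  proof (rule AE_I[OF _ z])
    show "{r \<in> space (PiR2 {1..j}). \<not> P (r i)} \<subseteq> Pi\<^sub>E {1..j} (\<lambda>k. if k = i then N else UNIV)"
      using N by (auto simp: space_PiM PiE_iff extensional_def)
    show "Pi\<^sub>E {1..j} (\<lambda>k. if k = i then N else UNIV) \<in> sets (PiR2 {1..j})"
      using N by (intro sets_PiM_I_finite) auto
  qed
qed simp

lemma Theta_props:
  assumes "mollifier \<rho>"
  shows "Theta \<rho> \<tau> \<in> borel_measurable borel" "0 \<le> Theta \<rho> \<tau> p" "Theta \<rho> \<tau> p \<le> 1"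
proof -
  have eq: "Theta \<rho> \<tau> = (\<lambda>p. (cosine_transform \<rho> (rescale \<tau> p))\<^sup>2)"
    using Theta_eq[OF assms] by auto
  have [measurable]: "cosine_transform \<rho> \<in> borel_measurable borel"
    by (rule mollifier_cosine_transform[OF assms])
  show "Theta \<rho> \<tau> \<in> borel_measurable borel" unfolding eq by measurable
  show "0 \<le> Theta \<rho> \<tau> p" "Theta \<rho> \<tau> p \<le> 1"
    unfolding eq using mollifier_cosine_transform(2)[OF assms] by auto
qed

lemma mass_pos: "\<tau> > 0 \<Longrightarrow> mass \<tau> > 0"
  using nu_pos[of \<tau>] by (simp add: mass_def)

lemma nn_integral_Theta:
  assumes \<rho>: "mollifier \<rho>" and \<tau>: "\<tau> > 0"
  shows "(\<integral>\<^sup>+p. ennreal (Theta \<rho> \<tau> p) \<partial>lborel) \<le> ennreal (mass \<tau>)"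
proof -
  note c = mollifier_cosine_transform[OF \<rho>]
  have [measurable]: "cosine_transform \<rho> \<in> borel_measurable borel" by (rule c)
  have "(\<integral>\<^sup>+p. ennreal (Theta \<rho> \<tau> p) \<partial>lborel) = ennreal (\<tau> / sqrt (nu \<tau>)) * (\<integral>\<^sup>+u. ennreal ((cosine_transform \<rho> u)\<^sup>2) \<partial>lborel)"
    unfolding Theta_eq[OF \<rho>] by (rule nn_integral_rescale[OF \<tau>, of "\<lambda>u. ennreal ((cosine_transform \<rho> u)\<^sup>2)"]) measurable
  also have "\<dots> \<le> ennreal (\<tau> / sqrt (nu \<tau>)) * ennreal ((2 * pi)\<^sup>2)"
    by (intro mult_left_mono c) auto
  also have "\<dots> = ennreal (mass \<tau>)"
    using \<tau> nu_pos[of \<tau>] by (subst ennreal_mult[symmetric]) (auto simp: mass_def mult.commute)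
  finally show ?thesis .
qed

lemma nn_integral_Theta_disc:
  assumes \<rho>: "mollifier \<rho>" and \<tau>: "\<tau> > 0" and a: "0 \<le> a" "a < 1" and c: "0 \<le> c" "c < 1" and \<xi>: "\<xi> \<ge> 0"
  shows "(\<integral>\<^sup>+p. ennreal (Theta \<rho> \<tau> p * disc_weight \<xi> a c (rescale \<tau> p)) \<partial>lborel)
    \<le> ennreal (mass \<tau> * (4 / ((1 - a) * (1 - c)) * \<xi> powr (1 - (a + c) / 2)))"
proof -
  have "(\<integral>\<^sup>+p. ennreal (Theta \<rho> \<tau> p * disc_weight \<xi> a c (rescale \<tau> p)) \<partial>lborel)
      \<le> (\<integral>\<^sup>+p. ennreal (disc_weight \<xi> a c (rescale \<tau> p)) \<partial>lborel)"
    using Theta_props[OF \<rho>, of \<tau>] disc_weight_nonneg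
    by (intro nn_integral_mono ennreal_leI) (auto intro!: mult_left_le_one_le)
  also have "\<dots> = ennreal (\<tau> / sqrt (nu \<tau>)) * (\<integral>\<^sup>+u. ennreal (disc_weight \<xi> a c u) \<partial>lborel)"
    by (rule nn_integral_rescale[OF \<tau>, of "\<lambda>u. ennreal (disc_weight \<xi> a c u)"]) measurable
  also have "\<dots> \<le> ennreal (\<tau> / sqrt (nu \<tau>)) * ennreal (4 / ((1 - a) * (1 - c)) * \<xi> powr (1 - (a + c) / 2))"
    using nn_integral_disc_powr[OF a c \<xi>]
    by (intro mult_left_mono) (auto simp: disc_weight_def ennreal_mult ennreal_indicator[symmetric] simp del: ennreal_indicator)
  also have "\<dots> = ennreal (\<tau> / sqrt (nu \<tau>) * (4 / ((1 - a) * (1 - c)) * \<xi> powr (1 - (a + c) / 2)))"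
    using \<tau> nu_pos[of \<tau>] a c by (intro ennreal_mult[symmetric]) auto
  also have "\<dots> \<le> ennreal (mass \<tau> * (4 / ((1 - a) * (1 - c)) * \<xi> powr (1 - (a + c) / 2)))"
  proof (intro ennreal_leI mult_right_mono)
    \<comment> \<open>The disc integral comes without the factor \<open>(2 * pi)\<^sup>2\<close>; it
      is inserted so that every bound is a multiple of \<open>mass \<tau>\<close>.\<close>
    have "1 \<le> 2 * pi" using pi_gt3 by simp
    then have "1 \<le> (2 * pi)\<^sup>2" by (rule one_le_power)
    then have "1 * (\<tau> / sqrt (nu \<tau>)) \<le> (2 * pi)\<^sup>2 * (\<tau> / sqrt (nu \<tau>))"
      using \<tau> nu_pos[of \<tau>] by (intro mult_right_mono) auto
    then show "\<tau> / sqrt (nu \<tau>) \<le> mass \<tau>" by (simp add: mass_def)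
  qed (use a c in auto)
  finally show ?thesis .
qed

text \<open>Off the axes the indicator of the disc is the disc weight with both exponents zero; on
  the axes the two differ because \<open>0 powr 0 = 0\<close>.\<close>

lemma nn_integral_Theta_small:
  assumes \<rho>: "mollifier \<rho>" and \<tau>: "\<tau> > 0" and \<xi>: "\<xi> \<ge> 0"
  shows "(\<integral>\<^sup>+p. ennreal (Theta \<rho> \<tau> p * indicator {u. (norm u)\<^sup>2 \<le> \<xi>} (rescale \<tau> p)) \<partial>lborel)
    \<le> ennreal (mass \<tau> * (4 * \<xi>))"
proof -
  have "(\<integral>\<^sup>+p. ennreal (Theta \<rho> \<tau> p * indicator {u. (norm u)\<^sup>2 \<le> \<xi>} (rescale \<tau> p)) \<partial>lborel) =
    (\<integral>\<^sup>+p. ennreal (Theta \<rho> \<tau> p * disc_weight \<xi> 0 0 (rescale \<tau> p)) \<partial>lborel)"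
    by (rule nn_integral_cong_AE, use AE_lborel_nth_nonzero in eventually_elim)
       (use \<tau> nu_pos[of \<tau>] in \<open>auto simp: disc_weight_def rescale_nth\<close>)
  also have "\<dots> \<le> ennreal (mass \<tau> * (4 / ((1 - 0) * (1 - 0)) * \<xi> powr (1 - (0 + 0) / 2)))"
    by (rule nn_integral_Theta_disc[OF \<rho> \<tau> _ _ _ _ \<xi>]) auto
  finally show ?thesis using \<xi> by simp
qed

lemma nn_integral_Theta_riesz:
  assumes \<rho>: "mollifier \<rho>" and \<tau>: "\<tau> > 0" and a: "0 \<le> a" "a < 1"
  shows "(\<integral>\<^sup>+p. ennreal (Theta \<rho> \<tau> p * riesz_weight a (rescale \<tau> p)) \<partial>lborel)
    \<le> ennreal (mass \<tau> * (1 + 4 / (1 - a)\<^sup>2))"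
proof -
  have [measurable]: "Theta \<rho> \<tau> \<in> borel_measurable borel" by (rule Theta_props[OF \<rho>])
  have "(\<integral>\<^sup>+p. ennreal (Theta \<rho> \<tau> p * riesz_weight a (rescale \<tau> p)) \<partial>lborel) =
    (\<integral>\<^sup>+p. ennreal (Theta \<rho> \<tau> p) + ennreal (Theta \<rho> \<tau> p * disc_weight 1 a a (rescale \<tau> p)) \<partial>lborel)"
    using Theta_props(2)[OF \<rho>, of \<tau>] disc_weight_nonneg
    by (intro nn_integral_cong) (simp add: riesz_weight_def distrib_left)
  also have "\<dots> = (\<integral>\<^sup>+p. ennreal (Theta \<rho> \<tau> p) \<partial>lborel) + (\<integral>\<^sup>+p. ennreal (Theta \<rho> \<tau> p * disc_weight 1 a a (rescale \<tau> p)) \<partial>lborel)"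
    by (rule nn_integral_add) auto
  also have "\<dots> \<le> ennreal (mass \<tau>) + ennreal (mass \<tau> * (4 / ((1 - a) * (1 - a)) * 1 powr (1 - (a + a) / 2)))"
    by (intro add_mono nn_integral_Theta nn_integral_Theta_disc \<rho> \<tau> a) auto
  also have "\<dots> = ennreal (mass \<tau> * (1 + 4 / (1 - a)\<^sup>2))"
    using mass_pos[OF \<tau>] a by (subst ennreal_plus[symmetric]) (auto simp: power2_eq_square distrib_left)
  finally show ?thesis .
qed

section \<open>Comparison of the symbols after rescaling\<close>

lemma R_normsq_eq: "\<tau> > 0 \<Longrightarrow> R_normsq \<tau> n p = \<tau> * (\<Sum>i=1..n. (norm (rescale \<tau> (p i)))\<^sup>2)"
  by (simp add: R_normsq_def norm_R_sqrt_sq sum_distrib_left)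

lemma R_normsq_ge:
  assumes \<tau>: "\<tau> > 0" and A: "A \<subseteq> {1..n}"
  shows "\<tau> * (\<Sum>i\<in>A. (norm (rescale \<tau> (p i)))\<^sup>2) \<le> R_normsq \<tau> n p"
  unfolding R_normsq_eq[OF \<tau>] using A \<tau> by (intro mult_left_mono sum_mono2) auto

lemma R_normsq_nonneg: "0 \<le> R_normsq \<tau> n p"
  by (simp add: R_normsq_def sum_nonneg)

lemma e1_normsq_eq: "e1_normsq n p = (\<Sum>i=1..n. (p i $ 1)\<^sup>2)"
  by (simp add: e1_normsq_def)

lemma e1_normsq_nonneg: "0 \<le> e1_normsq n p"
  by (simp add: e1_normsq_eq sum_nonneg)

lemma nu_e1_normsq_eq: "\<tau> > 0 \<Longrightarrow> nu \<tau> * e1_normsq n p = \<tau> * (\<Sum>i=1..n. (rescale \<tau> (p i) $ 1)\<^sup>2)"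
  by (simp add: e1_normsq_eq sum_distrib_left nu_e1_sq)

lemma nth_sq_le_norm_sq: "(u $ 1)\<^sup>2 \<le> (norm (u::real^2))\<^sup>2" "(u $ 2)\<^sup>2 \<le> (norm (u::real^2))\<^sup>2"
  by (simp_all add: norm_real2_sq)

lemma nu_e1_normsq_le: "\<tau> > 0 \<Longrightarrow> nu \<tau> * e1_normsq n p \<le> R_normsq \<tau> n p"
  unfolding R_normsq_eq nu_e1_normsq_eq by (intro mult_left_mono sum_mono nth_sq_le_norm_sq) auto

lemma sum_sq_le_card: "(\<Sum>i\<in>A. f i)\<^sup>2 \<le> real (card A) * (\<Sum>i\<in>A. (f i)\<^sup>2)" for f :: "'a \<Rightarrow> real"
  using Cauchy_Schwarz_ineq_sum[of "\<lambda>_. 1" f A] by simp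

text \<open>Cauchy--Schwarz over the \<open>j + 1\<close> incoming momenta. The resulting factor
  \<open>Suc j\<close> is later bounded by \<open>n\<close>.\<close>

lemma total_e1_sq_le:
  assumes "j < n"
  shows "((\<Sum>i=1..Suc j. x i) $ 1)\<^sup>2 \<le> real (Suc j) * e1_normsq n x"
proof -
  have "((\<Sum>i=1..Suc j. x i) $ 1)\<^sup>2 \<le> real (card {1..Suc j}) * (\<Sum>i=1..Suc j. (x i $ 1)\<^sup>2)"
    unfolding sum_component by (rule sum_sq_le_card)
  also have "\<dots> \<le> real (Suc j) * e1_normsq n x"
    unfolding e1_normsq_eq using assms by (intro mult_mono sum_mono2 sum_nonneg) auto
  finally show ?thesis .
qed

lemma borel_measurable_R_normsq [measurable]: "R_normsq \<tau> n \<in> borel_measurable (leb n)"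
proof -
  have "(\<lambda>v. (norm (R_sqrt \<tau> *v v))\<^sup>2) \<in> borel_measurable borel"
    unfolding R_sqrt_mult by measurable
  then show ?thesis
    unfolding R_normsq_def[abs_def]
    by (intro borel_measurable_sum measurable_compose[OF borel_measurable_leb_component])
qed

lemma borel_measurable_e1_normsq [measurable]: "e1_normsq n \<in> borel_measurable (leb n)"
  unfolding e1_normsq_eq[abs_def]
  by (intro borel_measurable_sum borel_measurable_power measurable_compose[OF borel_measurable_leb_component borel_measurable_nth])

section \<open>Estimates on a single fibre\<close>

abbreviation small :: "real \<Rightarrow> real \<Rightarrow> real^2 \<Rightarrow> real" where
  "small \<tau> \<xi> p \<equiv> indicator {u. (norm u)\<^sup>2 \<le> \<xi>} (rescale \<tau> p)"

text \<open>The geometric mean, with exponents \<alpha> and \<open>1 - \<alpha>\<close>, of the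
  symbols behind the two norms on the right-hand side of the theorem. All estimates of a single term
  aim at this pointwise weight.\<close>

definition mixed_weight :: "real \<Rightarrow> real \<Rightarrow> nat \<Rightarrow> (nat \<Rightarrow> real^2) \<Rightarrow> real" where
  "mixed_weight \<tau> \<alpha> n x = (nu \<tau> * e1_normsq n x) powr \<alpha> * R_normsq \<tau> n x powr (1 - \<alpha>)"

definition weighted_mass :: "(real^2 \<Rightarrow> real) \<Rightarrow> real \<Rightarrow> real \<Rightarrow> nat \<Rightarrow> chaos \<Rightarrow> ennreal" where
  "weighted_mass \<rho> \<tau> \<alpha> n \<psi> =
    (\<integral>\<^sup>+x. ennreal ((Theta_prod \<rho> \<tau> n x) * (mixed_weight \<tau> \<alpha> n x * (cmod (\<psi> x))\<^sup>2)) \<partial>leb n)"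

text \<open>The factor of \<open>nn_integral_Theta_riesz\<close> at exponent \<alpha>. It grows
  without bound as \<alpha> tends to \<open>1\<close>, where the power \<open>-2 * \<alpha>\<close>
  of the norm ceases to be integrable at the origin of the plane; the final constant inherits its
  dependence on \<alpha> from here.\<close>

definition singularity_const :: "real \<Rightarrow> real" where
  "singularity_const \<alpha> = 1 + 4 / (1 - \<alpha>)\<^sup>2"

lemma mixed_weight_nonneg: "0 \<le> mixed_weight \<tau> \<alpha> n x"
  by (simp add: mixed_weight_def)

text \<open>The first symbol is below the second one, so replacing a part of its exponent only
  increases it.\<close>

lemma nu_e1_normsq_le_mixed_weight:
  assumes \<tau>: "\<tau> > 0" and \<alpha>: "0 < \<alpha>" "\<alpha> < 1"
  shows "nu \<tau> * e1_normsq n x \<le> mixed_weight \<tau> \<alpha> n x"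
proof -
  let ?W = "nu \<tau> * e1_normsq n x"
  have 0: "?W \<ge> 0" using nu_pos[of \<tau>] e1_normsq_nonneg[of n x] by simp
  have "?W = ?W powr \<alpha> * ?W powr (1 - \<alpha>)"
    using 0 by (simp add: powr_add[symmetric])
  also have "\<dots> \<le> mixed_weight \<tau> \<alpha> n x"
    unfolding mixed_weight_def using \<alpha> 0 nu_e1_normsq_le[OF \<tau>, of n x]
    by (intro mult_left_mono powr_mono2) auto
  finally show ?thesis .
qed

text \<open>From \<open>1/2 \<le> \<alpha>\<close> follows
  \<open>1 - \<alpha> \<le> \<alpha>\<close>, so \<open>4 / (1 - \<alpha>)\<^sup>2\<close> dominates
  the constants of all other exponents in use and a single constant serves every case. The number
  \<open>17\<close> is its value at \<open>\<alpha> = 1/2\<close>.\<close>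

lemma singularity_const_bounds:
  assumes "1/2 \<le> \<alpha>" "\<alpha> < 1"
  shows "17 \<le> singularity_const \<alpha>" "4 / ((1 - \<alpha>) * \<alpha>) \<le> singularity_const \<alpha>"
    "4 / (\<alpha> * \<alpha>) \<le> singularity_const \<alpha>"
proof -
  have "(1 - \<alpha>)\<^sup>2 \<le> (1/2)\<^sup>2" using assms by (intro power_mono) auto
  then have 1: "(1 - \<alpha>)\<^sup>2 \<le> 1/4" by (simp add: power2_eq_square)
  have "4 / (1/4) \<le> 4 / (1 - \<alpha>)\<^sup>2" using 1 assms by (intro divide_left_mono) auto
  then show 17: "17 \<le> singularity_const \<alpha>" by (simp add: singularity_const_def)
  have "(1 - \<alpha>)\<^sup>2 \<le> (1 - \<alpha>) * \<alpha>" using assms unfolding power2_eq_square by (intro mult_left_mono) auto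
  then have "4 / ((1 - \<alpha>) * \<alpha>) \<le> 4 / (1 - \<alpha>)\<^sup>2" using assms by (intro divide_left_mono) auto
  then show "4 / ((1 - \<alpha>) * \<alpha>) \<le> singularity_const \<alpha>" by (simp add: singularity_const_def)
  have "1/2 * (1/2) \<le> \<alpha> * \<alpha>" using assms by (intro mult_mono) auto
  then have "4 / (\<alpha> * \<alpha>) \<le> 4 / (1/4)" using assms by (intro divide_left_mono) auto
  then show "4 / (\<alpha> * \<alpha>) \<le> singularity_const \<alpha>" using 17 by simp
qed

lemma prod_le_ennreal_scaled:
  fixes f :: "'a \<Rightarrow> ennreal"
  assumes "finite A" "\<And>i. i \<in> A \<Longrightarrow> f i \<le> ennreal (M * c i)" "0 \<le> M" "\<And>i. 0 \<le> c i"
  shows "(\<Prod>i\<in>A. f i) \<le> ennreal (M ^ card A * (\<Prod>i\<in>A. c i))"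
  using assms(1,2)
proof (induction A rule: finite_induct)
  case (insert x A)
  have "f x * (\<Prod>i\<in>A. f i) \<le> ennreal (M * c x) * ennreal (M ^ card A * (\<Prod>i\<in>A. c i))"
    using insert by (intro mult_mono) auto
  also have "\<dots> = ennreal (M * c x * (M ^ card A * (\<Prod>i\<in>A. c i)))"
    using assms by (intro ennreal_mult[symmetric]) (auto intro!: prod_nonneg mult_nonneg_nonneg)
  finally show ?case using insert by (simp add: mult_ac)
qed simp

lemma prod_if_subset:
  assumes "finite A" "S \<subseteq> A"
  shows "(\<Prod>i\<in>A. if i \<in> S then f i else 1) = (\<Prod>i\<in>S. f i :: real)"
  using assms by (simp add: prod.If_cases Int_absorb1)

lemma norm_rescale_sq_le: "\<lbrakk>R_normsq \<tau> n x \<le> \<tau> * \<xi>; \<tau> > 0; i \<in> {1..n}\<rbrakk> \<Longrightarrow> (norm (rescale \<tau> (x i)))\<^sup>2 \<le> \<xi>"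
  using R_normsq_ge[of \<tau> "{i}" n x] by simp (smt (verit) mult_le_cancel_left_pos)

lemma H_weight_le:
  assumes "X > 0" "2 * X \<le> R_normsq \<tau> k p"
  shows "bessel_weight \<tau> k p \<le> 1 / X"
  using assms by (simp add: powr_minus_divide R_normsq_nonneg add_nonneg_nonneg frac_le)

text \<open>A single set \<open>I\<close> of outgoing momenta, of which \<open>i0\<close> is the one
  eliminated by the total momentum. The support condition is required at every point; the final
  proof passes to a representative for which this is true.\<close>

locale fibre_setup =
  fixes \<rho> :: "real^2 \<Rightarrow> real" and \<tau> \<alpha> \<xi> :: real and j n k l :: nat and I :: "nat set" and i0 :: nat
    and \<psi> :: chaos
  assumes \<rho>: "mollifier \<rho>" and \<tau>: "\<tau> > 0" and \<alpha>: "1/2 \<le> \<alpha>" "\<alpha> < 1" and \<xi>: "0 \<le> \<xi>"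
    and j: "j < n" and I: "I \<subseteq> {1..k}" "card I = l" "i0 \<in> I" and k: "k + Suc j = n + l"
    and \<psi>: "\<psi> \<in> borel_measurable (leb n)"
    and supp: "\<And>x. \<psi> x \<noteq> 0 \<Longrightarrow> R_normsq \<tau> n x \<le> \<tau> * \<xi>"
begin

abbreviation "K \<equiv> singularity_const \<alpha>"
abbreviation "qI p \<equiv> (\<Sum>i\<in>I. p i)"
abbreviation "fib p \<equiv> fibre_integral \<rho> \<tau> j (qI p) (\<lambda>r. \<psi> (joined_args j n k I r p))"

lemma finI: "finite I" using I finite_subset by blast

lemma K_ge: "17 \<le> K" using singularity_const_bounds(1)[OF \<alpha>] .

lemma \<alpha>0: "0 < \<alpha>" using \<alpha> by linarith

lemma rescale_nonzero: "u$1 \<noteq> 0 \<and> u$2 \<noteq> 0 \<Longrightarrow> rescale \<tau> u $ 1 \<noteq> 0 \<and> rescale \<tau> u $ 2 \<noteq> 0"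
  using \<tau> nu_pos[of \<tau>] by (auto simp: rescale_nth)

lemma AE_nonzero: "AE p in leb k'. \<forall>i\<in>{1..k'}. rescale \<tau> (p i) $ 1 \<noteq> 0 \<and> rescale \<tau> (p i) $ 2 \<noteq> 0"
  using AE_leb_component[OF AE_lborel_nth_nonzero] by (rule eventually_mono) (use rescale_nonzero in blast)

text \<open>The common scheme of the three estimates below. One chooses \<open>g\<close> for the
  outgoing momenta, \<open>h\<close> for the incoming ones, \<open>w\<close> as the weight left on
  \<open>\<psi>\<close> and \<open>cq\<close> for the total momentum. The demands on them are made
  only off the axes and, for \<open>hw\<close>, on the support of \<open>\<psi>\<close>;
  \<open>cqw\<close> returns what is left to \<open>mixed_weight\<close>. The numbers
  \<open>cg\<close> and \<open>ch\<close> are the one-variable integrals in units of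
  \<open>mass \<tau>\<close>.\<close>

lemma fibre_bound:
  assumes gm: "\<And>i. g i \<in> borel_measurable borel" and g0: "\<And>i u. 0 \<le> g i u"
    and hm: "\<And>i. h i \<in> borel_measurable borel" and h0: "\<And>i u. 0 \<le> h i u"
    and gk: "\<And>i. i \<in> I - {i0} \<Longrightarrow> (\<integral>\<^sup>+u. ennreal (Theta \<rho> \<tau> u * g i u) \<partial>lborel) \<le> ennreal (mass \<tau> * cg i)"
    and hk: "\<And>i. i \<in> {1..j} \<Longrightarrow> (\<integral>\<^sup>+u. ennreal (Theta \<rho> \<tau> u * h i u) \<partial>lborel) \<le> ennreal (mass \<tau> * ch i)"
    and cg0: "\<And>i. 0 \<le> cg i" and ch0: "\<And>i. 0 \<le> ch i"
    and cq: "cq \<in> borel_measurable borel" and cq0: "\<And>q. 0 \<le> cq q"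
    and w: "w \<in> borel_measurable (leb n)" and w0: "\<And>x. 0 \<le> w x"
    and kap0: "\<And>p. 0 \<le> kap p"
    and kap: "\<And>p. (\<forall>i\<in>{1..k}. rescale \<tau> (p i) $ 1 \<noteq> 0 \<and> rescale \<tau> (p i) $ 2 \<noteq> 0) \<Longrightarrow>
      kap p \<le> cq (qI p) * (\<Prod>i\<in>I - {i0}. g i (p i))"
    and hw: "\<And>x. \<lbrakk>\<psi> x \<noteq> 0; R_normsq \<tau> n x \<le> \<tau> * \<xi>; \<forall>i\<in>{1..j}. rescale \<tau> (x i) $ 1 \<noteq> 0 \<and> rescale \<tau> (x i) $ 2 \<noteq> 0\<rbrakk> \<Longrightarrow>
      1 \<le> (\<Prod>i=1..j. h i (x i)) * w x"
    and cqw: "\<And>x. cq (\<Sum>i=1..Suc j. x i) * w x \<le> D * mixed_weight \<tau> \<alpha> n x" and D: "0 \<le> D"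
  shows "(\<integral>\<^sup>+p. ennreal ((Theta_prod \<rho> \<tau> k p) * kap p * (cmod (fib p))\<^sup>2) \<partial>leb k)
    \<le> ennreal (mass \<tau> ^ (l - 1 + j) * ((\<Prod>i\<in>I - {i0}. cg i) * (\<Prod>i=1..j. ch i) * D)) * weighted_mass \<rho> \<tau> \<alpha> n \<psi>"
proof -
  have M: "0 \<le> mass \<tau>" using mass_pos[OF \<tau>] by simp
  have cI: "card (I - {i0}) = l - 1" using I finI by simp
  have hw': "AE r in leb j. \<forall>x. (\<forall>i\<in>{1..j}. x i = r i) \<longrightarrow> \<psi> x = 0 \<or> 1 \<le> (\<Prod>i=1..j. h i (r i)) * w x"
    using AE_nonzero[of j]
  proof eventually_elim
    case (elim r)
    show ?case
    proof (intro allI impI)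
      fix x assume x: "\<forall>i\<in>{1..j}. x i = r i"
      then have "(\<Prod>i=1..j. h i (r i)) = (\<Prod>i=1..j. h i (x i))" by (intro prod.cong) auto
      then show "\<psi> x = 0 \<or> 1 \<le> (\<Prod>i=1..j. h i (r i)) * w x"
        using hw[of x] supp[of x] elim x by auto
    qed
  qed
  have kap': "AE p in leb k. kap p \<le> cq (qI p) * (\<Prod>i\<in>I - {i0}. g i (p i))"
    using AE_nonzero[of k] by (rule eventually_mono) (rule kap)
  have "(\<integral>\<^sup>+p. ennreal ((Theta_prod \<rho> \<tau> k p) * kap p * (cmod (fib p))\<^sup>2) \<partial>leb k)
    \<le> (\<Prod>i\<in>I - {i0}. \<integral>\<^sup>+u. ennreal (Theta \<rho> \<tau> u * g i u) \<partial>lborel) *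
      (\<Prod>i=1..j. \<integral>\<^sup>+u. ennreal (Theta \<rho> \<tau> u * h i u) \<partial>lborel) *
      (\<integral>\<^sup>+x. ennreal ((Theta_prod \<rho> \<tau> n x) * (cq (\<Sum>i=1..Suc j. x i) * (w x * (cmod (\<psi> x))\<^sup>2))) \<partial>leb n)"
    by (rule nn_integral_fibre_bound[OF Theta_props[OF \<rho>] j I k \<psi> hm h0 gm g0 cq cq0 w w0 kap0 kap' hw'])
  also have "\<dots> \<le> ennreal (mass \<tau> ^ (l - 1) * (\<Prod>i\<in>I - {i0}. cg i)) * ennreal (mass \<tau> ^ j * (\<Prod>i=1..j. ch i)) *
      (ennreal D * weighted_mass \<rho> \<tau> \<alpha> n \<psi>)"
  proof (intro mult_mono)
    show "(\<Prod>i\<in>I - {i0}. \<integral>\<^sup>+u. ennreal (Theta \<rho> \<tau> u * g i u) \<partial>lborel) \<le> ennreal (mass \<tau> ^ (l - 1) * (\<Prod>i\<in>I - {i0}. cg i))"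
      unfolding cI[symmetric] by (rule prod_le_ennreal_scaled) (use finI gk M cg0 in auto)
    show "(\<Prod>i=1..j. \<integral>\<^sup>+u. ennreal (Theta \<rho> \<tau> u * h i u) \<partial>lborel) \<le> ennreal (mass \<tau> ^ j * (\<Prod>i=1..j. ch i))"
      by (rule order.trans[OF prod_le_ennreal_scaled[where M="mass \<tau>" and c=ch]]) (use hk M ch0 in auto)
    have "(\<integral>\<^sup>+x. ennreal ((Theta_prod \<rho> \<tau> n x) * (cq (\<Sum>i=1..Suc j. x i) * (w x * (cmod (\<psi> x))\<^sup>2))) \<partial>leb n)
      \<le> (\<integral>\<^sup>+x. ennreal D * ennreal ((Theta_prod \<rho> \<tau> n x) * (mixed_weight \<tau> \<alpha> n x * (cmod (\<psi> x))\<^sup>2)) \<partial>leb n)"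
    proof (rule nn_integral_mono)
      fix x
      have P: "0 \<le> (Theta_prod \<rho> \<tau> n x)" by (intro prod_nonneg Theta_props[OF \<rho>])
      have "(cq (\<Sum>i=1..Suc j. x i) * w x) * (cmod (\<psi> x))\<^sup>2 \<le> (D * mixed_weight \<tau> \<alpha> n x) * (cmod (\<psi> x))\<^sup>2"
        by (intro mult_right_mono cqw) auto
      from mult_left_mono[OF this P] have "(Theta_prod \<rho> \<tau> n x) * (cq (\<Sum>i=1..Suc j. x i) * (w x * (cmod (\<psi> x))\<^sup>2)) \<le>
        D * ((Theta_prod \<rho> \<tau> n x) * (mixed_weight \<tau> \<alpha> n x * (cmod (\<psi> x))\<^sup>2))"
        by (simp only: mult_ac)
      then show "ennreal ((Theta_prod \<rho> \<tau> n x) * (cq (\<Sum>i=1..Suc j. x i) * (w x * (cmod (\<psi> x))\<^sup>2))) \<le>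
        ennreal D * ennreal ((Theta_prod \<rho> \<tau> n x) * (mixed_weight \<tau> \<alpha> n x * (cmod (\<psi> x))\<^sup>2))"
        using D P mixed_weight_nonneg by (subst ennreal_mult[symmetric]) (auto intro!: ennreal_leI)
    qed
    also have "\<dots> = ennreal D * weighted_mass \<rho> \<tau> \<alpha> n \<psi>"
      unfolding weighted_mass_def
    proof (rule nn_integral_cmult)
      have "(\<lambda>x. \<Prod>i=1..n. Theta \<rho> \<tau> (x i)) \<in> borel_measurable (leb n)"
        by (intro borel_measurable_prod measurable_compose[OF borel_measurable_leb_component Theta_props(1)[OF \<rho>]])
      moreover have "mixed_weight \<tau> \<alpha> n \<in> borel_measurable (leb n)"
        unfolding mixed_weight_def[abs_def] by measurable
      moreover note \<psi>
      ultimately show "(\<lambda>x. ennreal ((Theta_prod \<rho> \<tau> n x) * (mixed_weight \<tau> \<alpha> n x * (cmod (\<psi> x))\<^sup>2))) \<in> borel_measurable (leb n)"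
        by measurable
    qed
    finally show "(\<integral>\<^sup>+x. ennreal ((Theta_prod \<rho> \<tau> n x) * (cq (\<Sum>i=1..Suc j. x i) * (w x * (cmod (\<psi> x))\<^sup>2))) \<partial>leb n)
      \<le> ennreal D * weighted_mass \<rho> \<tau> \<alpha> n \<psi>" .
  qed auto
  also have "\<dots> = ennreal (mass \<tau> ^ (l - 1) * (\<Prod>i\<in>I - {i0}. cg i) * (mass \<tau> ^ j * (\<Prod>i=1..j. ch i)) * D) * weighted_mass \<rho> \<tau> \<alpha> n \<psi>"
    using M D cg0 ch0 by (subst ennreal_mult, (auto intro!: prod_nonneg mult_nonneg_nonneg)[2], subst ennreal_mult, (auto intro!: prod_nonneg mult_nonneg_nonneg)[2]) (simp only: mult.assoc)
  finally show ?thesis by (simp add: power_add mult_ac)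
qed

text \<open>With three outgoing momenta, \<open>i0\<close> accounts for the total and the
  singularity is shared by two others: each receives the inverse of its norm to the first power,
  which is integrable in the plane whatever the total is. Nothing singular in \<open>q\<close>
  remains, so \<open>w = 1\<close> suffices. Each momentum confined by \<open>S\<close> or
  \<open>S'\<close> gains a factor \<open>K * \<xi>\<close>.\<close>

lemma fibre_bound_three:
  assumes i12: "i1 \<in> I - {i0}" "i2 \<in> I - {i0}" "i1 \<noteq> i2" and S: "S \<subseteq> I - {i0, i1, i2}" and S': "S' \<subseteq> {1..j}"
  shows "(\<integral>\<^sup>+p. ennreal ((Theta_prod \<rho> \<tau> k p) *
      (bessel_weight \<tau> k p * (qI p $ 1)\<^sup>2 * (\<Prod>i\<in>S. small \<tau> \<xi> (p i))) * (cmod (fib p))\<^sup>2) \<partial>leb k)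
    \<le> ennreal (mass \<tau> ^ (l - 1 + j) * (K\<^sup>2 * (K * \<xi>) ^ card S * (K * \<xi>) ^ card S' * (real (Suc j) / (\<tau> * nu \<tau>))))
      * weighted_mass \<rho> \<tau> \<alpha> n \<psi>"
proof -
  define g where "g i u = (if i = i1 \<or> i = i2 then riesz_weight (1/2) (rescale \<tau> u) else if i \<in> S then small \<tau> \<xi> u else 1)" for i u
  define h where "h i u = (if i \<in> S' then small \<tau> \<xi> u else 1)" for i :: nat and u
  define cg where "cg i = (if i = i1 \<or> i = i2 then K else if i \<in> S then K * \<xi> else 1)" for i
  define ch where "ch i = (if i \<in> S' then K * \<xi> else 1)" for i :: nat
  define w where "w x = (1::real)" for x :: "nat \<Rightarrow> real^2"
  define cq where "cq q = (q $ 1)\<^sup>2 / \<tau>" for q :: "real^2"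
  have K0: "0 \<le> K" using K_ge by linarith
  have M: "0 \<le> mass \<tau>" using mass_pos[OF \<tau>] by simp
  have rest: "(\<Prod>i\<in>I - {i0}. if i = i1 \<or> i = i2 then f i else if i \<in> S then f' i else 1) = f i1 * f i2 * (\<Prod>i\<in>S. f' i)"
    for f f' :: "nat \<Rightarrow> real"
  proof -
    have "(\<Prod>i\<in>I - {i0}. if i = i1 \<or> i = i2 then f i else if i \<in> S then f' i else 1) =
      f i1 * (f i2 * (\<Prod>i\<in>I - {i0} - {i1} - {i2}. if i = i1 \<or> i = i2 then f i else if i \<in> S then f' i else 1))"
      using i12 finI by (simp add: prod.remove[of "I - {i0}" i1] prod.remove[of "I - {i0} - {i1}" i2])
    also have "(\<Prod>i\<in>I - {i0} - {i1} - {i2}. if i = i1 \<or> i = i2 then f i else if i \<in> S then f' i else 1) =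
      (\<Prod>i\<in>I - {i0} - {i1} - {i2}. if i \<in> S then f' i else 1)"
      by (intro prod.cong) auto
    also have "\<dots> = (\<Prod>i\<in>S. f' i)"
      using finI S by (intro prod_if_subset) auto
    finally show ?thesis by (simp add: mult.assoc)
  qed
  have Th1: "(\<integral>\<^sup>+u. ennreal (Theta \<rho> \<tau> u * 1) \<partial>lborel) \<le> ennreal (mass \<tau> * 1)"
    using nn_integral_Theta[OF \<rho> \<tau>] by simp
  have Th2: "(\<integral>\<^sup>+u. ennreal (Theta \<rho> \<tau> u * small \<tau> \<xi> u) \<partial>lborel) \<le> ennreal (mass \<tau> * (K * \<xi>))"
    using K_ge \<xi> M by (intro order.trans[OF nn_integral_Theta_small[OF \<rho> \<tau> \<xi>]] ennreal_leI mult_left_mono mult_right_mono) auto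
  have Th3: "(\<integral>\<^sup>+u. ennreal (Theta \<rho> \<tau> u * riesz_weight (1/2) (rescale \<tau> u)) \<partial>lborel) \<le> ennreal (mass \<tau> * K)"
    using K_ge M by (intro order.trans[OF nn_integral_Theta_riesz[OF \<rho> \<tau>]] ennreal_leI mult_left_mono) (auto simp: power2_eq_square)
  have "(\<integral>\<^sup>+p. ennreal ((Theta_prod \<rho> \<tau> k p) *
      (bessel_weight \<tau> k p * (qI p $ 1)\<^sup>2 * (\<Prod>i\<in>S. small \<tau> \<xi> (p i))) * (cmod (fib p))\<^sup>2) \<partial>leb k)
    \<le> ennreal (mass \<tau> ^ (l - 1 + j) * ((\<Prod>i\<in>I - {i0}. cg i) * (\<Prod>i=1..j. ch i) * (real (Suc j) / (\<tau> * nu \<tau>)))) * weighted_mass \<rho> \<tau> \<alpha> n \<psi>"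
  proof (rule fibre_bound[where g=g and h=h and cq=cq and w=w])
    show "g i \<in> borel_measurable borel" for i
      unfolding g_def[abs_def] by (cases "i = i1 \<or> i = i2"; cases "i \<in> S") auto
    show "h i \<in> borel_measurable borel" for i
      unfolding h_def[abs_def] by (cases "i \<in> S'") auto
    show "0 \<le> g i u" for i u using riesz_weight_ge_1[of "1/2" "rescale \<tau> u"] by (auto simp: g_def)
    show "(\<integral>\<^sup>+u. ennreal (Theta \<rho> \<tau> u * g i u) \<partial>lborel) \<le> ennreal (mass \<tau> * cg i)" for i
      using Th1 Th2 Th3 by (auto simp: g_def cg_def)
    show "(\<integral>\<^sup>+u. ennreal (Theta \<rho> \<tau> u * h i u) \<partial>lborel) \<le> ennreal (mass \<tau> * ch i)" for i
      using Th1 Th2 by (auto simp: h_def ch_def)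
    show "0 \<le> bessel_weight \<tau> k p * (qI p $ 1)\<^sup>2 * (\<Prod>i\<in>S. small \<tau> \<xi> (p i))" for p
      by (intro mult_nonneg_nonneg prod_nonneg) auto
    show "bessel_weight \<tau> k p * (qI p $ 1)\<^sup>2 * (\<Prod>i\<in>S. small \<tau> \<xi> (p i)) \<le> cq (qI p) * (\<Prod>i\<in>I - {i0}. g i (p i))"
      if nz: "\<forall>i\<in>{1..k}. rescale \<tau> (p i) $ 1 \<noteq> 0 \<and> rescale \<tau> (p i) $ 2 \<noteq> 0" for p
    proof -
      define u where "u = rescale \<tau> (p i1)"
      define v where "v = rescale \<tau> (p i2)"
      have nz': "u$1 \<noteq> 0" "u$2 \<noteq> 0" "v$1 \<noteq> 0" "v$2 \<noteq> 0"
        using nz i12 I by (auto simp: u_def v_def)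
      then have uv: "norm u > 0" "norm v > 0" by auto
      have "\<tau> * (\<Sum>i\<in>{i1,i2}. (norm (rescale \<tau> (p i)))\<^sup>2) \<le> R_normsq \<tau> k p"
        using i12 I by (intro R_normsq_ge \<tau>) auto
      then have "\<tau> * ((norm u)\<^sup>2 + (norm v)\<^sup>2) \<le> R_normsq \<tau> k p"
        using i12 by (simp add: u_def v_def)
      \<comment> \<open>The arithmetic-geometric mean inequality is what distributes the singularity
        evenly over the two momenta.\<close>
      moreover have "\<tau> * (2 * norm u * norm v) \<le> \<tau> * ((norm u)\<^sup>2 + (norm v)\<^sup>2)"
        using \<tau> by (intro mult_left_mono sum_squares_bound) auto
      ultimately have "2 * (\<tau> * (norm u * norm v)) \<le> R_normsq \<tau> k p" by (simp add: mult_ac)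
      then have "bessel_weight \<tau> k p \<le> 1 / (\<tau> * (norm u * norm v))"
        using uv \<tau> by (intro H_weight_le) auto
      also have "\<dots> \<le> 1 / \<tau> * (riesz_weight (1/2) u * riesz_weight (1/2) v)"
      proof -
        have "1 / norm u \<le> riesz_weight (1/2) u" "1 / norm v \<le> riesz_weight (1/2) v"
          using riesz_weight_lower[of u "1/2"] riesz_weight_lower[of v "1/2"] nz' uv
          by (simp_all add: powr_half_sqrt field_simps)
        then have "1 / norm u * (1 / norm v) \<le> riesz_weight (1/2) u * riesz_weight (1/2) v"
          using uv riesz_weight_ge_1[of "1/2" u] by (intro mult_mono) auto
        then show ?thesis using \<tau> by (simp add: field_simps)
      qed
      finally have "bessel_weight \<tau> k p * ((qI p $ 1)\<^sup>2 * (\<Prod>i\<in>S. small \<tau> \<xi> (p i))) \<le>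
        1 / \<tau> * (riesz_weight (1/2) u * riesz_weight (1/2) v) * ((qI p $ 1)\<^sup>2 * (\<Prod>i\<in>S. small \<tau> \<xi> (p i)))"
        by (intro mult_right_mono mult_nonneg_nonneg prod_nonneg) auto
      then show ?thesis
        unfolding g_def rest by (simp add: cq_def u_def v_def mult_ac)
    qed
    \<comment> \<open>On the support of \<open>\<psi>\<close> every incoming momentum lies in the
      disc, so the indicators equal \<open>1\<close> and may be inserted freely.\<close>
    show "1 \<le> (\<Prod>i=1..j. h i (x i)) * w x" if "R_normsq \<tau> n x \<le> \<tau> * \<xi>" for x
    proof -
      have "h i (x i) = 1" if "i \<in> {1..j}" for i
        using norm_rescale_sq_le[OF \<open>R_normsq \<tau> n x \<le> \<tau> * \<xi>\<close> \<tau>, of i] that j by (auto simp: h_def)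
      then show ?thesis by (simp add: w_def)
    qed
    show "cq (\<Sum>i=1..Suc j. x i) * w x \<le> real (Suc j) / (\<tau> * nu \<tau>) * mixed_weight \<tau> \<alpha> n x" for x
    proof -
      have "cq (\<Sum>i=1..Suc j. x i) * w x = 1 / \<tau> * ((\<Sum>i=1..Suc j. x i) $ 1)\<^sup>2" by (simp only: cq_def w_def) simp
      also have "\<dots> \<le> 1 / \<tau> * (real (Suc j) * e1_normsq n x)"
        using \<tau> by (intro mult_left_mono total_e1_sq_le j) auto
      also have "\<dots> = real (Suc j) / (\<tau> * nu \<tau>) * (nu \<tau> * e1_normsq n x)"
        using \<tau> nu_pos[of \<tau>] by (simp add: field_simps)
      also have "\<dots> \<le> real (Suc j) / (\<tau> * nu \<tau>) * mixed_weight \<tau> \<alpha> n x"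
        using \<tau> nu_pos[of \<tau>] by (intro mult_left_mono nu_e1_normsq_le_mixed_weight \<alpha> \<alpha>0) auto
      finally show ?thesis .
    qed
    show "cq \<in> borel_measurable borel"
      unfolding cq_def[abs_def] by measurable
    show "w \<in> borel_measurable (leb n)" unfolding w_def[abs_def] by measurable
  qed (use K0 \<xi> \<tau> nu_pos[of \<tau>] in \<open>auto simp: h_def cg_def ch_def cq_def w_def\<close>)
  also have "(\<Prod>i\<in>I - {i0}. cg i) = K\<^sup>2 * (K * \<xi>) ^ card S"
    unfolding cg_def rest by (simp add: power2_eq_square)
  also have "(\<Prod>i=1..j. ch i) = (K * \<xi>) ^ card S'"
    unfolding ch_def using S' by (simp add: prod_if_subset)
  finally show ?thesis .
qed

text \<open>With only two outgoing variables \<open>1 / (|u\<^sub>1|\<^sup>2 + |u\<^sub>2|\<^sup>2)\<close> is not locally integrable on the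
  fibre. The power \<open>1 - \<alpha>\<close> of it is bounded through \<open>|u\<^sub>1 + u\<^sub>2|\<^sup>2\<close>, which the factor
  \<open>(e1 \<bullet> q)\<^sup>2\<close> absorbs; this is where \<open>\<alpha> < 1\<close> is needed.\<close>

lemma fibre_bound_two:
  assumes l: "l = 2" and j1: "1 \<le> j"
  shows "(\<integral>\<^sup>+p. ennreal ((Theta_prod \<rho> \<tau> k p) *
      (bessel_weight \<tau> k p * (qI p $ 1)\<^sup>2) * (cmod (fib p))\<^sup>2) \<partial>leb k)
    \<le> ennreal (mass \<tau> ^ (l - 1 + j) * (K\<^sup>2 * \<xi> powr \<alpha> * (4 * real (Suc j) / (\<tau> * nu \<tau>))))
      * weighted_mass \<rho> \<tau> \<alpha> n \<psi>"
proof -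
  have K0: "0 \<le> K" using K_ge by linarith
  have M: "0 \<le> mass \<tau>" using mass_pos[OF \<tau>] by simp
  have "card (I - {i0}) = 1" using I finI l by simp
  then obtain i1 where i1: "I - {i0} = {i1}" by (auto simp: card_1_singleton_iff)
  have II: "I = {i0, i1}" "i0 \<noteq> i1" using i1 I by auto
  define g where "g i u = riesz_weight \<alpha> (rescale \<tau> u)" for i :: nat and u
  \<comment> \<open>One incoming momentum pays, through its singular weight, for the factor
    \<open>R_normsq powr (1 - \<alpha>)\<close> contained in \<open>mixed_weight\<close>. Integrated
    over the disc it yields \<open>\<xi> powr \<alpha>\<close>.\<close>
  define h where "h i u = (if i = 1 then disc_weight \<xi> (1 - \<alpha>) (1 - \<alpha>) (rescale \<tau> u) else 1)" for i :: nat and u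
  define cg where "cg i = K" for i :: nat
  define ch where "ch i = (if i = 1 then K * \<xi> powr \<alpha> else 1)" for i :: nat
  define w where "w x = (R_normsq \<tau> n x / \<tau>) powr (1 - \<alpha>)" for x
  define cq where "cq q = 4 / \<tau> * ((q $ 1)\<^sup>2 * ((norm (rescale \<tau> q))\<^sup>2) powr - (1 - \<alpha>))" for q :: "real^2"
  have nu: "nu \<tau> > 0" by (rule nu_pos)
  have Th1: "(\<integral>\<^sup>+u. ennreal (Theta \<rho> \<tau> u * 1) \<partial>lborel) \<le> ennreal (mass \<tau> * 1)"
    using nn_integral_Theta[OF \<rho> \<tau>] by simp
  have Th2: "(\<integral>\<^sup>+u. ennreal (Theta \<rho> \<tau> u * disc_weight \<xi> (1 - \<alpha>) (1 - \<alpha>) (rescale \<tau> u)) \<partial>lborel) \<le> ennreal (mass \<tau> * (K * \<xi> powr \<alpha>))"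
  proof (rule order.trans[OF nn_integral_Theta_disc[OF \<rho> \<tau> _ _ _ _ \<xi>]])
    have "1 - (1 - \<alpha> + (1 - \<alpha>)) / 2 = \<alpha>" by (simp add: field_simps)
    then have "4 / ((1 - (1 - \<alpha>)) * (1 - (1 - \<alpha>))) * \<xi> powr (1 - (1 - \<alpha> + (1 - \<alpha>)) / 2) \<le> K * \<xi> powr \<alpha>"
      using singularity_const_bounds(3)[OF \<alpha>] by (simp only:) (intro mult_right_mono, auto)
    then show "ennreal (mass \<tau> * (4 / ((1 - (1 - \<alpha>)) * (1 - (1 - \<alpha>))) * \<xi> powr (1 - (1 - \<alpha> + (1 - \<alpha>)) / 2))) \<le> ennreal (mass \<tau> * (K * \<xi> powr \<alpha>))"
      using M by (intro ennreal_leI mult_left_mono)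
  qed (use \<alpha> in auto)
  have Th3: "(\<integral>\<^sup>+u. ennreal (Theta \<rho> \<tau> u * riesz_weight \<alpha> (rescale \<tau> u)) \<partial>lborel) \<le> ennreal (mass \<tau> * K)"
    using nn_integral_Theta_riesz[OF \<rho> \<tau>, of \<alpha>] \<alpha> by (simp add: singularity_const_def)
  have "(\<integral>\<^sup>+p. ennreal ((Theta_prod \<rho> \<tau> k p) *
      (bessel_weight \<tau> k p * (qI p $ 1)\<^sup>2) * (cmod (fib p))\<^sup>2) \<partial>leb k)
    \<le> ennreal (mass \<tau> ^ (l - 1 + j) * ((\<Prod>i\<in>I - {i0}. cg i) * (\<Prod>i=1..j. ch i) * (4 * real (Suc j) / (\<tau> * nu \<tau>)))) * weighted_mass \<rho> \<tau> \<alpha> n \<psi>"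
  proof (rule fibre_bound[where g=g and h=h and cq=cq and w=w])
    show "g i \<in> borel_measurable borel" for i
      unfolding g_def[abs_def] by measurable
    show "h i \<in> borel_measurable borel" for i
      unfolding h_def[abs_def] by (cases "i = 1") auto
    show "0 \<le> g i u" for i u using riesz_weight_ge_1[of \<alpha> "rescale \<tau> u"] by (auto simp: g_def)
    show "(\<integral>\<^sup>+u. ennreal (Theta \<rho> \<tau> u * g i u) \<partial>lborel) \<le> ennreal (mass \<tau> * cg i)" for i
      using Th3 by (auto simp: g_def cg_def)
    show "(\<integral>\<^sup>+u. ennreal (Theta \<rho> \<tau> u * h i u) \<partial>lborel) \<le> ennreal (mass \<tau> * ch i)" for i
      using Th1 Th2 by (auto simp: h_def ch_def)
    show "bessel_weight \<tau> k p * (qI p $ 1)\<^sup>2 \<le> cq (qI p) * (\<Prod>i\<in>I - {i0}. g i (p i))"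
      if nz: "\<forall>i\<in>{1..k}. rescale \<tau> (p i) $ 1 \<noteq> 0 \<and> rescale \<tau> (p i) $ 2 \<noteq> 0" for p
    proof (cases "qI p $ 1 = 0")
      case True
      then show ?thesis using riesz_weight_ge_1[of \<alpha>] \<tau>
        by (auto simp: cq_def g_def intro!: prod_nonneg order.trans[OF zero_le_one])
    next
      case False
      define u where "u = rescale \<tau> (p i1)"
      define v where "v = rescale \<tau> (p i0)"
      define s where "s = rescale \<tau> (qI p)"
      have nz': "u$1 \<noteq> 0" "u$2 \<noteq> 0"
        using nz II I by (auto simp: u_def)
      then have u0: "norm u > 0" by auto
      have s: "s = v + u" unfolding s_def u_def v_def rescale_sum using II by simp
      have "s $ 1 \<noteq> 0" using False \<tau> nu by (simp add: s_def rescale_nth)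
      then have s0: "norm s > 0" by auto
      define X where "X = (norm u)\<^sup>2 + (norm v)\<^sup>2"
      have "(norm s)\<^sup>2 \<le> (norm u + norm v)\<^sup>2"
        unfolding s using norm_triangle_ineq[of v u] by (intro power_mono) auto
      also have "\<dots> \<le> 2 * X"
        using sum_squares_bound[of "norm u" "norm v"] by (simp add: X_def power2_sum)
      finally have sX: "(norm s)\<^sup>2 / 2 \<le> X" by simp
      have uX: "(norm u)\<^sup>2 \<le> X" by (simp add: X_def)
      have X0: "X > 0" using uX u0 by (smt (verit) zero_less_power2)
      have "\<tau> * (\<Sum>i\<in>{i0,i1}. (norm (rescale \<tau> (p i)))\<^sup>2) \<le> R_normsq \<tau> k p"
        using II I by (intro R_normsq_ge \<tau>) auto
      then have "2 * (\<tau> * X / 2) \<le> R_normsq \<tau> k p"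
        using II by (simp add: u_def v_def X_def add.commute)
      then have "bessel_weight \<tau> k p \<le> 1 / (\<tau> * X / 2)"
        using X0 \<tau> by (intro H_weight_le) auto
      \<comment> \<open>The inverse of \<open>X\<close> is split: the power \<alpha> is integrated
        in the free outgoing momentum \<open>u\<close>, and the power \<open>1 - \<alpha>\<close> is
        passed on to the total momentum \<open>s\<close>.\<close>
      also have "\<dots> = 2 / \<tau> * (X powr - \<alpha> * X powr - (1 - \<alpha>))"
      proof -
        have "X powr - \<alpha> * X powr - (1 - \<alpha>) = X powr (- 1)"
          unfolding powr_add[symmetric] by simp
        then show ?thesis using X0 \<tau> by (simp add: powr_minus_divide)
      qed
      also have "\<dots> \<le> 2 / \<tau> * (riesz_weight \<alpha> u * (2 * ((norm s)\<^sup>2) powr - (1 - \<alpha>)))"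
      proof (intro mult_left_mono mult_mono)
        have "X powr - \<alpha> \<le> ((norm u)\<^sup>2) powr - \<alpha>"
          using \<alpha> u0 uX by (intro powr_mono2') auto
        also have "\<dots> \<le> riesz_weight \<alpha> u"
          using riesz_weight_lower[of u \<alpha>] nz' \<alpha> u0 by (simp add: powr_minus field_simps)
        finally show "X powr - \<alpha> \<le> riesz_weight \<alpha> u" .
        have "X powr - (1 - \<alpha>) \<le> ((norm s)\<^sup>2 / 2) powr - (1 - \<alpha>)"
          using \<alpha> s0 sX by (intro powr_mono2') auto
        also have "\<dots> = 2 powr (1 - \<alpha>) * ((norm s)\<^sup>2) powr - (1 - \<alpha>)"
        proof -
          have "((norm s)\<^sup>2 / 2) powr - (1 - \<alpha>) = ((norm s)\<^sup>2) powr - (1 - \<alpha>) / 2 powr - (1 - \<alpha>)"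
            by (rule powr_divide)
          then show ?thesis by (simp only: powr_minus_divide[of 2 "1 - \<alpha>"]) simp
        qed
        also have "\<dots> \<le> 2 powr 1 * ((norm s)\<^sup>2) powr - (1 - \<alpha>)"
          using \<alpha> by (intro mult_right_mono powr_mono) auto
        finally show "X powr - (1 - \<alpha>) \<le> 2 * ((norm s)\<^sup>2) powr - (1 - \<alpha>)" by simp
      qed (use \<tau> riesz_weight_ge_1[of \<alpha> u] in auto)
      finally have "bessel_weight \<tau> k p * (qI p $ 1)\<^sup>2 \<le>
        2 / \<tau> * (riesz_weight \<alpha> u * (2 * ((norm s)\<^sup>2) powr - (1 - \<alpha>))) * (qI p $ 1)\<^sup>2"
        by (intro mult_right_mono) auto
      also have "\<dots> = cq (qI p) * (\<Prod>i\<in>I - {i0}. g i (p i))"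
        unfolding i1 by (simp add: cq_def g_def u_def s_def mult_ac)
      finally show ?thesis .
    qed
    show "1 \<le> (\<Prod>i=1..j. h i (x i)) * w x" if le: "R_normsq \<tau> n x \<le> \<tau> * \<xi>"
      and nz: "\<forall>i\<in>{1..j}. rescale \<tau> (x i) $ 1 \<noteq> 0 \<and> rescale \<tau> (x i) $ 2 \<noteq> 0" for x
    proof -
      have "(\<Prod>i=1..j. h i (x i)) = (\<Prod>i=1..j. if i \<in> {1} then disc_weight \<xi> (1 - \<alpha>) (1 - \<alpha>) (rescale \<tau> (x i)) else 1)"
        by (intro prod.cong) (auto simp: h_def)
      also have "\<dots> = disc_weight \<xi> (1 - \<alpha>) (1 - \<alpha>) (rescale \<tau> (x 1))"
        using j1 by (subst prod_if_subset) auto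
      finally have eq: "(\<Prod>i=1..j. h i (x i)) = disc_weight \<xi> (1 - \<alpha>) (1 - \<alpha>) (rescale \<tau> (x 1))" .
      have "\<tau> * (\<Sum>i\<in>{1}. (norm (rescale \<tau> (x i)))\<^sup>2) \<le> R_normsq \<tau> n x"
        using j by (intro R_normsq_ge \<tau>) auto
      then have "(norm (rescale \<tau> (x 1)))\<^sup>2 \<le> R_normsq \<tau> n x / \<tau>"
        using \<tau> by (simp add: field_simps)
      then show ?thesis
        unfolding eq w_def using nz j1 j \<alpha> norm_rescale_sq_le[OF le \<tau>, of 1]
        by (intro disc_weight_lower) auto
    qed
    show "cq (\<Sum>i=1..Suc j. x i) * w x \<le> 4 * real (Suc j) / (\<tau> * nu \<tau>) * mixed_weight \<tau> \<alpha> n x" for x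
    proof -
      define q where "q = (\<Sum>i=1..Suc j. x i)"
      define b where "b = rescale \<tau> q $ 1"
      define W where "W = nu \<tau> * e1_normsq n x"
      have W0: "0 \<le> W" using nu e1_normsq_nonneg[of n x] by (simp add: W_def)
      have "nu \<tau> * (q $ 1)\<^sup>2 \<le> nu \<tau> * (real (Suc j) * e1_normsq n x)"
        unfolding q_def using nu by (intro mult_left_mono total_e1_sq_le j) auto
      then have b2: "b\<^sup>2 \<le> real (Suc j) * W / \<tau>"
        using \<tau> unfolding nu_e1_sq[OF \<tau>] b_def[symmetric] by (simp add: W_def field_simps)
      \<comment> \<open>The squared norm of the rescaled total is at least \<open>b\<^sup>2\<close>,
        so the negative power takes \<open>b\<^sup>2\<close> down to its power \<alpha>. This is
        precisely the first factor of \<open>mixed_weight\<close>; \<open>w\<close> supplies the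
        second.\<close>
      have "(q $ 1)\<^sup>2 * ((norm (rescale \<tau> q))\<^sup>2) powr - (1 - \<alpha>) \<le> \<tau> / nu \<tau> * (b\<^sup>2) powr \<alpha>"
      proof (cases "b = 0")
        case True
        then have "q $ 1 = 0" using \<tau> nu by (simp add: b_def rescale_nth)
        then show ?thesis using \<tau> nu by simp
      next
        case False
        have "(q $ 1)\<^sup>2 * ((norm (rescale \<tau> q))\<^sup>2) powr - (1 - \<alpha>) \<le> (q $ 1)\<^sup>2 * (b\<^sup>2) powr - (1 - \<alpha>)"
          using False \<alpha> nth_sq_le_norm_sq(1)[of "rescale \<tau> q"] by (intro mult_left_mono powr_mono2') (auto simp: b_def)
        also have "\<dots> = \<tau> / nu \<tau> * ((b\<^sup>2) powr 1 * (b\<^sup>2) powr - (1 - \<alpha>))"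
        proof -
          have "(q $ 1)\<^sup>2 = \<tau> / nu \<tau> * b\<^sup>2"
            using nu_e1_sq[OF \<tau>, of q] nu by (simp add: b_def field_simps)
          then show ?thesis using False by simp
        qed
        also have "(b\<^sup>2) powr 1 * (b\<^sup>2) powr - (1 - \<alpha>) = (b\<^sup>2) powr \<alpha>"
          by (simp only: powr_add[symmetric]) simp
        finally show ?thesis .
      qed
      also have "\<dots> \<le> \<tau> / nu \<tau> * (real (Suc j) * W / \<tau>) powr \<alpha>"
        using \<tau> nu \<alpha>0 b2 by (intro mult_left_mono powr_mono2) auto
      also have "\<dots> \<le> \<tau> / nu \<tau> * (real (Suc j) * (W / \<tau>) powr \<alpha>)"
      proof -
        have "(real (Suc j)) powr \<alpha> \<le> real (Suc j) powr 1"
          using \<alpha> by (intro powr_mono) auto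
        then have "(real (Suc j)) powr \<alpha> * (W / \<tau>) powr \<alpha> \<le> real (Suc j) * (W / \<tau>) powr \<alpha>"
          by (intro mult_right_mono) auto
        then show ?thesis using \<tau> nu W0 by (intro mult_left_mono) (auto simp: powr_mult[symmetric])
      qed
      finally have "cq q * w x \<le> 4 / \<tau> * (\<tau> / nu \<tau> * (real (Suc j) * (W / \<tau>) powr \<alpha>)) * (R_normsq \<tau> n x / \<tau>) powr (1 - \<alpha>)"
        unfolding cq_def w_def using \<tau> by (intro mult_right_mono mult_left_mono) auto
      also have "\<dots> = 4 * real (Suc j) / nu \<tau> * ((W / \<tau>) powr \<alpha> * (R_normsq \<tau> n x / \<tau>) powr (1 - \<alpha>))"
        using \<tau> nu by (simp add: field_simps)
      also have "(W / \<tau>) powr \<alpha> * (R_normsq \<tau> n x / \<tau>) powr (1 - \<alpha>) = mixed_weight \<tau> \<alpha> n x / \<tau>"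
      proof -
        have "\<tau> powr \<alpha> * \<tau> powr (1 - \<alpha>) = \<tau>" using \<tau> by (simp add: powr_add[symmetric])
        then show ?thesis
          using \<tau> W0 R_normsq_nonneg[of \<tau> n x] by (simp add: powr_divide mixed_weight_def W_def[symmetric])
      qed
      finally show ?thesis unfolding q_def by (simp add: mult.commute)
    qed
    show "cq \<in> borel_measurable borel"
      unfolding cq_def[abs_def] by measurable
    show "w \<in> borel_measurable (leb n)" unfolding w_def[abs_def] by measurable
  qed (use K0 \<xi> \<tau> nu disc_weight_nonneg in \<open>auto simp: h_def cg_def ch_def cq_def w_def\<close>)
  also have "(\<Prod>i\<in>I - {i0}. cg i) * (\<Prod>i=1..j. ch i) = K\<^sup>2 * \<xi> powr \<alpha>"
  proof -
    have "(\<Prod>i=1..j. ch i) = (\<Prod>i=1..j. if i \<in> {1} then K * \<xi> powr \<alpha> else 1)"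
      by (intro prod.cong) (auto simp: ch_def)
    also have "\<dots> = K * \<xi> powr \<alpha>" using j1 by (subst prod_if_subset) auto
    finally show ?thesis by (simp add: i1 cg_def power2_eq_square)
  qed
  finally show ?thesis .
qed

text \<open>A single outgoing momentum is the total itself, so its Bessel weight cancels
  \<open>(e1 \<bullet> q)\<^sup>2\<close> completely and \<open>cq\<close> is constant. The whole of
  \<open>mixed_weight\<close> must then come from the incoming side. Two incoming momenta are used,
  each with exponent \<alpha> on the first coordinate and \<open>1 - \<alpha>\<close> on the second:
  the product of their first coordinates is controlled by the first symbol and that of their second
  coordinates by the second. Each integral over the disc gives
  \<open>\<xi> powr (1/2)\<close>.\<close>

lemma fibre_bound_one:
  assumes l: "l = 1" and j2: "2 \<le> j"
  shows "(\<integral>\<^sup>+p. ennreal ((Theta_prod \<rho> \<tau> k p) *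
      (bessel_weight \<tau> k p * (qI p $ 1)\<^sup>2) * (cmod (fib p))\<^sup>2) \<partial>leb k)
    \<le> ennreal (mass \<tau> ^ (l - 1 + j) * (K\<^sup>2 * \<xi> * (2 / (\<tau> * nu \<tau>))))
      * weighted_mass \<rho> \<tau> \<alpha> n \<psi>"
proof -
  have K0: "0 \<le> K" using K_ge by linarith
  have M: "0 \<le> mass \<tau>" using mass_pos[OF \<tau>] by simp
  have I0: "I - {i0} = {}" "I = {i0}" using I l by (auto simp: card_1_singleton_iff)
  define h where "h i u = (if i \<in> {1,2} then disc_weight \<xi> \<alpha> (1 - \<alpha>) (rescale \<tau> u) else 1)" for i :: nat and u
  define ch where "ch i = (if i \<in> {1,2} then K * \<xi> powr (1/2) else 1)" for i :: nat
  define w where "w x = mixed_weight \<tau> \<alpha> n x / \<tau>" for x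
  have nu: "nu \<tau> > 0" by (rule nu_pos)
  have Th1: "(\<integral>\<^sup>+u. ennreal (Theta \<rho> \<tau> u * 1) \<partial>lborel) \<le> ennreal (mass \<tau> * 1)"
    using nn_integral_Theta[OF \<rho> \<tau>] by simp
  have Th2: "(\<integral>\<^sup>+u. ennreal (Theta \<rho> \<tau> u * disc_weight \<xi> \<alpha> (1 - \<alpha>) (rescale \<tau> u)) \<partial>lborel) \<le> ennreal (mass \<tau> * (K * \<xi> powr (1/2)))"
  proof (rule order.trans[OF nn_integral_Theta_disc[OF \<rho> \<tau> _ _ _ _ \<xi>]])
    have "1 - (\<alpha> + (1 - \<alpha>)) / 2 = 1/2" by simp
    then have "4 / ((1 - \<alpha>) * (1 - (1 - \<alpha>))) * \<xi> powr (1 - (\<alpha> + (1 - \<alpha>)) / 2) \<le> K * \<xi> powr (1/2)"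
      using singularity_const_bounds(2)[OF \<alpha>] by (simp only:) (intro mult_right_mono, auto)
    then show "ennreal (mass \<tau> * (4 / ((1 - \<alpha>) * (1 - (1 - \<alpha>))) * \<xi> powr (1 - (\<alpha> + (1 - \<alpha>)) / 2))) \<le> ennreal (mass \<tau> * (K * \<xi> powr (1/2)))"
      using M by (intro ennreal_leI mult_left_mono)
  qed (use \<alpha> in auto)
  have pr: "(\<Prod>i=1..j. if i \<in> {1,2} then f i else 1) = f 1 * f 2" for f :: "nat \<Rightarrow> real"
    using j2 by (subst prod_if_subset) auto
  have "(\<integral>\<^sup>+p. ennreal ((Theta_prod \<rho> \<tau> k p) *
      (bessel_weight \<tau> k p * (qI p $ 1)\<^sup>2) * (cmod (fib p))\<^sup>2) \<partial>leb k)
    \<le> ennreal (mass \<tau> ^ (l - 1 + j) * ((\<Prod>i\<in>I - {i0}. 1) * (\<Prod>i=1..j. ch i) * (2 / (\<tau> * nu \<tau>)))) * weighted_mass \<rho> \<tau> \<alpha> n \<psi>"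
  proof (rule fibre_bound[where g="\<lambda>_ _. 1" and cg="\<lambda>_. 1" and h=h and cq="\<lambda>_. 2 / nu \<tau>" and w=w])
    show "h i \<in> borel_measurable borel" for i
      unfolding h_def[abs_def] by (cases "i \<in> {1,2}") auto
    show "(\<integral>\<^sup>+u. ennreal (Theta \<rho> \<tau> u * h i u) \<partial>lborel) \<le> ennreal (mass \<tau> * ch i)" for i
      using Th1 Th2 by (auto simp: h_def ch_def)
    show "bessel_weight \<tau> k p * (qI p $ 1)\<^sup>2 \<le> 2 / nu \<tau> * (\<Prod>i\<in>I - {i0}. 1)" for p
    proof (cases "p i0 $ 1 = 0")
      case False
      have "nu \<tau> * (p i0 $ 1)\<^sup>2 \<le> \<tau> * (\<Sum>i\<in>{i0}. (norm (rescale \<tau> (p i)))\<^sup>2)"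
        unfolding nu_e1_sq[OF \<tau>] using \<tau> by (auto intro!: mult_left_mono nth_sq_le_norm_sq)
      also have "\<dots> \<le> R_normsq \<tau> k p" using I by (intro R_normsq_ge \<tau>) auto
      finally have "2 * (nu \<tau> * (p i0 $ 1)\<^sup>2 / 2) \<le> R_normsq \<tau> k p" by simp
      then have "bessel_weight \<tau> k p \<le> 1 / (nu \<tau> * (p i0 $ 1)\<^sup>2 / 2)"
        using nu False by (intro H_weight_le) auto
      then have "bessel_weight \<tau> k p * (p i0 $ 1)\<^sup>2 \<le> 1 / (nu \<tau> * (p i0 $ 1)\<^sup>2 / 2) * (p i0 $ 1)\<^sup>2"
        by (intro mult_right_mono) auto
      then show ?thesis using False I0 by simp
    qed (use nu I0 in simp)
    show "1 \<le> (\<Prod>i=1..j. h i (x i)) * w x" if le: "R_normsq \<tau> n x \<le> \<tau> * \<xi>"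
      and nz: "\<forall>i\<in>{1..j}. rescale \<tau> (x i) $ 1 \<noteq> 0 \<and> rescale \<tau> (x i) $ 2 \<noteq> 0" for x
    proof -
      define u where "u = rescale \<tau> (x 1)"
      define v where "v = rescale \<tau> (x 2)"
      have nz': "u$1 \<noteq> 0" "u$2 \<noteq> 0" "v$1 \<noteq> 0" "v$2 \<noteq> 0" using nz j2 by (auto simp: u_def v_def)
      have sm: "(norm u)\<^sup>2 \<le> \<xi>" "(norm v)\<^sup>2 \<le> \<xi>"
        unfolding u_def v_def using norm_rescale_sq_le[OF le \<tau>] j2 j by auto
      have eq: "(\<Prod>i=1..j. h i (x i)) = disc_weight \<xi> \<alpha> (1 - \<alpha>) u * disc_weight \<xi> \<alpha> (1 - \<alpha>) v"
        unfolding h_def pr by (simp add: u_def v_def)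
      have W1: "\<bar>u$1\<bar> * \<bar>v$1\<bar> \<le> nu \<tau> * e1_normsq n x / \<tau>"
      proof -
        have "2 * (\<bar>u$1\<bar> * \<bar>v$1\<bar>) \<le> (u$1)\<^sup>2 + (v$1)\<^sup>2"
          using sum_squares_bound[of "\<bar>u$1\<bar>" "\<bar>v$1\<bar>"] by (simp add: mult.assoc)
        also have "\<dots> = (\<Sum>i\<in>{1,2}. (rescale \<tau> (x i) $ 1)\<^sup>2)" by (simp add: u_def v_def)
        also have "\<dots> \<le> (\<Sum>i=1..n. (rescale \<tau> (x i) $ 1)\<^sup>2)" using j2 j by (intro sum_mono2) auto
        finally have "2 * (\<bar>u$1\<bar> * \<bar>v$1\<bar>) \<le> nu \<tau> * e1_normsq n x / \<tau>"
          unfolding nu_e1_normsq_eq[OF \<tau>] using \<tau> by simp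
        moreover have "0 \<le> \<bar>u$1\<bar> * \<bar>v$1\<bar>" by simp
        ultimately show ?thesis by linarith
      qed
      have W2: "\<bar>u$2\<bar> * \<bar>v$2\<bar> \<le> R_normsq \<tau> n x / \<tau>"
      proof -
        have "2 * (\<bar>u$2\<bar> * \<bar>v$2\<bar>) \<le> (u$2)\<^sup>2 + (v$2)\<^sup>2"
          using sum_squares_bound[of "\<bar>u$2\<bar>" "\<bar>v$2\<bar>"] by (simp add: mult.assoc)
        also have "\<dots> \<le> (norm u)\<^sup>2 + (norm v)\<^sup>2" by (intro add_mono nth_sq_le_norm_sq)
        also have "\<dots> = (\<Sum>i\<in>{1,2}. (norm (rescale \<tau> (x i)))\<^sup>2)" by (simp add: u_def v_def)
        also have "\<dots> \<le> (\<Sum>i=1..n. (norm (rescale \<tau> (x i)))\<^sup>2)" using j2 j by (intro sum_mono2) auto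
        finally have "2 * (\<bar>u$2\<bar> * \<bar>v$2\<bar>) \<le> R_normsq \<tau> n x / \<tau>"
          unfolding R_normsq_eq[OF \<tau>] using \<tau> by simp
        moreover have "0 \<le> \<bar>u$2\<bar> * \<bar>v$2\<bar>" by simp
        ultimately show ?thesis by linarith
      qed
      have "mixed_weight \<tau> \<alpha> n x / \<tau> = (nu \<tau> * e1_normsq n x / \<tau>) powr \<alpha> * (R_normsq \<tau> n x / \<tau>) powr (1 - \<alpha>)"
      proof -
        have "\<tau> powr \<alpha> * \<tau> powr (1 - \<alpha>) = \<tau>" using \<tau> by (simp add: powr_add[symmetric])
        then show ?thesis
          using \<tau> nu e1_normsq_nonneg[of n x] R_normsq_nonneg[of \<tau> n x] by (simp add: powr_divide mixed_weight_def)
      qed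
      also have "\<dots> \<ge> (\<bar>u$1\<bar> * \<bar>v$1\<bar>) powr \<alpha> * (\<bar>u$2\<bar> * \<bar>v$2\<bar>) powr (1 - \<alpha>)"
        using \<alpha> \<alpha>0 W1 W2 by (intro mult_mono powr_mono2) auto
      finally have lower: "(\<bar>u$1\<bar> * \<bar>v$1\<bar>) powr \<alpha> * (\<bar>u$2\<bar> * \<bar>v$2\<bar>) powr (1 - \<alpha>) \<le> w x" by (simp add: w_def)
      have pp: "c powr - a * c powr a = 1" if "c > 0" for a c :: real using that by (simp add: powr_add[symmetric])
      have "1 = (\<bar>u$1\<bar> powr - \<alpha> * \<bar>u$1\<bar> powr \<alpha>) * (\<bar>u$2\<bar> powr - (1 - \<alpha>) * \<bar>u$2\<bar> powr (1 - \<alpha>)) *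
          ((\<bar>v$1\<bar> powr - \<alpha> * \<bar>v$1\<bar> powr \<alpha>) * (\<bar>v$2\<bar> powr - (1 - \<alpha>) * \<bar>v$2\<bar> powr (1 - \<alpha>)))"
        using nz' by (subst pp, simp, subst pp, simp, subst pp, simp, subst pp, simp, simp)
      also have "\<dots> = (\<Prod>i=1..j. h i (x i)) * ((\<bar>u$1\<bar> * \<bar>v$1\<bar>) powr \<alpha> * (\<bar>u$2\<bar> * \<bar>v$2\<bar>) powr (1 - \<alpha>))"
        unfolding eq using sm by (simp add: disc_weight_def powr_mult mult_ac)
      also have "\<dots> \<le> (\<Prod>i=1..j. h i (x i)) * w x"
        using lower disc_weight_nonneg unfolding eq by (intro mult_left_mono mult_nonneg_nonneg) auto
      finally show ?thesis .
    qed
    show "w \<in> borel_measurable (leb n)" unfolding w_def[abs_def] mixed_weight_def[abs_def] by measurable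
    show "2 / nu \<tau> * w x \<le> 2 / (\<tau> * nu \<tau>) * mixed_weight \<tau> \<alpha> n x" for x
      by (simp add: w_def field_simps)
  qed (use K0 \<xi> \<tau> nu disc_weight_nonneg mixed_weight_nonneg I0 in \<open>auto simp: h_def ch_def w_def\<close>)
  also have "(\<Prod>i\<in>I - {i0}. 1) * (\<Prod>i=1..j. ch i) = K\<^sup>2 * \<xi>"
    unfolding ch_def pr using \<xi> by (simp add: power2_eq_square powr_half_sqrt)
  finally show ?thesis .
qed

end

section \<open>The operators on a single chaos\<close>

lemma borel_measurable_complex_of_real:
  "f \<in> borel_measurable M \<Longrightarrow> (\<lambda>x. complex_of_real (f x)) \<in> borel_measurable M"
  by (rule measurable_compose[OF _ borel_measurable_of_real])


lemma ennreal_add_mult_sum: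
  assumes "0 \<le> a" "0 \<le> B" "\<And>i. 0 \<le> b i"
  shows "ennreal (a + B * (\<Sum>i\<in>I. b i)) = ennreal a + ennreal B * (\<Sum>i\<in>I. ennreal (b i))"
proof -
  have "(\<Sum>i\<in>I. ennreal (b i)) = ennreal (\<Sum>i\<in>I. b i)"
    using assms by (intro sum_ennreal) auto
  then show ?thesis
    using assms by (simp add: ennreal_mult sum_nonneg)
qed

lemma ennreal_add_mult_of_nat:
  assumes "0 \<le> a" "0 \<le> B" "0 \<le> c"
  shows "ennreal a + ennreal B * (of_nat N * ennreal c) = ennreal (a + B * (real N * c))"
  using assms by (simp add: ennreal_mult ennreal_of_nat_eq_real_of_nat)

lemma fibre_integral_nonzero:
  assumes "fibre_integral \<rho> \<tau> j q f \<noteq> 0"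
  shows "\<exists>r. f r \<noteq> 0"
proof (rule ccontr)
  assume "\<nexists>r. f r \<noteq> 0"
  then have "fibre_integral \<rho> \<tau> j q f = 0" by (simp add: fibre_integral_def)
  with assms show False by simp
qed

lemma measurable_rest:
  assumes "j < n" "I \<subseteq> {1..k}" "card I = l" "k + Suc j = n + l"
  shows "rest j n k I \<in> measurable (leb k) (PiR2 {Suc (Suc j)..n})"
  unfolding rest_def[abs_def] leb_def
proof (intro measurable_restrict measurable_component_singleton)
  fix i assume "i \<in> {Suc (Suc j)..n}"
  then show "rest_index j k I i \<in> {1..k}"
    using bij_betw_rest_index[OF assms] by (auto simp: bij_betw_def)
qed

lemma sigma_finite_leb: "sigma_finite_measure (leb n)"
  unfolding leb_def by (rule sigma_finite_PiR2) simp

lemma measurable_glue_joined: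
  assumes jI: "j < n" "I \<subseteq> {1..k}" "card I = l" "k + Suc j = n + l"
  shows "(\<lambda>z. glue j n (\<Sum>i\<in>I. fst z i) (snd z) (rest j n k I (fst z))) \<in> measurable (leb k \<Otimes>\<^sub>M leb j) (leb n)"
proof -
  have q: "(\<lambda>z. \<Sum>i\<in>I. fst z i) \<in> borel_measurable (leb k \<Otimes>\<^sub>M leb j)"
    using jI by (intro borel_measurable_sum measurable_compose[OF measurable_fst borel_measurable_leb_component]) auto
  show ?thesis
    unfolding leb_def[of n] using jI q
    by (intro measurable_glue measurable_compose[OF measurable_fst measurable_rest] measurable_snd[of "leb k" "leb j", unfolded leb_def[of j], folded leb_def[of k]])
       (auto simp: leb_def)
qed

lemma borel_measurable_fibre_integral:
  assumes T: "Theta \<rho> \<tau> \<in> borel_measurable borel" and \<psi>: "\<psi> \<in> borel_measurable (leb n)"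
    and jI: "j < n" "I \<subseteq> {1..k}" "card I = l" "k + Suc j = n + l"
  shows "(\<lambda>p. fibre_integral \<rho> \<tau> j (\<Sum>i\<in>I. p i) (\<lambda>r. \<psi> (joined_args j n k I r p))) \<in> borel_measurable (leb k)"
proof -
  interpret J: sigma_finite_measure "leb j" by (rule sigma_finite_leb)
  have q: "(\<lambda>z. \<Sum>i\<in>I. fst z i) \<in> borel_measurable (leb k \<Otimes>\<^sub>M leb j)"
    using jI by (intro borel_measurable_sum measurable_compose[OF measurable_fst borel_measurable_leb_component]) auto
  have r: "(\<lambda>z. snd z i) \<in> borel_measurable (leb k \<Otimes>\<^sub>M leb j)" if "i \<in> {1..j}" for i
    by (rule measurable_compose[OF measurable_snd borel_measurable_leb_component[OF that]])
  have s: "(\<lambda>z. (\<Sum>i\<in>I. fst z i) - (\<Sum>i=1..j. snd z i)) \<in> borel_measurable (leb k \<Otimes>\<^sub>M leb j)"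
    by (intro borel_measurable_diff borel_measurable_sum q r)
  note g = measurable_glue_joined[OF jI]
  have t: "(\<lambda>z. Theta \<rho> \<tau> (((snd z)(Suc j := (\<Sum>i\<in>I. fst z i) - (\<Sum>i=1..j. snd z i))) i)) \<in> borel_measurable (leb k \<Otimes>\<^sub>M leb j)"
    if i: "i \<in> {1..Suc j}" for i
  proof (rule measurable_compose[OF _ T])
    show "(\<lambda>z. ((snd z)(Suc j := (\<Sum>i\<in>I. fst z i) - (\<Sum>i=1..j. snd z i))) i) \<in> borel_measurable (leb k \<Otimes>\<^sub>M leb j)"
    proof (cases "i = Suc j")
      case True
      then show ?thesis using s by simp
    next
      case False
      then show ?thesis using r[of i] i by simp
    qed
  qed
  show ?thesis
    unfolding fibre_integral_def Let_def joined_args_eq_glue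
  proof (rule J.borel_measurable_lebesgue_integral)
    have "(\<lambda>z. \<psi> (glue j n (\<Sum>i\<in>I. fst z i) (snd z) (rest j n k I (fst z))) *
        complex_of_real (\<Prod>i=1..Suc j. Theta \<rho> \<tau> (((snd z)(Suc j := (\<Sum>i\<in>I. fst z i) - (\<Sum>i=1..j. snd z i))) i)))
        \<in> borel_measurable (leb k \<Otimes>\<^sub>M leb j)"
      by (intro borel_measurable_times borel_measurable_complex_of_real borel_measurable_prod t measurable_compose[OF g \<psi>])
    then show "(\<lambda>(p, r). \<psi> (glue j n (\<Sum>i\<in>I. p i) r (rest j n k I p)) *
        complex_of_real (\<Prod>i=1..Suc j. Theta \<rho> \<tau> ((complete_fibre j (\<Sum>i\<in>I. p i) r) i)))
        \<in> borel_measurable (leb k \<Otimes>\<^sub>M leb j)"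
      by (simp add: case_prod_beta)
  qed
qed

lemma cmod_sum_sq_le_card: "(cmod (\<Sum>i\<in>A. z i))\<^sup>2 \<le> real (card A) * (\<Sum>i\<in>A. (cmod (z i))\<^sup>2)"
proof -
  have "(cmod (\<Sum>i\<in>A. z i))\<^sup>2 \<le> (\<Sum>i\<in>A. cmod (z i))\<^sup>2"
    by (intro power_mono norm_sum) auto
  then show ?thesis using sum_sq_le_card[of "\<lambda>i. cmod (z i)" A] by linarith
qed

text \<open>If two different sets contribute, each of them contains an index outside the other one.\<close>

lemma cmod_sum_sq_le_multiplicity:
  fixes z :: "'a set \<Rightarrow> complex" and s :: "'a \<Rightarrow> real"
  assumes fin: "finite \<I>" and \<I>: "\<And>I. I \<in> \<I> \<Longrightarrow> I \<subseteq> U \<and> card I = l" and U: "finite U"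
    and s: "\<And>i. 0 \<le> s i" "\<And>I i. \<lbrakk>I \<in> \<I>; z I \<noteq> 0; i \<in> U - I\<rbrakk> \<Longrightarrow> s i = 1"
  shows "(cmod (\<Sum>I\<in>\<I>. z I))\<^sup>2 \<le> (\<Sum>I\<in>\<I>. (1 + real (card \<I>) * (\<Sum>i\<in>I. s i)) * (cmod (z I))\<^sup>2)"
proof (cases "\<exists>I\<in>\<I>. \<forall>I'\<in>\<I>. z I' \<noteq> 0 \<longrightarrow> I' = I")
  case True
  \<comment> \<open>At most one set contributes, so the square of the sum is a single square and
    multiplicity \<open>1\<close> is enough.\<close>
  then obtain I where I: "I \<in> \<I>" "\<And>I'. I' \<in> \<I> \<Longrightarrow> I' \<noteq> I \<Longrightarrow> z I' = 0" by blast
  have "(\<Sum>I\<in>\<I>. z I) = (\<Sum>I'\<in>{I}. z I')"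
    using I fin by (intro sum.mono_neutral_right) auto
  then have "(cmod (\<Sum>I\<in>\<I>. z I))\<^sup>2 = 1 * (cmod (z I))\<^sup>2" by simp
  also have "\<dots> \<le> (1 + real (card \<I>) * (\<Sum>i\<in>I. s i)) * (cmod (z I))\<^sup>2"
    using s(1) by (intro mult_right_mono) (auto intro!: sum_nonneg mult_nonneg_nonneg)
  also have "\<dots> \<le> (\<Sum>I\<in>\<I>. (1 + real (card \<I>) * (\<Sum>i\<in>I. s i)) * (cmod (z I))\<^sup>2)"
    using I fin s(1) by (intro member_le_sum) (auto intro!: sum_nonneg mult_nonneg_nonneg add_nonneg_nonneg)
  finally show ?thesis .
next
  case False
  have "(cmod (\<Sum>I\<in>\<I>. z I))\<^sup>2 \<le> real (card \<I>) * (\<Sum>I\<in>\<I>. (cmod (z I))\<^sup>2)"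
    by (rule cmod_sum_sq_le_card)
  also have "\<dots> = (\<Sum>I\<in>\<I>. real (card \<I>) * (cmod (z I))\<^sup>2)" by (simp add: sum_distrib_left)
  also have "\<dots> \<le> (\<Sum>I\<in>\<I>. (1 + real (card \<I>) * (\<Sum>i\<in>I. s i)) * (cmod (z I))\<^sup>2)"
  proof (rule sum_mono)
    fix I assume I: "I \<in> \<I>"
    show "real (card \<I>) * (cmod (z I))\<^sup>2 \<le> (1 + real (card \<I>) * (\<Sum>i\<in>I. s i)) * (cmod (z I))\<^sup>2"
    proof (cases "z I = 0")
      case False
      obtain I' where I': "I' \<in> \<I>" "z I' \<noteq> 0" "I' \<noteq> I"
        using \<open>\<not> (\<exists>I\<in>\<I>. \<forall>I'\<in>\<I>. z I' \<noteq> 0 \<longrightarrow> I' = I)\<close> I by blast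
      have finI: "finite I" "finite I'" using \<I>[OF I] \<I>[OF I'(1)] U finite_subset by blast+
      \<comment> \<open>Sets of equal cardinality are nested only if they are equal.\<close>
      have "\<not> I \<subseteq> I'"
        using card_subset_eq[of I' I] \<I>[OF I] \<I>[OF I'(1)] finI I'(3) by auto
      then obtain i where i: "i \<in> I" "i \<notin> I'" by blast
      then have "s i = 1" using s(2)[OF I'(1,2), of i] \<I>[OF I] by blast
      then have "1 \<le> (\<Sum>i\<in>I. s i)"
        using member_le_sum[of i I s] i finI s(1) by auto
      then have "real (card \<I>) * 1 \<le> 1 + real (card \<I>) * (\<Sum>i\<in>I. s i)"
        by (intro order.trans[OF mult_left_mono[of 1 "\<Sum>i\<in>I. s i"]]) auto
      then show ?thesis by (intro mult_right_mono) auto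
    qed simp
  qed
  finally show ?thesis .
qed

text \<open>There are \<open>m - 1\<close> integrations, \<open>j\<close> over incoming and
  \<open>m - j - 1\<close> over outgoing momenta, each costing \<open>mass \<tau>\<close>. The
  powers of \<open>2 * pi\<close> cancel, \<tau> is left with exponent
  \<open>(2 - m) + (m - 1) = 1\<close> and \<open>nu\<close> with
  \<open>(1 + m) / 2 - (m - 1) / 2 = 1\<close>.\<close>

lemma prefactor_sq:
  assumes \<tau>: "\<tau> > 0" and m: "m \<ge> 1"
  shows "(\<tau> powr (1 - real m / 2) * nu \<tau> powr ((1 + real m) / 4) / (2 * pi) ^ (m - 1))\<^sup>2 * mass \<tau> ^ (m - 1) / (\<tau> * nu \<tau>) = 1"
proof -
  have nu: "nu \<tau> > 0" by (rule nu_pos)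
  have 1: "(\<tau> powr (1 - real m / 2))\<^sup>2 = \<tau> powr (2 - real m)"
    using \<tau> by (simp add: powr_power algebra_simps)
  have 2: "(nu \<tau> powr ((1 + real m) / 4))\<^sup>2 = nu \<tau> powr ((1 + real m) / 2)"
  proof -
    have e: "real 2 * ((1 + real m) / 4) = (1 + real m) / 2" by simp
    have "(nu \<tau> powr ((1 + real m) / 4))\<^sup>2 = nu \<tau> powr (real 2 * ((1 + real m) / 4))"
      by (rule powr_power) (use nu in simp)
    then show ?thesis by (simp only: e)
  qed
  have 3: "\<tau> ^ (m - 1) = \<tau> powr (real m - 1)"
    using \<tau> m by (simp add: powr_realpow[symmetric] of_nat_diff)
  have 4: "sqrt (nu \<tau>) ^ (m - 1) = nu \<tau> powr ((real m - 1) / 2)"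
    using nu m by (simp add: powr_half_sqrt[symmetric] powr_power of_nat_diff)
  have 5: "\<tau> powr (2 - real m) * \<tau> powr (real m - 1) = \<tau>"
    using \<tau> by (simp add: powr_add[symmetric])
  have 6: "nu \<tau> powr ((1 + real m) / 2) = nu \<tau> * nu \<tau> powr ((real m - 1) / 2)"
  proof -
    have "(1 + real m) / 2 = 1 + (real m - 1) / 2" by (simp add: field_simps)
    then have "nu \<tau> powr ((1 + real m) / 2) = nu \<tau> powr (1 + (real m - 1) / 2)" by (simp only:)
    also have "\<dots> = nu \<tau> powr 1 * nu \<tau> powr ((real m - 1) / 2)" by (rule powr_add)
    finally show ?thesis using nu by simp
  qed
  have 7: "((2 * pi)\<^sup>2) ^ (m - 1) = ((2 * pi) ^ (m - 1))\<^sup>2"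
    by (simp only: power_mult[symmetric] mult.commute)
  have M: "mass \<tau> ^ (m - 1) = ((2 * pi) ^ (m - 1))\<^sup>2 * (\<tau> powr (real m - 1) / nu \<tau> powr ((real m - 1) / 2))"
    unfolding mass_def by (simp only: power_mult_distrib[of "(2 * pi)\<^sup>2"] power_divide 7 3 4)
  have gen: "(A * B / a)\<^sup>2 * (a\<^sup>2 * (t / s)) = (A\<^sup>2 * t) * (B\<^sup>2 / s)" if "a \<noteq> 0" for A B a t s :: real
    using that by (simp add: power_mult_distrib power_divide)
  have "(\<tau> powr (1 - real m / 2) * nu \<tau> powr ((1 + real m) / 4) / (2 * pi) ^ (m - 1))\<^sup>2 * mass \<tau> ^ (m - 1) =
      (\<tau> powr (2 - real m) * \<tau> powr (real m - 1)) * (nu \<tau> powr ((1 + real m) / 2) / nu \<tau> powr ((real m - 1) / 2))"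
    unfolding M 1[symmetric] 2[symmetric] by (rule gen) simp
  also have "\<dots> = \<tau> * nu \<tau>"
    unfolding 5 6 using nu by simp
  finally show ?thesis using \<tau> nu by simp
qed

text \<open>\<open>counting m j n\<close> is what remains of the combinatorial prefactors after Cauchy--Schwarz over
  the subsets \<open>I\<close>.\<close>

definition counting :: "nat \<Rightarrow> nat \<Rightarrow> nat \<Rightarrow> real" where
  "counting m j n = (let k = n + m - (2 * j + 1) in
     fact m * fact k * (fact n / (fact k * fact (j + 1)))\<^sup>2 * (real (k choose (m - j)))\<^sup>2 / fact n)"

locale chaos_setup =
  fixes \<rho> :: "real^2 \<Rightarrow> real" and \<tau> \<alpha> \<xi> :: real and m j n :: nat and \<psi> :: chaos
  assumes \<rho>: "mollifier \<rho>" and \<tau>: "\<tau> > 0" and \<alpha>: "1/2 \<le> \<alpha>" "\<alpha> < 1" and \<xi>: "0 \<le> \<xi>"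
    and j: "j < n" "j < m" and m: "3 \<le> m"
    and \<psi>: "\<psi> \<in> borel_measurable (leb n)"
    and supp: "\<And>x. \<psi> x \<noteq> 0 \<Longrightarrow> R_normsq \<tau> n x \<le> \<tau> * \<xi>"
begin

abbreviation "k \<equiv> n + m - (2 * j + 1)"
abbreviation "\<I> \<equiv> {I. I \<subseteq> {1..k} \<and> card I = m - j}"
abbreviation "K \<equiv> singularity_const \<alpha>"
abbreviation "qI I p \<equiv> (\<Sum>i\<in>I. p i :: real^2)"
abbreviation "fib I p \<equiv> fibre_integral \<rho> \<tau> j (qI I p) (\<lambda>r. \<psi> (joined_args j n k I r p))"
abbreviation "Th p \<equiv> (Theta_prod \<rho> \<tau> k p)"
abbreviation "comb \<equiv> fact n / (fact k * fact (j + 1)) :: real"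
abbreviation "WM \<equiv> weighted_mass \<rho> \<tau> \<alpha> n \<psi>"

lemma k_eq: "k + Suc j = n + (m - j)" using j by simp

lemma card_\<I>: "card \<I> = k choose (m - j)"
  using n_subsets[of "{1..k}" "m - j"] by simp

lemma fibre_setup_I: "I \<in> \<I> \<Longrightarrow> i0 \<in> I \<Longrightarrow> fibre_setup \<rho> \<tau> \<alpha> \<xi> j n k (m - j) I i0 \<psi>"
  unfolding fibre_setup_def using \<rho> \<tau> \<alpha> \<xi> j k_eq \<psi> supp by auto

lemma fib_measurable: "I \<in> \<I> \<Longrightarrow> fib I \<in> borel_measurable (leb k)"
  using borel_measurable_fibre_integral[OF Theta_props(1)[OF \<rho>] \<psi> j(1) _ _ k_eq] by auto

lemma Th_measurable [measurable]: "Th \<in> borel_measurable (leb k)"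
  by (intro borel_measurable_prod measurable_compose[OF borel_measurable_leb_component Theta_props(1)[OF \<rho>]])

lemma H_measurable: "(\<lambda>p. bessel_weight \<tau> k p) \<in> borel_measurable (leb k)"
  by measurable

lemma borel_measurable_cmod: "f \<in> borel_measurable M \<Longrightarrow> (\<lambda>x. cmod (f x)) \<in> borel_measurable M"
  by (rule measurable_compose[OF _ borel_measurable_norm])

lemma Th_nonneg: "0 \<le> Th p"
  by (intro prod_nonneg Theta_props[OF \<rho>])

lemma q_measurable: "I \<in> \<I> \<Longrightarrow> (\<lambda>p. qI I p $ 1) \<in> borel_measurable (leb k)"
  by (intro measurable_compose[OF _ borel_measurable_nth] borel_measurable_sum borel_measurable_leb_component) auto

lemma A_chaos_eq:
  "A_chaos \<rho> \<tau> m j n \<psi> p = - \<i> * complex_of_real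
      (\<tau> powr (1 - real m / 2) * nu \<tau> powr ((1 + real m) / 4) / (2 * pi) ^ (m - 1) * comb) *
    (\<Sum>I\<in>\<I>. complex_of_real (qI I p $ 1) * fib I p)"
  using j m unfolding A_chaos_def Let_def e1_inner by simp

lemma A_chaos_measurable: "A_chaos \<rho> \<tau> m j n \<psi> \<in> borel_measurable (leb k)"
  unfolding A_chaos_eq[abs_def]
  by (intro borel_measurable_times borel_measurable_const borel_measurable_sum borel_measurable_complex_of_real q_measurable fib_measurable)

text \<open>The multiplicity \<open>\<mu>\<close> stands for the price of squaring the sum over
  \<open>I\<close>. It may depend on the momenta: besides the constant number of sets, a price is
  used below that is larger than \<open>1\<close> only where some outgoing momentum is
  confined.\<close>

lemma A_chaos_bound_multiplicity:
  assumes \<mu>: "\<And>I p. 0 \<le> \<mu> I p"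
    and point: "\<And>p. (cmod (\<Sum>I\<in>\<I>. complex_of_real (qI I p $ 1) * fib I p))\<^sup>2 \<le>
      (\<Sum>I\<in>\<I>. \<mu> I p * (cmod (complex_of_real (qI I p $ 1) * fib I p))\<^sup>2)"
    and \<mu>m: "\<And>I. I \<in> \<I> \<Longrightarrow> \<mu> I \<in> borel_measurable (leb k)"
    and bound: "\<And>I. I \<in> \<I> \<Longrightarrow>
      (\<integral>\<^sup>+p. ennreal (Th p * (bessel_weight \<tau> k p * (qI I p $ 1)\<^sup>2 * \<mu> I p) * (cmod (fib I p))\<^sup>2) \<partial>leb k)
      \<le> ennreal (mass \<tau> ^ (m - 1) * (Q / (\<tau> * nu \<tau>))) * WM"
    and Q: "0 \<le> Q"
  shows "chaos_dual_normsq \<rho> \<tau> m j n \<psi> k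
    \<le> ennreal (comb\<^sup>2 * real (card \<I>) * Q) * WM"
proof -
  define c where "c = \<tau> powr (1 - real m / 2) * nu \<tau> powr ((1 + real m) / 4) / (2 * pi) ^ (m - 1)"
  have c0: "0 \<le> c" using nu_pos[of \<tau>] by (simp add: c_def)
  let ?H = "\<lambda>p. bessel_weight \<tau> k p"
  let ?F = "\<lambda>I p. Th p * (?H p * (qI I p $ 1)\<^sup>2 * \<mu> I p) * (cmod (fib I p))\<^sup>2"
  have Fm: "?F I \<in> borel_measurable (leb k)" if "I \<in> \<I>" for I
    by (intro borel_measurable_times borel_measurable_power borel_measurable_cmod Th_measurable H_measurable
        q_measurable fib_measurable \<mu>m that)
  have F0: "0 \<le> ?F I p" for I p
    by (intro mult_nonneg_nonneg Th_nonneg \<mu>) auto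
  have [measurable]: "A_chaos \<rho> \<tau> m j n \<psi> \<in> borel_measurable (leb k)" by (rule A_chaos_measurable)
  have "(\<integral>\<^sup>+p. ennreal (?H p * (cmod (A_chaos \<rho> \<tau> m j n \<psi> p))\<^sup>2) \<partial>Xi \<rho> \<tau> k) =
      (\<integral>\<^sup>+p. ennreal (Th p) * ennreal (?H p * (cmod (A_chaos \<rho> \<tau> m j n \<psi> p))\<^sup>2) \<partial>leb k)"
    unfolding Xi_def by (intro nn_integral_density) measurable
  also have "\<dots> \<le> (\<integral>\<^sup>+p. (\<Sum>I\<in>\<I>. ennreal ((c * comb)\<^sup>2) * ennreal (?F I p)) \<partial>leb k)"
  proof (rule nn_integral_mono)
    fix p
    let ?z = "\<lambda>I. complex_of_real (qI I p $ 1) * fib I p"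
    have "(cmod (A_chaos \<rho> \<tau> m j n \<psi> p))\<^sup>2 = (c * comb)\<^sup>2 * (cmod (\<Sum>I\<in>\<I>. ?z I))\<^sup>2"
      unfolding A_chaos_eq c_def[symmetric]
      by (simp only: norm_mult norm_minus_cancel norm_ii norm_of_real power_mult_distrib mult_1 power2_abs)
    also have "\<dots> \<le> (c * comb)\<^sup>2 * (\<Sum>I\<in>\<I>. \<mu> I p * (cmod (?z I))\<^sup>2)"
      by (intro mult_left_mono point) auto
    finally have "Th p * ?H p * (cmod (A_chaos \<rho> \<tau> m j n \<psi> p))\<^sup>2 \<le> Th p * ?H p * ((c * comb)\<^sup>2 * (\<Sum>I\<in>\<I>. \<mu> I p * (cmod (?z I))\<^sup>2))"
      by (intro mult_left_mono mult_nonneg_nonneg Th_nonneg) auto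
    also have "\<dots> = (c * comb)\<^sup>2 * (\<Sum>I\<in>\<I>. Th p * ?H p * (\<mu> I p * (cmod (?z I))\<^sup>2))"
      by (simp only: sum_distrib_left mult_ac)
    also have "\<dots> = (\<Sum>I\<in>\<I>. (c * comb)\<^sup>2 * ?F I p)"
      unfolding sum_distrib_left
      by (intro sum.cong refl) (simp only: norm_mult norm_of_real power_mult_distrib power2_abs mult_ac)
    finally have le: "Th p * (?H p * (cmod (A_chaos \<rho> \<tau> m j n \<psi> p))\<^sup>2) \<le> (\<Sum>I\<in>\<I>. (c * comb)\<^sup>2 * ?F I p)"
      by (simp only: mult.assoc)
    have "ennreal (Th p) * ennreal (?H p * (cmod (A_chaos \<rho> \<tau> m j n \<psi> p))\<^sup>2) = ennreal (Th p * (?H p * (cmod (A_chaos \<rho> \<tau> m j n \<psi> p))\<^sup>2))"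
      by (intro ennreal_mult[symmetric] Th_nonneg) auto
    also have "\<dots> \<le> ennreal (\<Sum>I\<in>\<I>. (c * comb)\<^sup>2 * ?F I p)"
      by (intro ennreal_leI le)
    also have "\<dots> = (\<Sum>I\<in>\<I>. ennreal ((c * comb)\<^sup>2 * ?F I p))"
      by (intro sum_ennreal[symmetric] mult_nonneg_nonneg[OF _ F0]) auto
    also have "\<dots> = (\<Sum>I\<in>\<I>. ennreal ((c * comb)\<^sup>2) * ennreal (?F I p))"
      by (intro sum.cong refl ennreal_mult F0) auto
    finally show "ennreal (Th p) * ennreal (?H p * (cmod (A_chaos \<rho> \<tau> m j n \<psi> p))\<^sup>2) \<le> (\<Sum>I\<in>\<I>. ennreal ((c * comb)\<^sup>2) * ennreal (?F I p))" .
  qed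
  also have "\<dots> = (\<Sum>I\<in>\<I>. ennreal ((c * comb)\<^sup>2) * (\<integral>\<^sup>+p. ennreal (?F I p) \<partial>leb k))"
    using Fm by (subst nn_integral_sum) (auto intro!: sum.cong nn_integral_cmult)
  also have "\<dots> \<le> (\<Sum>I\<in>\<I>. ennreal ((c * comb)\<^sup>2) * (ennreal (mass \<tau> ^ (m - 1) * (Q / (\<tau> * nu \<tau>))) * WM))"
    by (intro sum_mono mult_left_mono bound) auto
  also have "\<dots> = of_nat (card \<I>) * (ennreal ((c * comb)\<^sup>2) * ennreal (mass \<tau> ^ (m - 1) * (Q / (\<tau> * nu \<tau>)))) * WM"
    by (simp add: mult.assoc)
  also have "of_nat (card \<I>) * (ennreal ((c * comb)\<^sup>2) * ennreal (mass \<tau> ^ (m - 1) * (Q / (\<tau> * nu \<tau>)))) =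
      ennreal (real (card \<I>) * ((c * comb)\<^sup>2 * (mass \<tau> ^ (m - 1) * (Q / (\<tau> * nu \<tau>)))))"
    using mass_pos[OF \<tau>] \<tau> nu_pos[of \<tau>] Q
    by (subst ennreal_mult[symmetric], simp, simp, subst ennreal_of_nat_eq_real_of_nat, subst ennreal_mult[symmetric]) auto
  also have "real (card \<I>) * ((c * comb)\<^sup>2 * (mass \<tau> ^ (m - 1) * (Q / (\<tau> * nu \<tau>)))) =
      comb\<^sup>2 * real (card \<I>) * Q * (c\<^sup>2 * mass \<tau> ^ (m - 1) / (\<tau> * nu \<tau>))"
  proof -
    have "B * ((c * E)\<^sup>2 * (M * (Q / t))) = E\<^sup>2 * B * Q * (c\<^sup>2 * M / t)" for B E M t :: real
      by (simp add: power_mult_distrib)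
    then show ?thesis .
  qed
  also have "c\<^sup>2 * mass \<tau> ^ (m - 1) / (\<tau> * nu \<tau>) = 1"
    unfolding c_def using m by (intro prefactor_sq \<tau>) auto
  finally show ?thesis by simp
qed

lemma counting_eq: "fact m * fact k * (comb\<^sup>2 * real (card \<I>) * (real (card \<I>) * Q)) = fact n * (counting m j n * Q)"
  unfolding counting_def Let_def card_\<I> by (simp add: power2_eq_square)

text \<open>Plain Cauchy--Schwarz over \<open>I\<close>. The number of sets then enters twice, once
  as the multiplicity and once through the summation, which explains the squared binomial in
  \<open>counting\<close>.\<close>

lemma A_chaos_bound_naive:
  assumes bound: "\<And>I. I \<in> \<I> \<Longrightarrow>
      (\<integral>\<^sup>+p. ennreal (Th p * (bessel_weight \<tau> k p * (qI I p $ 1)\<^sup>2) * (cmod (fib I p))\<^sup>2) \<partial>leb k)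
      \<le> ennreal (mass \<tau> ^ (m - 1) * (Q / (\<tau> * nu \<tau>))) * WM"
    and Q: "0 \<le> Q"
  shows "ennreal (fact m * fact k) * chaos_dual_normsq \<rho> \<tau> m j n \<psi> k
    \<le> ennreal (fact n * (counting m j n * Q)) * WM"
proof -
  let ?B = "real (card \<I>)"
  have "chaos_dual_normsq \<rho> \<tau> m j n \<psi> k
    \<le> ennreal (comb\<^sup>2 * ?B * (?B * Q)) * WM"
  proof (rule A_chaos_bound_multiplicity[where \<mu>="\<lambda>_ _. ?B"])
    fix p
    show "(cmod (\<Sum>I\<in>\<I>. complex_of_real (qI I p $ 1) * fib I p))\<^sup>2 \<le> (\<Sum>I\<in>\<I>. ?B * (cmod (complex_of_real (qI I p $ 1) * fib I p))\<^sup>2)"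
      unfolding sum_distrib_left[symmetric] by (rule cmod_sum_sq_le_card)
  next
    fix I assume I: "I \<in> \<I>"
    let ?G = "\<lambda>p. Th p * (bessel_weight \<tau> k p * (qI I p $ 1)\<^sup>2) * (cmod (fib I p))\<^sup>2"
    have G0: "0 \<le> ?G p" for p by (intro mult_nonneg_nonneg Th_nonneg) auto
    have "(\<integral>\<^sup>+p. ennreal (Th p * (bessel_weight \<tau> k p * (qI I p $ 1)\<^sup>2 * ?B) * (cmod (fib I p))\<^sup>2) \<partial>leb k)
      = (\<integral>\<^sup>+p. ennreal ?B * ennreal (?G p) \<partial>leb k)"
      using G0 by (intro nn_integral_cong) (simp add: ennreal_mult[symmetric] mult_ac)
    also have "\<dots> = ennreal ?B * (\<integral>\<^sup>+p. ennreal (?G p) \<partial>leb k)"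
      by (intro nn_integral_cmult measurable_compose[OF _ measurable_ennreal] borel_measurable_times
          borel_measurable_power borel_measurable_cmod Th_measurable H_measurable q_measurable fib_measurable I)
    also have "\<dots> \<le> ennreal ?B * (ennreal (mass \<tau> ^ (m - 1) * (Q / (\<tau> * nu \<tau>))) * WM)"
      by (intro mult_left_mono bound I) auto
    also have "\<dots> = ennreal (mass \<tau> ^ (m - 1) * (?B * Q / (\<tau> * nu \<tau>))) * WM"
      using mass_pos[OF \<tau>] \<tau> nu_pos[of \<tau>] Q
      by (simp add: mult.assoc[symmetric] ennreal_mult[symmetric]) (simp add: mult_ac)
    finally show "(\<integral>\<^sup>+p. ennreal (Th p * (bessel_weight \<tau> k p * (qI I p $ 1)\<^sup>2 * ?B) * (cmod (fib I p))\<^sup>2) \<partial>leb k)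
      \<le> ennreal (mass \<tau> ^ (m - 1) * (?B * Q / (\<tau> * nu \<tau>))) * WM" .
  qed (use Q in auto)
  then have "ennreal (fact m * fact k) * chaos_dual_normsq \<rho> \<tau> m j n \<psi> k
    \<le> ennreal (fact m * fact k) * (ennreal (comb\<^sup>2 * ?B * (?B * Q)) * WM)"
    by (intro mult_left_mono) auto
  also have "\<dots> = ennreal (fact m * fact k * (comb\<^sup>2 * ?B * (?B * Q))) * WM"
    using Q by (simp add: mult.assoc[symmetric] ennreal_mult[symmetric])
  finally show ?thesis unfolding counting_eq .
qed

text \<open>One of the three indices is eliminated by the total momentum and the other two absorb
  the singularity. The set \<open>X\<close> reserves an index that is to be confined instead; with
  one such index, four outgoing momenta are needed.\<close>

lemma obtain_three_outside:
  assumes I: "I \<in> \<I>" and X: "card X + 3 \<le> m - j" and finX: "finite X"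
  obtains i0 i1 i2 where "i0 \<in> I - X" "i1 \<in> I - X" "i2 \<in> I - X" "i0 \<noteq> i1" "i0 \<noteq> i2" "i1 \<noteq> i2"
proof -
  have finI: "finite I" using I finite_subset[of I "{1..k}"] by auto
  have "card I - card X \<le> card (I - X)" by (rule diff_card_le_card_Diff) (use finX in simp)
  then have "3 \<le> card (I - X)" using I X by auto
  then obtain T where "T \<subseteq> I - X" "card T = 3" using obtain_subset_with_card_n by metis
  then show ?thesis using that by (auto simp: card_3_iff)
qed

lemma mass_exponent: "m - j - 1 + j = m - 1"
  using j by simp

lemma A_chaos_bound_three:
  assumes l: "3 \<le> m - j" and S': "S' \<subseteq> {1..j}"
  shows "ennreal (fact m * fact k) * chaos_dual_normsq \<rho> \<tau> m j n \<psi> k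
    \<le> ennreal (fact n * (counting m j n * (K\<^sup>2 * (K * \<xi>) ^ card S' * real (Suc j)))) * WM"
proof (rule A_chaos_bound_naive)
  fix I assume I: "I \<in> \<I>"
  from obtain_three_outside[OF I, of "{}"] l
  obtain i0 i1 i2 where i: "i0 \<in> I" "i1 \<in> I" "i2 \<in> I" "i0 \<noteq> i1" "i0 \<noteq> i2" "i1 \<noteq> i2" by auto
  interpret fs: fibre_setup \<rho> \<tau> \<alpha> \<xi> j n k "m - j" I i0 \<psi> by (rule fibre_setup_I[OF I i(1)])
  show "(\<integral>\<^sup>+p. ennreal (Th p * (bessel_weight \<tau> k p * (qI I p $ 1)\<^sup>2) * (cmod (fib I p))\<^sup>2) \<partial>leb k)
      \<le> ennreal (mass \<tau> ^ (m - 1) * (K\<^sup>2 * (K * \<xi>) ^ card S' * real (Suc j) / (\<tau> * nu \<tau>))) * WM"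
    using fs.fibre_bound_three[of i1 i2 "{}" S'] i S' unfolding mass_exponent by (simp add: mult.assoc)
qed (use \<xi> singularity_const_bounds(1)[OF \<alpha>] in auto)

lemma A_chaos_bound_two:
  assumes l: "m - j = 2" and j1: "1 \<le> j"
  shows "ennreal (fact m * fact k) * chaos_dual_normsq \<rho> \<tau> m j n \<psi> k
    \<le> ennreal (fact n * (counting m j n * (K\<^sup>2 * \<xi> powr \<alpha> * (4 * real (Suc j))))) * WM"
proof (rule A_chaos_bound_naive)
  fix I assume I: "I \<in> \<I>"
  then obtain i0 where i: "i0 \<in> I" using l by fastforce
  interpret fs: fibre_setup \<rho> \<tau> \<alpha> \<xi> j n k "m - j" I i0 \<psi> by (rule fibre_setup_I[OF I i])
  show "(\<integral>\<^sup>+p. ennreal (Th p * (bessel_weight \<tau> k p * (qI I p $ 1)\<^sup>2) * (cmod (fib I p))\<^sup>2) \<partial>leb k)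
      \<le> ennreal (mass \<tau> ^ (m - 1) * (K\<^sup>2 * \<xi> powr \<alpha> * (4 * real (Suc j)) / (\<tau> * nu \<tau>))) * WM"
    using fs.fibre_bound_two[OF l j1] unfolding mass_exponent by (simp only: times_divide_eq_right mult.assoc)
qed (use \<xi> singularity_const_bounds(1)[OF \<alpha>] in auto)

lemma A_chaos_bound_one:
  assumes l: "m - j = 1"
  shows "ennreal (fact m * fact k) * chaos_dual_normsq \<rho> \<tau> m j n \<psi> k
    \<le> ennreal (fact n * (counting m j n * (K\<^sup>2 * \<xi> * 2))) * WM"
proof (rule A_chaos_bound_naive)
  have j2: "2 \<le> j" using l m by simp
  fix I assume I: "I \<in> \<I>"
  then obtain i0 where i: "i0 \<in> I" using l by fastforce
  interpret fs: fibre_setup \<rho> \<tau> \<alpha> \<xi> j n k "m - j" I i0 \<psi> by (rule fibre_setup_I[OF I i])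
  show "(\<integral>\<^sup>+p. ennreal (Th p * (bessel_weight \<tau> k p * (qI I p $ 1)\<^sup>2) * (cmod (fib I p))\<^sup>2) \<partial>leb k)
      \<le> ennreal (mass \<tau> ^ (m - 1) * (K\<^sup>2 * \<xi> * 2 / (\<tau> * nu \<tau>))) * WM"
    using fs.fibre_bound_one[OF l j2] unfolding mass_exponent by (simp only: times_divide_eq_right mult.assoc)
qed (use \<xi> singularity_const_bounds(1)[OF \<alpha>] in auto)

text \<open>Momenta outside \<open>I\<close> are passed on to \<open>\<psi>\<close> unchanged, so
  its support condition applies to them directly.\<close>

lemma fib_nonzero_small:
  assumes I: "I \<in> \<I>" and nz: "fib I p \<noteq> 0" and i: "i \<in> {1..k} - I"
  shows "small \<tau> \<xi> (p i) = (1::real)"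
proof -
  obtain r where r: "\<psi> (joined_args j n k I r p) \<noteq> 0"
    using fibre_integral_nonzero[OF nz] by blast
  have "bij_betw (rest_index j k I) {Suc (Suc j)..n} ({1..k} - I)"
    using I by (intro bij_betw_rest_index[OF j(1) _ _ k_eq]) auto
  then have "i \<in> rest_index j k I ` {Suc (Suc j)..n}"
    using i by (simp only: bij_betw_def)
  then obtain i' where i': "i' \<in> {Suc (Suc j)..n}" "rest_index j k I i' = i"
    by blast
  have "joined_args j n k I r p i' = p i"
    using i' by (auto simp: joined_args_def rest_index_def)
  moreover have "(norm (rescale \<tau> (joined_args j n k I r p i')))\<^sup>2 \<le> \<xi>"
    using i' by (intro norm_rescale_sq_le[OF supp[OF r] \<tau>]) auto
  ultimately show ?thesis by simp
qed

text \<open>For \<open>j = 0\<close> there is no fibre to integrate over, and Cauchy--Schwarz over \<open>I\<close> alone would lose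
  a factor exponential in \<open>n\<close> even for tiny \<open>\<xi>\<close>. The multiplicity bound keeps the diagonal
  contribution free of this loss, and the remaining contributions gain a factor \<open>\<xi>\<close> from an outgoing
  variable that is confined to the support of \<open>\<psi>\<close>.\<close>

lemma A_chaos_bound_zero:
  assumes j0: "j = 0" and m4: "4 \<le> m"
  shows "ennreal (fact m * fact k) * chaos_dual_normsq \<rho> \<tau> m j n \<psi> k
    \<le> ennreal (fact n * (real n * K\<^sup>2 + counting m j n * (real m * (K\<^sup>2 * (K * \<xi>))))) * WM"
proof -
  let ?B = "real (card \<I>)"
  have K: "17 \<le> K" by (rule singularity_const_bounds(1)[OF \<alpha>])
  define Q1 where "Q1 = K\<^sup>2 * (K * \<xi>)"
  \<comment> \<open>The first summand belongs to multiplicity \<open>1\<close>. In the second, each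
    of the \<open>m\<close> outgoing momenta in \<open>I\<close> may be the confined one.\<close>
  define Q where "Q = K\<^sup>2 + ?B * (real m * Q1)"
  have Q1: "0 \<le> Q1" using K \<xi> by (auto simp: Q1_def)
  then have Q0: "0 \<le> Q" by (simp add: Q_def)
  have sm [measurable]: "(\<lambda>p. small \<tau> \<xi> (p i) :: real) \<in> borel_measurable (leb k)" if "i \<in> {1..k}" for i
    by (rule measurable_compose[OF borel_measurable_leb_component[OF that]]) measurable
  have "chaos_dual_normsq \<rho> \<tau> m j n \<psi> k
    \<le> ennreal (comb\<^sup>2 * ?B * Q) * WM"
  proof (rule A_chaos_bound_multiplicity[where \<mu>="\<lambda>I p. 1 + ?B * (\<Sum>i\<in>I. small \<tau> \<xi> (p i))"])
    fix p
    show "(cmod (\<Sum>I\<in>\<I>. complex_of_real (qI I p $ 1) * fib I p))\<^sup>2 \<le>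
      (\<Sum>I\<in>\<I>. (1 + ?B * (\<Sum>i\<in>I. small \<tau> \<xi> (p i))) * (cmod (complex_of_real (qI I p $ 1) * fib I p))\<^sup>2)"
    proof (rule cmod_sum_sq_le_multiplicity[where U="{1..k}" and l="m - j"])
      fix i I assume "I \<in> \<I>" "complex_of_real (qI I p $ 1) * fib I p \<noteq> 0" "i \<in> {1..k} - I"
      then show "small \<tau> \<xi> (p i) = (1::real)" using fib_nonzero_small[of I p i] by auto
    qed auto
  next
    fix I assume I: "I \<in> \<I>"
    have finI: "finite I" using I finite_subset[of I "{1..k}"] by auto
    have sub: "i \<in> {1..k}" if "i \<in> I" for i using I that by auto
    show "(\<lambda>p. 1 + ?B * (\<Sum>i\<in>I. small \<tau> \<xi> (p i))) \<in> borel_measurable (leb k)"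
      by (intro borel_measurable_add borel_measurable_times borel_measurable_const borel_measurable_sum sm sub)
    let ?G = "\<lambda>p. Th p * (bessel_weight \<tau> k p * (qI I p $ 1)\<^sup>2) * (cmod (fib I p))\<^sup>2"
    let ?Gi = "\<lambda>i p. Th p * (bessel_weight \<tau> k p * (qI I p $ 1)\<^sup>2 * small \<tau> \<xi> (p i)) * (cmod (fib I p))\<^sup>2"
    have G0: "0 \<le> ?G p" "0 \<le> ?Gi i p" for p i by (intro mult_nonneg_nonneg Th_nonneg; simp)+
    have Gm: "?G \<in> borel_measurable (leb k)"
      by (intro borel_measurable_times borel_measurable_power borel_measurable_cmod Th_measurable H_measurable q_measurable fib_measurable I)
    have Gim: "?Gi i \<in> borel_measurable (leb k)" if "i \<in> I" for i
      by (intro borel_measurable_times borel_measurable_power borel_measurable_cmod Th_measurable H_measurable q_measurable fib_measurable I sm sub that)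
    let ?c = "mass \<tau> ^ (m - 1) / (\<tau> * nu \<tau>)"
    have c0: "0 \<le> ?c" using mass_pos[OF \<tau>] \<tau> nu_pos[of \<tau>] by simp
    have b1: "(\<integral>\<^sup>+p. ennreal (?G p) \<partial>leb k) \<le> ennreal (?c * K\<^sup>2) * WM"
    proof -
      have "card ({}::nat set) + 3 \<le> m - j" using m4 j0 by simp
      from obtain_three_outside[OF I this]
      obtain i0 i1 i2 where i: "i0 \<in> I" "i1 \<in> I" "i2 \<in> I" "i0 \<noteq> i1" "i0 \<noteq> i2" "i1 \<noteq> i2" by auto
      interpret fs: fibre_setup \<rho> \<tau> \<alpha> \<xi> j n k "m - j" I i0 \<psi> by (rule fibre_setup_I[OF I i(1)])
      show ?thesis
        using fs.fibre_bound_three[of i1 i2 "{}" "{}"] i j0 by (simp add: mult_ac)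
    qed
    have b2: "(\<integral>\<^sup>+p. ennreal (?Gi i p) \<partial>leb k) \<le> ennreal (?c * Q1) * WM" if iI: "i \<in> I" for i
    proof -
      have "card {i} + 3 \<le> m - j" using m4 j0 by simp
      then obtain i0 i1 i2 where i': "i0 \<in> I - {i}" "i1 \<in> I - {i}" "i2 \<in> I - {i}" "i0 \<noteq> i1" "i0 \<noteq> i2" "i1 \<noteq> i2"
        using obtain_three_outside[OF I, of "{i}"] by blast
      then have i: "i0 \<in> I" "i1 \<in> I" "i2 \<in> I" "i0 \<noteq> i1" "i0 \<noteq> i2" "i1 \<noteq> i2" "i0 \<noteq> i" "i1 \<noteq> i" "i2 \<noteq> i" by auto
      interpret fs: fibre_setup \<rho> \<tau> \<alpha> \<xi> j n k "m - j" I i0 \<psi> by (rule fibre_setup_I[OF I i(1)])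
      show ?thesis
        using fs.fibre_bound_three[of i1 i2 "{i}" "{}"] i iI j0 by (simp add: Q1_def mult_ac)
    qed
    have "(\<integral>\<^sup>+p. ennreal (Th p * (bessel_weight \<tau> k p * (qI I p $ 1)\<^sup>2 * (1 + ?B * (\<Sum>i\<in>I. small \<tau> \<xi> (p i)))) * (cmod (fib I p))\<^sup>2) \<partial>leb k)
      = (\<integral>\<^sup>+p. ennreal (?G p) + ennreal ?B * (\<Sum>i\<in>I. ennreal (?Gi i p)) \<partial>leb k)"
    proof (rule nn_integral_cong)
      fix p
      have "Th p * (bessel_weight \<tau> k p * (qI I p $ 1)\<^sup>2 * (1 + ?B * (\<Sum>i\<in>I. small \<tau> \<xi> (p i)))) * (cmod (fib I p))\<^sup>2
        = ?G p + ?B * (\<Sum>i\<in>I. ?Gi i p)"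
      proof -
        have "T * (h * (1 + B * (\<Sum>i\<in>I. s i))) * f = T * h * f + B * (\<Sum>i\<in>I. T * (h * s i) * f)" for T h B f :: real and s
          by (simp add: sum_distrib_left sum_distrib_right distrib_left distrib_right mult_ac)
        from this[of "Th p" "bessel_weight \<tau> k p * (qI I p $ 1)\<^sup>2" ?B "\<lambda>i. small \<tau> \<xi> (p i)" "(cmod (fib I p))\<^sup>2"]
        show ?thesis .
      qed
      moreover have "ennreal (?G p + ?B * (\<Sum>i\<in>I. ?Gi i p)) = ennreal (?G p) + ennreal ?B * (\<Sum>i\<in>I. ennreal (?Gi i p))"
        by (rule ennreal_add_mult_sum) (use G0 in auto)
      ultimately show "ennreal (Th p * (bessel_weight \<tau> k p * (qI I p $ 1)\<^sup>2 * (1 + ?B * (\<Sum>i\<in>I. small \<tau> \<xi> (p i)))) * (cmod (fib I p))\<^sup>2)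
        = ennreal (?G p) + ennreal ?B * (\<Sum>i\<in>I. ennreal (?Gi i p))" by (simp only:)
    qed
    also have "\<dots> = (\<integral>\<^sup>+p. ennreal (?G p) \<partial>leb k) + ennreal ?B * (\<Sum>i\<in>I. \<integral>\<^sup>+p. ennreal (?Gi i p) \<partial>leb k)"
    proof -
      have e: "(\<lambda>p. ennreal (?Gi i p)) \<in> borel_measurable (leb k)" if "i \<in> I" for i
        by (rule measurable_compose[OF Gim[OF that] measurable_ennreal])
      have "(\<integral>\<^sup>+p. ennreal (?G p) + ennreal ?B * (\<Sum>i\<in>I. ennreal (?Gi i p)) \<partial>leb k) =
        (\<integral>\<^sup>+p. ennreal (?G p) \<partial>leb k) + (\<integral>\<^sup>+p. ennreal ?B * (\<Sum>i\<in>I. ennreal (?Gi i p)) \<partial>leb k)"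
        by (intro nn_integral_add measurable_compose[OF Gm measurable_ennreal] borel_measurable_times_ennreal borel_measurable_sum e) auto
      also have "(\<integral>\<^sup>+p. ennreal ?B * (\<Sum>i\<in>I. ennreal (?Gi i p)) \<partial>leb k) = ennreal ?B * (\<integral>\<^sup>+p. (\<Sum>i\<in>I. ennreal (?Gi i p)) \<partial>leb k)"
        by (intro nn_integral_cmult borel_measurable_sum e)
      also have "(\<integral>\<^sup>+p. (\<Sum>i\<in>I. ennreal (?Gi i p)) \<partial>leb k) = (\<Sum>i\<in>I. \<integral>\<^sup>+p. ennreal (?Gi i p) \<partial>leb k)"
        by (rule nn_integral_sum) (rule e)
      finally show ?thesis .
    qed
    also have "\<dots> \<le> ennreal (?c * K\<^sup>2) * WM + ennreal ?B * (\<Sum>i\<in>I. ennreal (?c * Q1) * WM)"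
      by (intro add_mono mult_left_mono sum_mono b1 b2) auto
    also have "\<dots> = (ennreal (?c * K\<^sup>2) + ennreal ?B * (of_nat (card I) * ennreal (?c * Q1))) * WM"
      by (simp add: distrib_right mult.assoc)
    also have "ennreal (?c * K\<^sup>2) + ennreal ?B * (of_nat (card I) * ennreal (?c * Q1)) = ennreal (?c * K\<^sup>2 + ?B * (real (card I) * (?c * Q1)))"
      by (rule ennreal_add_mult_of_nat[OF mult_nonneg_nonneg[OF c0 zero_le_power2] of_nat_0_le_iff mult_nonneg_nonneg[OF c0 Q1]])
    also have "?c * K\<^sup>2 + ?B * (real (card I) * (?c * Q1)) = mass \<tau> ^ (m - 1) * (Q / (\<tau> * nu \<tau>))"
      using I j0 by (simp add: Q_def add_divide_distrib distrib_left mult_ac)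
    finally show "(\<integral>\<^sup>+p. ennreal (Th p * (bessel_weight \<tau> k p * (qI I p $ 1)\<^sup>2 * (1 + ?B * (\<Sum>i\<in>I. small \<tau> \<xi> (p i)))) * (cmod (fib I p))\<^sup>2) \<partial>leb k)
      \<le> ennreal (mass \<tau> ^ (m - 1) * (Q / (\<tau> * nu \<tau>))) * WM" .
  qed (use Q0 in \<open>auto intro!: add_nonneg_nonneg mult_nonneg_nonneg sum_nonneg\<close>)
  then have "ennreal (fact m * fact k) * chaos_dual_normsq \<rho> \<tau> m j n \<psi> k
    \<le> ennreal (fact m * fact k) * (ennreal (comb\<^sup>2 * ?B * Q) * WM)"
    by (intro mult_left_mono) auto
  also have "\<dots> = ennreal (fact m * fact k * (comb\<^sup>2 * ?B * Q)) * WM"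
    using Q0 by (simp add: mult.assoc[symmetric] ennreal_mult[symmetric])
  also have "fact m * fact k * (comb\<^sup>2 * ?B * Q) = fact m * fact k * (comb\<^sup>2 * ?B) * K\<^sup>2 + fact n * (counting m j n * (real m * Q1))"
    unfolding counting_eq[symmetric] Q_def by (simp add: distrib_left mult_ac)
  \<comment> \<open>Here \<open>fact (j + 1) = 1\<close> and \<open>k - m = n - 1\<close>, so one
    binomial cancels the factorials of \<open>m\<close> and \<open>k\<close>: the part with
    multiplicity \<open>1\<close> costs no more than a factor \<open>n\<close>.\<close>
  also have "fact m * fact k * (comb\<^sup>2 * ?B) = fact n * real n"
  proof -
    have k: "k - m = n - 1" "m \<le> k" using j j0 by auto
    have B: "?B = fact k / (fact m * fact (n - 1))"
      unfolding card_\<I> using binomial_fact[of m k, where 'a=real] k j0 by simp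
    have "fact n = real n * fact (n - 1)" using j by (intro fact_reduce) auto
    then have "fact n / fact (n - 1) = real n" by (simp add: field_simps)
    moreover have "fact m * fact k * (comb\<^sup>2 * ?B) = fact n * (fact n / fact (n - 1))"
    proof -
      have gen: "a * b * ((c / (b * 1))\<^sup>2 * (b / (a * d))) = c * (c / d)" if "a \<noteq> 0" "b \<noteq> 0" for a b c d :: real
        using that by (simp add: power2_eq_square)
      have "fact (j + 1) = (1::real)" using j0 by simp
      then show ?thesis unfolding B by (simp only:) (rule gen; simp)
    qed
    ultimately show ?thesis by simp
  qed
  finally show ?thesis by (simp add: Q1_def distrib_left mult_ac)
qed

end

section \<open>Combinatorial constants\<close>

text \<open>Consecutive values have ratio \<open>Suc (s + l) / Suc s\<close>, at most
  \<open>l + 1\<close>. The point is the exponent: it is \<open>s\<close>, later the number of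
  untouched momenta, so no factor exponential in \<open>m\<close> arises.\<close>

lemma binomial_le_Suc_power: "(s + l) choose s \<le> (l + 1) ^ s"
proof (induction s)
  case (Suc s)
  have "Suc s * (Suc (s + l) choose Suc s) = Suc (s + l) * ((s + l) choose s)"
    by (rule Suc_times_binomial)
  also have "\<dots> \<le> (Suc s * (l + 1)) * (l + 1) ^ s"
    using Suc by (intro mult_mono) auto
  finally have "Suc s * (Suc (s + l) choose Suc s) \<le> Suc s * (l + 1) ^ Suc s"
    by (simp only: mult.assoc power_Suc)
  then show ?case by (simp only: mult_le_cancel1 add_Suc zero_less_Suc simp_thms)
qed simp

text \<open>The identity \<open>k - (m - j) = n - (j + 1)\<close> makes both binomials share the
  factorial of the number of untouched momenta. One copy of each binomial remains after
  cancellation.\<close>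

lemma counting_factor:
  assumes "j < n" "j < m"
  shows "counting m j n = fact m / (fact (j + 1) * fact (m - j)) * real (n choose (j + 1)) *
    real ((n + m - (2 * j + 1)) choose (m - j))"
proof -
  define k where "k = n + m - (2 * j + 1)"
  have k: "m - j \<le> k" "k - (m - j) = n - (j + 1)" using assms by (auto simp: k_def)
  have B: "real (k choose (m - j)) = fact k / (fact (m - j) * fact (n - (j + 1)))"
    using binomial_fact[OF k(1), where 'a=real] k by simp
  have N: "real (n choose (j + 1)) = fact n / (fact (j + 1) * fact (n - (j + 1)))"
    using assms by (intro binomial_fact) auto
  have gen: "a * b * (c / (b * d))\<^sup>2 * (b / (e * f))\<^sup>2 / c = a / (d * e) * (c / (d * f)) * (b / (e * f))"
    if "b \<noteq> 0" "c \<noteq> 0" for a b c d e f :: real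
    using that by (simp add: power2_eq_square) (simp only: mult_ac)
  show ?thesis
    unfolding counting_def Let_def k_def[symmetric] B N by (rule gen) auto
qed

lemma fact_ratio_le_power:
  assumes "j \<le> m"
  shows "(fact m :: real) / fact (m - j) \<le> real m ^ j"
proof -
  have "fact m div fact (m - j) \<le> m ^ j" using fact_div_fact_le_pow[OF assms] .
  moreover have "fact (m - j) dvd (fact m :: nat)" by (intro fact_dvd) auto
  ultimately have "(fact m :: nat) \<le> m ^ j * fact (m - j)"
    by (metis dvd_div_mult_self mult_le_mono1)
  then have "real (fact m) \<le> real (m ^ j * fact (m - j))" by (rule of_nat_mono)
  then show ?thesis by (simp add: field_simps)
qed

text \<open>The ratio of factorials contributes \<open>j\<close> powers of \<open>m\<close> and the
  choice of the outgoing momenta \<open>n - (j + 1)\<close> more, in total \<open>n - 1\<close>. Two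
  factors \<open>2 ^ n\<close> come from the choice of the incoming momenta and from bounding
  \<open>m - j + 1\<close> by \<open>2 * m\<close>.\<close>

lemma counting_le:
  assumes j: "j < n" "j < m"
  shows "counting m j n \<le> 4 ^ n * real m ^ (n - 1)"
proof -
  define s where "s = n - (j + 1)"
  have k: "n + m - (2 * j + 1) = s + (m - j)" using j by (simp add: s_def)
  have m1: "1 \<le> real m" using j by simp
  have "(fact m :: real) / (fact (j + 1) * fact (m - j)) \<le> fact m / fact (m - j)"
    using mult_right_mono[OF fact_ge_1[of "j + 1"], of "fact (m - j)"]
    by (intro divide_left_mono) (simp_all del: fact_Suc)
  also have "\<dots> \<le> real m ^ j" using j by (intro fact_ratio_le_power) auto
  finally have 1: "(fact m :: real) / (fact (j + 1) * fact (m - j)) \<le> real m ^ j" .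
  have "n choose (j + 1) \<le> 2 ^ n" by (rule binomial_le_pow2)
  then have 2: "real (n choose (j + 1)) \<le> 2 ^ n"
    by (metis of_nat_le_iff of_nat_numeral of_nat_power)
  have "(s + (m - j)) choose (m - j) = (s + (m - j)) choose s"
    using binomial_symmetric[of s "s + (m - j)"] by simp
  also have "\<dots> \<le> (m - j + 1) ^ s" by (rule binomial_le_Suc_power)
  also have "\<dots> \<le> (2 * m) ^ s" using j by (intro power_mono) auto
  finally have "real ((s + (m - j)) choose (m - j)) \<le> (2 * real m) ^ s"
    by (metis of_nat_le_iff of_nat_mult of_nat_numeral of_nat_power)
  also have "\<dots> = 2 ^ s * real m ^ s" by (simp add: power_mult_distrib)
  also have "\<dots> \<le> 2 ^ n * real m ^ s"
    using m1 by (intro mult_right_mono power_increasing) (auto simp: s_def)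
  finally have 3: "real ((s + (m - j)) choose (m - j)) \<le> 2 ^ n * real m ^ s" .
  have "counting m j n \<le> real m ^ j * 2 ^ n * (2 ^ n * real m ^ s)"
    unfolding counting_factor[OF j] k using 1 2 3 by (intro mult_mono) auto
  also have "\<dots> = (2 ^ n * 2 ^ n) * (real m ^ j * real m ^ s)" by (simp only: mult_ac)
  also have "\<dots> = 4 ^ n * real m ^ (n - 1)"
  proof -
    have "(2::real) ^ n * 2 ^ n = 4 ^ n" by (simp flip: power_mult_distrib)
    moreover have "real m ^ j * real m ^ s = real m ^ (n - 1)"
      using j by (simp add: power_add[symmetric] s_def)
    ultimately show ?thesis by (simp only:)
  qed
  finally show ?thesis .
qed

text \<open>With two outgoing momenta only \<open>\<xi> powr \<alpha>\<close> is gained, which is no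
  better than \<open>sqrt \<xi>\<close> at \<open>\<alpha> = 1/2\<close>, so the general bound would
  be too large. Here the factorials collapse to \<open>m / 2\<close>, since
  \<open>j + 1 = m - 1\<close>, and the target order is \<open>n + 1 - j\<close>, at most
  \<open>n\<close>.\<close>

lemma counting_two_le:
  assumes j: "j < n" "m = j + 2" "1 \<le> j"
  shows "counting m j n \<le> real m * 2 ^ n * real n ^ 2"
proof -
  have m: "m - j = 2" "j + 1 = m - 1" using j by auto
  have "fact m = real m * fact (m - 1)" using j by (intro fact_reduce) auto
  then have 1: "fact m / (fact (j + 1) * fact (m - j)) = real m / 2"
    unfolding m by (simp add: fact_2)
  have "n choose (j + 1) \<le> 2 ^ n" by (rule binomial_le_pow2)
  then have 2: "real (n choose (j + 1)) \<le> 2 ^ n"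
    by (metis of_nat_le_iff of_nat_numeral of_nat_power)
  have "(n + m - (2 * j + 1)) choose 2 \<le> (n + m - (2 * j + 1)) ^ 2"
  proof (cases "2 \<le> n + m - (2 * j + 1)")
    case True
    then show ?thesis by (rule binomial_le_pow)
  next
    case False
    then show ?thesis by (subst binomial_eq_0) auto
  qed
  also have "\<dots> \<le> n ^ 2" using j by (intro power_mono) auto
  finally have 3: "real ((n + m - (2 * j + 1)) choose 2) \<le> real n ^ 2"
    by (metis of_nat_le_iff of_nat_power)
  have jm: "j < m" using j by simp
  have "counting m j n \<le> real m / 2 * 2 ^ n * real n ^ 2"
    unfolding counting_factor[OF j(1) jm] 1 using 2 3 m by (intro mult_mono) auto
  also have "\<dots> \<le> real m * 2 ^ n * real n ^ 2" by (intro mult_right_mono) auto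
  finally show ?thesis .
qed

text \<open>For \<open>m = 3\<close> and \<open>j = 0\<close> there is no fibre variable to confine,
  and all three outgoing momenta are already spoken for. No power of \<xi> is gained, but the count
  is polynomial in \<open>n\<close>.\<close>

lemma counting_three_le:
  assumes n: "1 \<le> n"
  shows "counting 3 0 n \<le> 27 * real n ^ 4"
proof -
  have "(n + 3 - 1) choose 3 \<le> (n + 3 - 1) ^ 3" by (rule binomial_le_pow) (use n in auto)
  also have "\<dots> \<le> (3 * n) ^ 3" using n by (intro power_mono) auto
  finally have "real ((n + 3 - 1) choose 3) \<le> (3 * real n) ^ 3"
    by (metis of_nat_le_iff of_nat_mult of_nat_numeral of_nat_power)
  then have "counting 3 0 n \<le> real n * (3 * real n) ^ 3"
    using n by (subst counting_factor) (auto intro!: mult_left_mono)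
  also have "\<dots> = 27 * real n ^ 4" by (simp add: power_mult_distrib eval_nat_numeral)
  finally show ?thesis .
qed

text \<open>\<open>B\<close> is the square of the factor in the theorem, because squared norms are
  compared. Terms without \<xi> fit into the square of the first summand and terms linear in \<xi>
  into the cross term. The last bound has only \<open>sqrt \<xi>\<close>; it is factored into two
  quantities, each at most the unsquared factor.\<close>

lemma budget_bounds:
  fixes \<xi> :: real
  assumes n: "1 \<le> n" and m: "3 \<le> m" and \<xi>: "0 \<le> \<xi>"
  defines "B \<equiv> (real n ^ 3 * real m ^ 3 + \<xi> * 4 ^ n * real m ^ n)\<^sup>2"
  shows "27 * real n ^ 5 \<le> B" "real n ^ 2 + real n * (4 ^ n * real m ^ n * \<xi>) \<le> B"
    "real n * real n * (4 ^ n * real m ^ n * \<xi>) \<le> B" "real m * 2 ^ n * real n ^ 4 * sqrt \<xi> \<le> B"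
proof -
  define P where "P = real n ^ 3 * real m ^ 3"
  define Q where "Q = 4 ^ n * real m ^ n * \<xi>"
  have n1: "1 \<le> real n" and m3: "3 \<le> real m" using n m by auto
  have B: "B = (P + Q)\<^sup>2" by (simp add: B_def P_def Q_def mult_ac)
  have Q0: "0 \<le> Q" using \<xi> by (simp add: Q_def)
  have m27: "27 \<le> real m ^ 3" using power_mono[of 3 "real m" 3] m3 by simp
  have nP: "27 * real n ^ 3 \<le> P"
    unfolding P_def using mult_left_mono[OF m27, of "real n ^ 3"] n1 by (simp add: mult.commute)
  have n3: "real n ^ 3 \<le> P" using nP n1 by (smt (verit) zero_le_power)
  have P0: "0 \<le> P" using n3 n1 by (smt (verit) zero_le_power)
  have BP: "P\<^sup>2 + 2 * P * Q \<le> B" unfolding B power2_sum using Q0 by simp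
  have PQ: "0 \<le> P * Q" using P0 Q0 by simp
  have n12: "real n \<le> real n ^ 2" "real n ^ 2 \<le> real n ^ 3" using n1 by (auto intro: power_increasing self_le_power)
  have "27 * real n ^ 5 \<le> 27 * real n ^ 3 * real n ^ 3"
  proof -
    have "real n ^ 5 \<le> real n ^ 6" using n1 by (intro power_increasing) auto
    then show ?thesis by (simp add: eval_nat_numeral)
  qed
  also have "\<dots> \<le> P * P" using nP n3 n1 P0 by (intro mult_mono) auto
  finally show "27 * real n ^ 5 \<le> B" using BP PQ by (simp add: power2_eq_square)
  have "real n ^ 2 \<le> P" using n12 n3 by linarith
  then have "real n \<le> P" using n12 by linarith
  have nQ: "real n * Q \<le> P * Q" using \<open>real n \<le> P\<close> Q0 by (intro mult_right_mono) auto
  have "real n * real n \<le> P * P" using \<open>real n \<le> P\<close> n1 by (intro mult_mono) auto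
  then have "real n ^ 2 \<le> P\<^sup>2" by (simp add: power2_eq_square)
  then show "real n ^ 2 + real n * (4 ^ n * real m ^ n * \<xi>) \<le> B"
    using nQ BP PQ unfolding Q_def[symmetric] by linarith
  have "real n * real n * Q \<le> P * Q" using \<open>real n ^ 2 \<le> P\<close> Q0 by (intro mult_right_mono) (auto simp: power2_eq_square)
  then show "real n * real n * (4 ^ n * real m ^ n * \<xi>) \<le> B"
    using BP PQ zero_le_power2[of P] unfolding Q_def[symmetric] by linarith
  show "real m * 2 ^ n * real n ^ 4 * sqrt \<xi> \<le> B"
  proof -
    \<comment> \<open>The square root of \<open>4 ^ n * \<xi>\<close>: the product
      \<open>real n * z\<close> is bounded by the mean of the squares, one of which fits into
      \<open>P\<close> and the other into \<open>Q\<close>.\<close>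
    define z where "z = 2 ^ n * sqrt \<xi>"
    have z0: "0 \<le> z" using \<xi> by (simp add: z_def)
    have "z\<^sup>2 = 4 ^ n * \<xi>"
    proof -
      have "((2::real) ^ n)\<^sup>2 = 4 ^ n" unfolding power2_eq_square by (simp flip: power_mult_distrib)
      then show ?thesis using \<xi> by (simp add: z_def power_mult_distrib)
    qed
    also have "\<dots> \<le> Q"
    proof -
      have "1 \<le> real m ^ n" using m3 by (intro one_le_power) auto
      then have "4 ^ n * \<xi> * 1 \<le> 4 ^ n * \<xi> * real m ^ n" using \<xi> by (intro mult_left_mono) auto
      then show ?thesis by (simp add: Q_def mult_ac)
    qed
    finally have "z\<^sup>2 \<le> Q" .
    moreover have "2 * real n * z \<le> real n ^ 2 + z\<^sup>2" by (rule sum_squares_bound)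
    moreover have "0 \<le> real n * z" using z0 by simp
    ultimately have nz: "real n * z \<le> P + Q" using \<open>real n ^ 2 \<le> P\<close> by linarith
    have "real m * real n ^ 3 \<le> real m ^ 3 * real n ^ 3"
      using m3 by (intro mult_right_mono self_le_power) auto
    then have "real m * real n ^ 3 \<le> P + Q" using Q0 by (simp add: P_def mult.commute)
    then have "(real m * real n ^ 3) * (real n * z) \<le> (P + Q) * (P + Q)"
      using nz P0 Q0 z0 by (intro mult_mono) auto
    moreover have "real n ^ 4 = real n ^ 3 * real n" by (simp add: power4_eq_xxxx power3_eq_cube)
    ultimately show ?thesis by (simp only: B z_def power2_eq_square mult_ac)
  qed
qed

context chaos_setup
begin

text \<open>The division by \<open>real n\<close> anticipates the sum over at most \<open>n\<close>
  values of \<open>j\<close>. The third power of \<open>K\<close> covers all cases, since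
  \<open>K \<ge> 17\<close> also absorbs the numerical factors \<open>2\<close> and
  \<open>4\<close>.\<close>

lemma A_chaos_bound:
  assumes \<xi>1: "\<xi> \<le> 1"
  shows "ennreal (fact m * fact k) * chaos_dual_normsq \<rho> \<tau> m j n \<psi> k
    \<le> ennreal (fact n * (K ^ 3 * (real n ^ 3 * real m ^ 3 + \<xi> * 4 ^ n * real m ^ n)\<^sup>2 / real n)) * WM"
    (is "?L \<le> ennreal (fact n * (K ^ 3 * ?B / real n)) * WM")
proof -
  have n: "1 \<le> n" using j by simp
  have n0: "0 < real n" using j by simp
  have K: "17 \<le> K" by (rule singularity_const_bounds(1)[OF \<alpha>])
  have K23: "4 * K\<^sup>2 \<le> K ^ 3"
    using mult_right_mono[of 4 K "K\<^sup>2"] K by (simp add: power2_eq_square power3_eq_cube)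
  have K2: "0 \<le> K\<^sup>2" "0 \<le> K ^ 3" using K by auto
  have K22: "2 * K\<^sup>2 \<le> K ^ 3" using K23 K2 by linarith
  have KK: "K\<^sup>2 \<le> K ^ 3" using K23 K2 by linarith
  note b = budget_bounds[OF n m \<xi>]
  have b2: "real n * (4 ^ n * real m ^ n * \<xi>) \<le> ?B"
    using b(2) zero_le_power2[of "real n"] by linarith
  have cnt0: "0 \<le> counting m j n" by (simp add: counting_def Let_def)
  have cm: "counting m j n * real m \<le> 4 ^ n * real m ^ n"
  proof -
    have "counting m j n * real m \<le> 4 ^ n * real m ^ (n - 1) * real m"
      by (intro mult_right_mono counting_le j) auto
    also have "\<dots> = 4 ^ n * real m ^ n"
      using n power_Suc2[of "real m" "n - 1"] by simp
    finally show ?thesis .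
  qed
  then have c: "counting m j n \<le> 4 ^ n * real m ^ n"
    using m mult_left_mono[OF _ cnt0, of 1 "real m"] by simp
  have fin: "?L \<le> ennreal (fact n * (K ^ 3 * ?B / real n)) * WM"
    if L: "?L \<le> ennreal (fact n * X) * WM" and X: "real n * X \<le> K ^ 3 * ?B" for X
  proof -
    have "X \<le> K ^ 3 * ?B / real n" using X n0 by (simp add: pos_le_divide_eq mult.commute)
    then have "ennreal (fact n * X) * WM \<le> ennreal (fact n * (K ^ 3 * ?B / real n)) * WM"
      by (intro mult_right_mono ennreal_leI mult_left_mono) auto
    with L show ?thesis by (rule order.trans)
  qed
  \<comment> \<open>For \<open>j = 0\<close> the line is drawn at \<open>m = 4\<close>: with three
    outgoing momenta none is left over to be confined.\<close>
  consider "m - j = 1" | "m - j = 2" | "3 \<le> m - j" "1 \<le> j" | "j = 0" "m = 3" | "j = 0" "4 \<le> m"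
    using j m by linarith
  then show ?thesis
  proof cases
    case 1
    show ?thesis
    proof (rule fin[OF A_chaos_bound_one[OF 1]])
      have "real n * (counting m j n * (K\<^sup>2 * \<xi> * 2)) = (2 * K\<^sup>2) * (real n * (counting m j n * \<xi>))" by simp
      also have "\<dots> \<le> K ^ 3 * (real n * (4 ^ n * real m ^ n * \<xi>))"
        using K22 K2 c cnt0 \<xi> n0 by (intro mult_mono mult_left_mono mult_right_mono mult_nonneg_nonneg) auto
      also have "\<dots> \<le> K ^ 3 * ?B"
        using b2 K2 by (intro mult_left_mono) auto
      finally show "real n * (counting m j n * (K\<^sup>2 * \<xi> * 2)) \<le> K ^ 3 * ?B" .
    qed
  next
    case 2
    then have j1: "1 \<le> j" and mj: "m = j + 2" using m by auto
    show ?thesis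
    proof (rule fin[OF A_chaos_bound_two[OF 2 j1]])
      \<comment> \<open>Both \<open>\<xi> \<le> 1\<close> and \<open>1/2 \<le> \<alpha>\<close>
        enter: they reduce the gain to \<open>sqrt \<xi>\<close>, the form in which the last of the
        budget bounds is available.\<close>
      have "\<xi> powr \<alpha> \<le> \<xi> powr (1/2)"
      proof (cases "\<xi> = 0")
        case False
        then show ?thesis using \<xi> \<xi>1 \<alpha> by (intro powr_mono') auto
      qed simp
      then have xa: "\<xi> powr \<alpha> \<le> sqrt \<xi>" using \<xi> by (simp add: powr_half_sqrt)
      have "real n * (counting m j n * (K\<^sup>2 * \<xi> powr \<alpha> * (4 * real (Suc j)))) = (4 * K\<^sup>2) * (counting m j n * (real n * real (Suc j)) * \<xi> powr \<alpha>)"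
        by (simp only: mult_ac)
      also have "\<dots> \<le> K ^ 3 * ((real m * 2 ^ n * real n ^ 2) * (real n * real n) * sqrt \<xi>)"
        using K23 K2 counting_two_le[OF j(1) mj j1] cnt0 xa j(1) by (intro mult_mono mult_nonneg_nonneg) auto
      also have "\<dots> = K ^ 3 * (real m * 2 ^ n * real n ^ 4 * sqrt \<xi>)" by (simp add: eval_nat_numeral)
      also have "\<dots> \<le> K ^ 3 * ?B" using b(4) K2 by (intro mult_left_mono) auto
      finally show "real n * (counting m j n * (K\<^sup>2 * \<xi> powr \<alpha> * (4 * real (Suc j)))) \<le> K ^ 3 * ?B" .
    qed
  next
    case 3
    show ?thesis
    \<comment> \<open>Confining a single incoming momentum already yields the required first power
      of \<xi>.\<close>
    proof (rule fin[OF A_chaos_bound_three[OF 3(1), of "{1}"]])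
      show "{1} \<subseteq> {1..j}" using 3 by auto
      have "real n * (counting m j n * (K\<^sup>2 * (K * \<xi>) ^ card {1::nat} * real (Suc j))) = K ^ 3 * ((real n * real (Suc j)) * (counting m j n * \<xi>))"
        by (simp add: power2_eq_square power3_eq_cube)
      also have "\<dots> \<le> K ^ 3 * ((real n * real n) * (4 ^ n * real m ^ n * \<xi>))"
        using K2 c cnt0 \<xi> n0 j(1) by (intro mult_mono mult_nonneg_nonneg) auto
      also have "\<dots> \<le> K ^ 3 * ?B" using b(3) K2 by (intro mult_left_mono) auto
      finally show "real n * (counting m j n * (K\<^sup>2 * (K * \<xi>) ^ card {1::nat} * real (Suc j))) \<le> K ^ 3 * ?B" .
    qed
  next
    case 4
    show ?thesis
    proof (rule fin[OF A_chaos_bound_three[of "{}"]])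
      show "3 \<le> m - j" using 4 by simp
      have "real n * (counting m j n * (K\<^sup>2 * (K * \<xi>) ^ card ({}::nat set) * real (Suc j))) = K\<^sup>2 * (real n * counting 3 0 n)"
        using 4 by simp
      also have "\<dots> \<le> K ^ 3 * (real n * (27 * real n ^ 4))"
        using KK counting_three_le[OF n] K2 cnt0 4 by (intro mult_mono mult_left_mono mult_nonneg_nonneg) auto
      also have "\<dots> = K ^ 3 * (27 * real n ^ 5)" by (simp add: eval_nat_numeral)
      also have "\<dots> \<le> K ^ 3 * ?B" using b(1) K2 by (intro mult_left_mono) auto
      finally show "real n * (counting m j n * (K\<^sup>2 * (K * \<xi>) ^ card ({}::nat set) * real (Suc j))) \<le> K ^ 3 * ?B" .
    qed simp
  next
    case 5
    show ?thesis
    proof (rule fin[OF A_chaos_bound_zero[OF 5]])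
      have "real n * (real n * K\<^sup>2 + counting m j n * (real m * (K\<^sup>2 * (K * \<xi>)))) =
          K\<^sup>2 * real n ^ 2 + K ^ 3 * (real n * (counting m j n * real m * \<xi>))"
        by (simp add: power2_eq_square power3_eq_cube algebra_simps)
      also have "\<dots> \<le> K ^ 3 * real n ^ 2 + K ^ 3 * (real n * (4 ^ n * real m ^ n * \<xi>))"
        using K2 KK cm \<xi> by (intro add_mono mult_left_mono mult_right_mono) auto
      also have "\<dots> = K ^ 3 * (real n ^ 2 + real n * (4 ^ n * real m ^ n * \<xi>))" by (simp add: distrib_left)
      also have "\<dots> \<le> K ^ 3 * ?B" using b(2) K2 by (intro mult_left_mono) auto
      finally show "real n * (real n * K\<^sup>2 + counting m j n * (real m * (K\<^sup>2 * (K * \<xi>)))) \<le> K ^ 3 * ?B" .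
    qed
  qed
qed

end

section \<open>Assembling the operator norm\<close>

text \<open>The weighted arithmetic-geometric mean is applied pointwise to \<open>f / A\<close> and
  \<open>g / B\<close>, and the two integrals then add up to at most
  \<open>\<alpha> + (1 - \<alpha>)\<close>. If \<open>A\<close> or \<open>B\<close> is zero,
  normalisation is impossible, but the integrand vanishes almost everywhere.\<close>

lemma nn_integral_powr_Holder:
  fixes f g :: "'a \<Rightarrow> real"
  assumes [measurable]: "f \<in> borel_measurable M" "g \<in> borel_measurable M"
    and nn: "\<And>x. 0 \<le> f x" "\<And>x. 0 \<le> g x" and \<alpha>: "0 < \<alpha>" "\<alpha> < 1"
    and A: "(\<integral>\<^sup>+x. ennreal (f x) \<partial>M) \<le> ennreal A" "0 \<le> A"
    and B: "(\<integral>\<^sup>+x. ennreal (g x) \<partial>M) \<le> ennreal B" "0 \<le> B"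
  shows "(\<integral>\<^sup>+x. ennreal (f x powr \<alpha> * g x powr (1 - \<alpha>)) \<partial>M) \<le> ennreal (A powr \<alpha> * B powr (1 - \<alpha>))"
proof -
  have zero: "(\<integral>\<^sup>+x. ennreal (f x powr \<alpha> * g x powr (1 - \<alpha>)) \<partial>M) = 0" if "(AE x in M. f x = 0) \<or> (AE x in M. g x = 0)"
  proof -
    have "AE x in M. ennreal (f x powr \<alpha> * g x powr (1 - \<alpha>)) = 0"
      using that \<alpha> by (auto elim!: eventually_mono)
    then have "(\<integral>\<^sup>+x. ennreal (f x powr \<alpha> * g x powr (1 - \<alpha>)) \<partial>M) = (\<integral>\<^sup>+x. 0 \<partial>M)"
      by (rule nn_integral_cong_AE)
    then show ?thesis by simp
  qed
  have z: "AE x in M. h x = 0" if "(\<integral>\<^sup>+x. ennreal (h x) \<partial>M) \<le> ennreal 0" "h \<in> borel_measurable M" "\<And>x. 0 \<le> h x" for h :: "'a \<Rightarrow> real"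
  proof -
    have "(\<integral>\<^sup>+x. ennreal (h x) \<partial>M) = 0" using that(1) by simp
    then have "AE x in M. ennreal (h x) = 0"
      using that(2) by (subst (asm) nn_integral_0_iff_AE) auto
    then show ?thesis using that(3) by (auto elim!: eventually_mono simp: ennreal_eq_0_iff antisym)
  qed
  consider "A = 0" | "B = 0" | "0 < A" "0 < B" using A(2) B(2) by linarith
  then show ?thesis
  proof cases
    case 1
    then show ?thesis using zero z[of f] A(1) nn by auto
  next
    case 2
    then show ?thesis using zero z[of g] B(1) nn by auto
  next
    case 3
    define c where "c = A powr \<alpha> * B powr (1 - \<alpha>)"
    have c0: "0 < c" using 3 by (simp add: c_def)
    have young: "f x powr \<alpha> * g x powr (1 - \<alpha>) \<le> c * (\<alpha> / A * f x + (1 - \<alpha>) / B * g x)" for x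
    proof (cases "f x = 0 \<or> g x = 0")
      case True
      then show ?thesis using \<alpha> 3 nn[of x] c0 by (auto intro!: mult_nonneg_nonneg add_nonneg_nonneg)
    next
      case False
      then have pos: "0 < f x" "0 < g x" using nn[of x] by auto
      have "(f x / A) powr \<alpha> * (g x / B) powr (1 - \<alpha>) \<le> \<alpha> * (f x / A) + (1 - \<alpha>) * (g x / B)"
        using pos 3 \<alpha> by (intro Youngs_inequality_0) auto
      then have "c * ((f x / A) powr \<alpha> * (g x / B) powr (1 - \<alpha>)) \<le> c * (\<alpha> * (f x / A) + (1 - \<alpha>) * (g x / B))"
        using c0 by (intro mult_left_mono) auto
      moreover have "c * ((f x / A) powr \<alpha> * (g x / B) powr (1 - \<alpha>)) = f x powr \<alpha> * g x powr (1 - \<alpha>)"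
        using pos 3 by (simp add: c_def powr_divide)
      ultimately show ?thesis by simp
    qed
    have "(\<integral>\<^sup>+x. ennreal (f x powr \<alpha> * g x powr (1 - \<alpha>)) \<partial>M) \<le>
      (\<integral>\<^sup>+x. ennreal (c * \<alpha> / A) * ennreal (f x) + ennreal (c * (1 - \<alpha>) / B) * ennreal (g x) \<partial>M)"
    proof (rule nn_integral_mono)
      fix x
      have "ennreal (c * \<alpha> / A) * ennreal (f x) + ennreal (c * (1 - \<alpha>) / B) * ennreal (g x) = ennreal (c * \<alpha> / A * f x + c * (1 - \<alpha>) / B * g x)"
        using c0 \<alpha> 3 nn[of x] by (subst ennreal_plus) (auto simp: ennreal_mult[symmetric])
      then show "ennreal (f x powr \<alpha> * g x powr (1 - \<alpha>)) \<le> ennreal (c * \<alpha> / A) * ennreal (f x) + ennreal (c * (1 - \<alpha>) / B) * ennreal (g x)"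
        using young[of x] by (simp only:) (intro ennreal_leI, simp add: distrib_left)
    qed
    also have "\<dots> = ennreal (c * \<alpha> / A) * (\<integral>\<^sup>+x. ennreal (f x) \<partial>M) + ennreal (c * (1 - \<alpha>) / B) * (\<integral>\<^sup>+x. ennreal (g x) \<partial>M)"
      by (subst nn_integral_add) (auto simp: nn_integral_cmult)
    also have "\<dots> \<le> ennreal (c * \<alpha> / A) * ennreal A + ennreal (c * (1 - \<alpha>) / B) * ennreal B"
      by (intro add_mono mult_left_mono A B) auto
    also have "\<dots> = ennreal (c * \<alpha> + c * (1 - \<alpha>))"
      using c0 \<alpha> 3 by (subst ennreal_plus) (auto simp: ennreal_mult[symmetric])
    also have "c * \<alpha> + c * (1 - \<alpha>) = c" by (simp add: algebra_simps)
    finally show ?thesis by (simp add: c_def)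
  qed
qed

section \<open>Integrals against Xi\<close>

lemma borel_measurable_prod_Theta:
  "mollifier \<rho> \<Longrightarrow> (\<lambda>p. \<Prod>i=1..n. Theta \<rho> \<tau> (p i)) \<in> borel_measurable (leb n)"
  by (intro borel_measurable_prod measurable_compose[OF borel_measurable_leb_component Theta_props(1)])

lemma prod_Theta_nonneg: "mollifier \<rho> \<Longrightarrow> 0 \<le> (Theta_prod \<rho> \<tau> n p)"
  by (intro prod_nonneg Theta_props)

lemma borel_measurable_Xi: "borel_measurable (Xi \<rho> \<tau> n) = borel_measurable (leb n)"
  by (simp add: Xi_def cong: measurable_cong_sets)

lemma nn_integral_Xi:
  assumes \<rho>: "mollifier \<rho>" and f: "f \<in> borel_measurable (leb n)" and f0: "\<And>p. 0 \<le> f p"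
  shows "(\<integral>\<^sup>+p. ennreal (f p) \<partial>Xi \<rho> \<tau> n) = (\<integral>\<^sup>+p. ennreal ((Theta_prod \<rho> \<tau> n p) * f p) \<partial>leb n)"
proof -
  have "(\<integral>\<^sup>+p. ennreal (f p) \<partial>Xi \<rho> \<tau> n) = (\<integral>\<^sup>+p. ennreal (Theta_prod \<rho> \<tau> n p) * ennreal (f p) \<partial>leb n)"
    unfolding Xi_def using borel_measurable_prod_Theta[OF \<rho>, of \<tau> n] f
    by (intro nn_integral_density) auto
  also have "\<dots> = (\<integral>\<^sup>+p. ennreal ((Theta_prod \<rho> \<tau> n p) * f p) \<partial>leb n)"
    by (intro nn_integral_cong ennreal_mult[symmetric] prod_Theta_nonneg[OF \<rho>] f0)
  finally show ?thesis .
qed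

lemma AE_Xi:
  assumes \<rho>: "mollifier \<rho>"
  shows "(AE p in Xi \<rho> \<tau> n. P p) \<longleftrightarrow> (AE p in leb n. (Theta_prod \<rho> \<tau> n p) \<noteq> 0 \<longrightarrow> P p)"
  unfolding Xi_def using borel_measurable_prod_Theta[OF \<rho>, of \<tau> n] prod_Theta_nonneg[OF \<rho>, where n=n and \<tau>=\<tau>]
  by (subst AE_density) (auto simp: less_le)

lemma borel_measurable_mixed_weight: "mixed_weight \<tau> \<alpha> n \<in> borel_measurable (leb n)"
  unfolding mixed_weight_def[abs_def] by measurable

lemma borel_measurable_cmod_sq: "f \<in> borel_measurable M \<Longrightarrow> (\<lambda>x. (cmod (f x))\<^sup>2) \<in> borel_measurable M"
  by (intro borel_measurable_power measurable_compose[OF _ borel_measurable_norm])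

lemma weighted_mass_Xi:
  assumes "mollifier \<rho>" "\<psi> \<in> borel_measurable (leb n)"
  shows "weighted_mass \<rho> \<tau> \<alpha> n \<psi> = (\<integral>\<^sup>+p. ennreal (mixed_weight \<tau> \<alpha> n p * (cmod (\<psi> p))\<^sup>2) \<partial>Xi \<rho> \<tau> n)"
  unfolding weighted_mass_def using assms
  by (intro nn_integral_Xi[symmetric] borel_measurable_times borel_measurable_mixed_weight borel_measurable_cmod_sq)
     (auto simp: mixed_weight_nonneg)

section \<open>The case m = 1\<close>

lemma A_chaos_one_eq:
  "0 < n \<Longrightarrow> A_chaos \<rho> \<tau> 1 0 n \<psi> p = - \<i> * complex_of_real (\<tau> powr (1 / 2) * nu \<tau> powr (1 / 2) *
    (\<Sum>i=1..n. p i $ 1 * (Theta \<rho> \<tau> (p i) - 1))) * \<psi> p"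
  by (simp add: A_chaos_def)

lemma A_chaos_one_measurable:
  assumes \<rho>: "mollifier \<rho>" and n: "0 < n" and \<psi>: "\<psi> \<in> borel_measurable (leb n)"
  shows "A_chaos \<rho> \<tau> 1 0 n \<psi> \<in> borel_measurable (leb n)"
  unfolding A_chaos_one_eq[OF n, abs_def]
  by (intro borel_measurable_times borel_measurable_const borel_measurable_complex_of_real borel_measurable_sum
      borel_measurable_diff measurable_compose[OF borel_measurable_leb_component borel_measurable_nth]
      measurable_compose[OF borel_measurable_leb_component Theta_props(1)[OF \<rho>]] \<psi>)

text \<open>Cauchy--Schwarz separates the first coordinates from the differences
  \<open>Theta - 1\<close>, whose squares sum to at most \<open>L\<^sup>2 * R / \<tau>\<close>. The
  factor \<tau> of the squared prefactor cancels, and the Bessel weight reduces \<open>R\<close> to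
  \<open>2\<close>.\<close>

lemma A_chaos_one_bound:
  assumes \<rho>: "mollifier \<rho>" and \<tau>: "\<tau> > 0" and \<alpha>: "0 < \<alpha>" "\<alpha> < 1" and n: "0 < n"
    and \<psi>: "\<psi> \<in> borel_measurable (leb n)"
    and L: "\<And>u. \<bar>(cosine_transform \<rho> u)\<^sup>2 - 1\<bar> \<le> L * norm u" "0 \<le> L"
  shows "chaos_dual_normsq \<rho> \<tau> 1 0 n \<psi> n
    \<le> ennreal (2 * L\<^sup>2) * weighted_mass \<rho> \<tau> \<alpha> n \<psi>"
proof -
  have nu: "0 < nu \<tau>" by (rule nu_pos)
  have "bessel_weight \<tau> n p * (cmod (A_chaos \<rho> \<tau> 1 0 n \<psi> p))\<^sup>2
      \<le> 2 * L\<^sup>2 * (mixed_weight \<tau> \<alpha> n p * (cmod (\<psi> p))\<^sup>2)" for p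
  proof -
    define R where "R = R_normsq \<tau> n p"
    define S where "S = (\<Sum>i=1..n. p i $ 1 * (Theta \<rho> \<tau> (p i) - 1))"
    have R0: "0 \<le> R" by (simp add: R_def R_normsq_nonneg)
    have E0: "0 \<le> e1_normsq n p" by (rule e1_normsq_nonneg)
    have "S\<^sup>2 \<le> (\<Sum>i=1..n. (p i $ 1)\<^sup>2) * (\<Sum>i=1..n. (Theta \<rho> \<tau> (p i) - 1)\<^sup>2)"
      unfolding S_def by (rule Cauchy_Schwarz_ineq_sum)
    also have "\<dots> \<le> e1_normsq n p * (\<Sum>i=1..n. L\<^sup>2 * (norm (rescale \<tau> (p i)))\<^sup>2)"
    proof (unfold e1_normsq_eq, intro mult_left_mono sum_mono)
      fix i
      have "\<bar>Theta \<rho> \<tau> (p i) - 1\<bar> \<le> L * norm (rescale \<tau> (p i))"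
        unfolding Theta_eq[OF \<rho>] by (rule L)
      then have "\<bar>Theta \<rho> \<tau> (p i) - 1\<bar>\<^sup>2 \<le> (L * norm (rescale \<tau> (p i)))\<^sup>2"
        by (intro power_mono) auto
      then show "(Theta \<rho> \<tau> (p i) - 1)\<^sup>2 \<le> L\<^sup>2 * (norm (rescale \<tau> (p i)))\<^sup>2"
        by (simp add: power_mult_distrib)
    qed (auto intro!: sum_nonneg)
    also have "(\<Sum>i=1..n. L\<^sup>2 * (norm (rescale \<tau> (p i)))\<^sup>2) = L\<^sup>2 * (R / \<tau>)"
      using \<tau> by (simp add: R_def R_normsq_eq[OF \<tau>] sum_distrib_left[symmetric])
    finally have S2: "S\<^sup>2 \<le> e1_normsq n p * (L\<^sup>2 * (R / \<tau>))" .
    have pref: "(\<tau> powr (1 / 2) * nu \<tau> powr (1 / 2))\<^sup>2 = \<tau> * nu \<tau>"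
      using \<tau> nu by (simp add: power_mult_distrib powr_half_sqrt)
    have "(1 + R / 2) powr - 1 * (\<tau> * nu \<tau> * S\<^sup>2) \<le> (1 + R / 2) powr - 1 * (\<tau> * nu \<tau> * (e1_normsq n p * (L\<^sup>2 * (R / \<tau>))))"
      using \<tau> nu S2 by (intro mult_left_mono) auto
    also have "\<dots> = ((1 + R / 2) powr - 1 * R) * (L\<^sup>2 * (nu \<tau> * e1_normsq n p))"
      using \<tau> by simp
    also have "\<dots> \<le> 2 * (L\<^sup>2 * mixed_weight \<tau> \<alpha> n p)"
    proof (intro mult_mono nu_e1_normsq_le_mixed_weight[OF \<tau> \<alpha>] order_refl)
      show "(1 + R / 2) powr - 1 * R \<le> 2"
        using R0 by (simp add: powr_minus_divide field_simps)
    qed (use nu E0 R0 in auto)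
    finally have main: "(1 + R / 2) powr - 1 * (\<tau> * nu \<tau> * S\<^sup>2) \<le> 2 * (L\<^sup>2 * mixed_weight \<tau> \<alpha> n p)" .
    have "(cmod (A_chaos \<rho> \<tau> 1 0 n \<psi> p))\<^sup>2 = \<tau> * nu \<tau> * S\<^sup>2 * (cmod (\<psi> p))\<^sup>2"
      unfolding A_chaos_one_eq[OF n] S_def[symmetric] pref[symmetric]
      by (simp only: norm_mult norm_minus_cancel norm_ii norm_of_real power_mult_distrib mult_1 power2_abs mult.assoc)
    then have "(1 + R / 2) powr - 1 * (cmod (A_chaos \<rho> \<tau> 1 0 n \<psi> p))\<^sup>2 = ((1 + R / 2) powr - 1 * (\<tau> * nu \<tau> * S\<^sup>2)) * (cmod (\<psi> p))\<^sup>2"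
      by (simp only: mult.assoc)
    also have "\<dots> \<le> (2 * (L\<^sup>2 * mixed_weight \<tau> \<alpha> n p)) * (cmod (\<psi> p))\<^sup>2"
      by (intro mult_right_mono main) auto
    finally show ?thesis by (simp only: R_def mult.assoc)
  qed
  then have "chaos_dual_normsq \<rho> \<tau> 1 0 n \<psi> n \<le>
    (\<integral>\<^sup>+p. ennreal (2 * L\<^sup>2) * ennreal (mixed_weight \<tau> \<alpha> n p * (cmod (\<psi> p))\<^sup>2) \<partial>Xi \<rho> \<tau> n)"
    using mixed_weight_nonneg by (intro nn_integral_mono) (simp add: ennreal_mult[symmetric] ennreal_leI)
  also have "\<dots> = ennreal (2 * L\<^sup>2) * weighted_mass \<rho> \<tau> \<alpha> n \<psi>"
    unfolding weighted_mass_Xi[OF \<rho> \<psi>]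
    by (intro nn_integral_cmult measurable_compose[OF _ measurable_ennreal])
       (simp add: borel_measurable_Xi borel_measurable_mixed_weight borel_measurable_cmod_sq[OF \<psi>] borel_measurable_times)
  finally show ?thesis .
qed

lemma A_chaos_zero: "A_chaos \<rho> \<tau> m j n (\<lambda>_. 0) p = 0"
  by (simp add: A_chaos_def fibre_integral_def Let_def)

text \<open>All other summands vanish: either the source component is not the \<open>n\<close>-th
  one, hence zero, or \<open>n \<le> j\<close> and the operator is zero by definition. For given
  \<open>k\<close> at most one \<open>j\<close> satisfies the equation.\<close>

lemma A_op_homogeneous:
  "A_op \<rho> \<tau> m (homogeneous n \<psi>) k p = (\<Sum>j\<in>{j. j < m \<and> j < n \<and> k + 2 * j + 1 = n + m}. A_chaos \<rho> \<tau> m j n \<psi> p)"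
proof -
  have "A_op \<rho> \<tau> m (homogeneous n \<psi>) k p = (\<Sum>j\<in>{j. j < m \<and> m \<le> k + 2 * j + 1}. A_chaos \<rho> \<tau> m j (k + 2 * j + 1 - m) (homogeneous n \<psi> (k + 2 * j + 1 - m)) p)"
    by (simp add: A_op_def Let_def)
  also have "\<dots> = (\<Sum>j\<in>{j. j < m \<and> j < n \<and> k + 2 * j + 1 = n + m}. A_chaos \<rho> \<tau> m j (k + 2 * j + 1 - m) (homogeneous n \<psi> (k + 2 * j + 1 - m)) p)"
  proof (rule sum.mono_neutral_right)
    show "\<forall>j\<in>{j. j < m \<and> m \<le> k + 2 * j + 1} - {j. j < m \<and> j < n \<and> k + 2 * j + 1 = n + m}.
      A_chaos \<rho> \<tau> m j (k + 2 * j + 1 - m) (homogeneous n \<psi> (k + 2 * j + 1 - m)) p = 0"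
    proof
      fix j assume j: "j \<in> {j. j < m \<and> m \<le> k + 2 * j + 1} - {j. j < m \<and> j < n \<and> k + 2 * j + 1 = n + m}"
      show "A_chaos \<rho> \<tau> m j (k + 2 * j + 1 - m) (homogeneous n \<psi> (k + 2 * j + 1 - m)) p = 0"
      proof (cases "k + 2 * j + 1 - m = n")
        case True
        then have "\<not> j < n" using j by auto
        then show ?thesis using True by (simp add: A_chaos_def)
      next
        case False
        then have "homogeneous n \<psi> (k + 2 * j + 1 - m) = (\<lambda>_. 0)" by (simp add: homogeneous_def)
        then show ?thesis by (simp only: A_chaos_zero)
      qed
    qed
  qed auto
  also have "\<dots> = (\<Sum>j\<in>{j. j < m \<and> j < n \<and> k + 2 * j + 1 = n + m}. A_chaos \<rho> \<tau> m j n \<psi> p)"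
  proof (rule sum.cong[OF refl])
    fix j assume "j \<in> {j. j < m \<and> j < n \<and> k + 2 * j + 1 = n + m}"
    then have "k + 2 * j + 1 - m = n" by simp
    then show "A_chaos \<rho> \<tau> m j (k + 2 * j + 1 - m) (homogeneous n \<psi> (k + 2 * j + 1 - m)) p = A_chaos \<rho> \<tau> m j n \<psi> p"
      by (simp only: homogeneous_def) simp
  qed
  finally show ?thesis .
qed

text \<open>The target order \<open>kk j\<close> determines \<open>j\<close>, so no two terms share
  a chaos and there are no cross terms; the series over all orders is a finite sum.\<close>

lemma H_normsq_A_op:
  assumes meas: "\<And>j. \<lbrakk>j < m; j < n\<rbrakk> \<Longrightarrow> A_chaos \<rho> \<tau> m j n \<psi> \<in> borel_measurable (leb (n + m - (2 * j + 1)))"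
  shows "H_normsq \<rho> \<tau> (- 1) (fock_scale (sqrt (fact m)) (A_op \<rho> \<tau> m (homogeneous n \<psi>))) =
    (\<Sum>j\<in>{j. j < m \<and> j < n}. ennreal (fact m * fact (n + m - (2 * j + 1))) *
      chaos_dual_normsq \<rho> \<tau> m j n \<psi> (n + m - (2 * j + 1)))"
proof -
  define J where "J = {j. j < m \<and> j < n}"
  define kk where "kk j = n + m - (2 * j + 1)" for j
  have finJ: "finite J" by (simp add: J_def)
  have inj: "inj_on kk J" by (auto simp: inj_on_def J_def kk_def)
  define t where "t k = ennreal (fact k) * (\<integral>\<^sup>+p. ennreal (bessel_weight \<tau> k p *
      (cmod (fock_scale (sqrt (fact m)) (A_op \<rho> \<tau> m (homogeneous n \<psi>)) k p))\<^sup>2) \<partial>Xi \<rho> \<tau> k)" for k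
  have index: "{j. j < m \<and> j < n \<and> k + 2 * j + 1 = n + m} = {j\<in>J. kk j = k}" for k
    by (auto simp: J_def kk_def)
  have t0: "t k = 0" if "k \<notin> kk ` J" for k
  proof -
    have "{j\<in>J. kk j = k} = {}" using that by auto
    then show ?thesis unfolding t_def fock_scale_def A_op_homogeneous index by (simp only:) simp
  qed
  have t1: "t (kk j) = ennreal (fact m * fact (kk j)) * chaos_dual_normsq \<rho> \<tau> m j n \<psi> (kk j)"
    if j: "j \<in> J" for j
  proof -
    have s: "{j'\<in>J. kk j' = kk j} = {j}" using inj j by (auto simp: inj_on_def)
    have "(cmod (fock_scale (sqrt (fact m)) (A_op \<rho> \<tau> m (homogeneous n \<psi>)) (kk j) p))\<^sup>2 = fact m * (cmod (A_chaos \<rho> \<tau> m j n \<psi> p))\<^sup>2" for p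
      unfolding fock_scale_def A_op_homogeneous index s by (simp add: norm_mult power_mult_distrib)
    then have "t (kk j) = ennreal (fact (kk j)) * (\<integral>\<^sup>+p. ennreal (fact m) * ennreal (bessel_weight \<tau> (kk j) p * (cmod (A_chaos \<rho> \<tau> m j n \<psi> p))\<^sup>2) \<partial>Xi \<rho> \<tau> (kk j))"
      unfolding t_def by (simp add: ennreal_mult[symmetric] mult_ac del: ennreal_fact)
    also have "\<dots> = ennreal (fact (kk j)) * (ennreal (fact m) * chaos_dual_normsq \<rho> \<tau> m j n \<psi> (kk j))"
    proof -
      have "A_chaos \<rho> \<tau> m j n \<psi> \<in> borel_measurable (leb (kk j))" using meas j by (simp add: J_def kk_def)
      from borel_measurable_cmod_sq[OF this]
      have "(\<lambda>p. bessel_weight \<tau> (kk j) p * (cmod (A_chaos \<rho> \<tau> m j n \<psi> p))\<^sup>2) \<in> borel_measurable (leb (kk j))"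
        by measurable
      then have "(\<lambda>p. bessel_weight \<tau> (kk j) p * (cmod (A_chaos \<rho> \<tau> m j n \<psi> p))\<^sup>2) \<in> borel_measurable (Xi \<rho> \<tau> (kk j))"
        by (simp only: borel_measurable_Xi)
      then show ?thesis by (subst nn_integral_cmult) auto
    qed
    also have "\<dots> = ennreal (fact m * fact (kk j)) * chaos_dual_normsq \<rho> \<tau> m j n \<psi> (kk j)"
      by (simp only: ennreal_mult[OF fact_ge_zero fact_ge_zero] mult_ac)
    finally show ?thesis .
  qed
  have "H_normsq \<rho> \<tau> (- 1) (fock_scale (sqrt (fact m)) (A_op \<rho> \<tau> m (homogeneous n \<psi>))) = (\<Sum>k. t k)"
    by (simp add: H_normsq_def t_def)
  also have "\<dots> = (\<Sum>k\<in>kk ` J. t k)"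
    using finJ t0 by (intro suminf_finite) auto
  also have "\<dots> = (\<Sum>j\<in>J. t (kk j))" by (simp add: sum.reindex[OF inj])
  also have "\<dots> = (\<Sum>j\<in>J. ennreal (fact m * fact (kk j)) * chaos_dual_normsq \<rho> \<tau> m j n \<psi> (kk j))"
    by (intro sum.cong refl t1)
  finally show ?thesis by (simp only: J_def kk_def)
qed

lemma H_normsq_A_op_le:
  assumes \<rho>: "mollifier \<rho>" and \<tau>: "\<tau> > 0" and \<alpha>: "1/2 \<le> \<alpha>" "\<alpha> < 1" and \<xi>: "0 \<le> \<xi>" "\<xi> \<le> 1"
    and m: "1 \<le> m" "m \<noteq> 2" and n: "1 \<le> n" and \<psi>: "\<psi> \<in> borel_measurable (leb n)"
    and supp: "\<And>x. \<psi> x \<noteq> 0 \<Longrightarrow> R_normsq \<tau> n x \<le> \<tau> * \<xi>"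
    and L: "\<And>u. \<bar>(cosine_transform \<rho> u)\<^sup>2 - 1\<bar> \<le> L * norm u" "0 \<le> L"
  shows "H_normsq \<rho> \<tau> (- 1) (fock_scale (sqrt (fact m)) (A_op \<rho> \<tau> m (homogeneous n \<psi>))) \<le>
    ennreal (fact n * ((singularity_const \<alpha> ^ 3 + 2 * L\<^sup>2) * (real n ^ 3 * real m ^ 3 + \<xi> * 4 ^ n * real m ^ n)\<^sup>2)) *
      weighted_mass \<rho> \<tau> \<alpha> n \<psi>"
    (is "_ \<le> ennreal (fact n * ((_ + _) * ?B)) * ?WM")
proof -
  let ?K = "singularity_const \<alpha>"
  have K: "0 \<le> ?K ^ 3" using singularity_const_bounds(1)[OF \<alpha>] by simp
  have B0: "0 \<le> ?B" by simp
  show ?thesis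
  proof (cases "m = 1")
    case True
    \<comment> \<open>For \<open>m = 1\<close> the factor of the theorem is at least
      \<open>1\<close>, so the absolute bound on the multiplier fits under it.\<close>
    have B1: "1 \<le> ?B"
    proof -
      have "1 * 1 \<le> real n ^ 3 * real m ^ 3" using n m by (intro mult_mono one_le_power) auto
      moreover have "0 \<le> \<xi> * 4 ^ n * real m ^ n" using \<xi> by simp
      ultimately have "1 \<le> real n ^ 3 * real m ^ 3 + \<xi> * 4 ^ n * real m ^ n" by linarith
      then show ?thesis by (rule one_le_power)
    qed
    have J: "{j. j < m \<and> j < n} = {0}" using True n by auto
    have "H_normsq \<rho> \<tau> (- 1) (fock_scale (sqrt (fact m)) (A_op \<rho> \<tau> m (homogeneous n \<psi>))) =
      ennreal (fact n) * chaos_dual_normsq \<rho> \<tau> 1 0 n \<psi> n"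
    proof (subst H_normsq_A_op)
      fix j assume "j < m" "j < n"
      then show "A_chaos \<rho> \<tau> m j n \<psi> \<in> borel_measurable (leb (n + m - (2 * j + 1)))"
        using A_chaos_one_measurable[OF \<rho> _ \<psi>, of \<tau>] True by simp
    qed (simp only: J, simp add: True)
    also have "\<dots> \<le> ennreal (fact n) * (ennreal (2 * L\<^sup>2) * ?WM)"
      using n \<alpha> by (intro mult_left_mono A_chaos_one_bound[OF \<rho> \<tau> _ _ _ \<psi> L]) auto
    also have "\<dots> = ennreal (fact n * (2 * L\<^sup>2)) * ?WM"
      by (simp add: ennreal_mult mult.assoc)
    also have "\<dots> \<le> ennreal (fact n * ((?K ^ 3 + 2 * L\<^sup>2) * ?B)) * ?WM"
    proof (intro mult_right_mono ennreal_leI mult_left_mono)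
      have "2 * L\<^sup>2 * 1 \<le> (?K ^ 3 + 2 * L\<^sup>2) * ?B"
        using K B1 by (intro mult_mono) auto
      then show "2 * L\<^sup>2 \<le> (?K ^ 3 + 2 * L\<^sup>2) * ?B" by simp
    qed auto
    finally show ?thesis .
  next
    case False
    then have m3: "3 \<le> m" using m by simp
    have chaos_setup_I: "chaos_setup \<rho> \<tau> \<alpha> \<xi> m j n \<psi>" if "j < m" "j < n" for j
      unfolding chaos_setup_def using \<rho> \<tau> \<alpha> \<xi> that m3 \<psi> supp by auto
    have "H_normsq \<rho> \<tau> (- 1) (fock_scale (sqrt (fact m)) (A_op \<rho> \<tau> m (homogeneous n \<psi>))) =
      (\<Sum>j\<in>{j. j < m \<and> j < n}. ennreal (fact m * fact (n + m - (2 * j + 1))) *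
      chaos_dual_normsq \<rho> \<tau> m j n \<psi> (n + m - (2 * j + 1)))"
      using chaos_setup.A_chaos_measurable[OF chaos_setup_I] by (intro H_normsq_A_op) auto
    also have "\<dots> \<le> (\<Sum>j\<in>{j. j < m \<and> j < n}. ennreal (fact n * (?K ^ 3 * ?B / real n)) * ?WM)"
      using chaos_setup.A_chaos_bound[OF chaos_setup_I \<xi>(2)] by (intro sum_mono) auto
    \<comment> \<open>The number of terms is at most \<open>n\<close>, which consumes the division
      by \<open>real n\<close> in \<open>A_chaos_bound\<close>.\<close>
    also have "\<dots> \<le> (\<Sum>j\<in>{..<n}. ennreal (fact n * (?K ^ 3 * ?B / real n)) * ?WM)"
      by (intro sum_mono2) auto
    also have "\<dots> = ennreal (real n) * ennreal (fact n * (?K ^ 3 * ?B / real n)) * ?WM"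
      by (simp add: ennreal_of_nat_eq_real_of_nat mult.assoc)
    also have "ennreal (real n) * ennreal (fact n * (?K ^ 3 * ?B / real n)) = ennreal (real n * (fact n * (?K ^ 3 * ?B / real n)))"
      using K B0 by (intro ennreal_mult[symmetric]) auto
    also have "real n * (fact n * (?K ^ 3 * ?B / real n)) = fact n * (?K ^ 3 * ?B)"
      using n by simp
    also have "ennreal (fact n * (?K ^ 3 * ?B)) * ?WM \<le> ennreal (fact n * ((?K ^ 3 + 2 * L\<^sup>2) * ?B)) * ?WM"
      using B0 by (intro mult_right_mono ennreal_leI mult_left_mono) auto
    finally show ?thesis .
  qed
qed

section \<open>Independence of the representative\<close>

text \<open>A fibre is itself a null set, so agreement almost everywhere does not restrict to every
  fibre. Disintegrating the \<open>Theta\<close> mass of the set of disagreement shows that almost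
  every fibre meets it in a null set.\<close>

lemma fibre_integral_cong_AE:
  assumes \<rho>: "mollifier \<rho>" and f: "f \<in> borel_measurable (leb n)" "f' \<in> borel_measurable (leb n)"
    and ff': "AE x in Xi \<rho> \<tau> n. f x = f' x"
    and jI: "j < n" "I \<subseteq> {1..k}" "card I = l" "k + Suc j = n + l" and l: "0 < l"
  shows "AE p in Xi \<rho> \<tau> k. fibre_integral \<rho> \<tau> j (\<Sum>i\<in>I. p i) (\<lambda>r. f (joined_args j n k I r p)) =
    fibre_integral \<rho> \<tau> j (\<Sum>i\<in>I. p i) (\<lambda>r. f' (joined_args j n k I r p))"
proof -
  interpret J: sigma_finite_measure "leb j" by (rule sigma_finite_leb)
  let ?T = "Theta \<rho> \<tau>"
  note T = Theta_props(1)[OF \<rho>, of \<tau>]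
  obtain i0 where i0: "i0 \<in> I" using jI(3) l by fastforce
  define d where "d x = (if f x = f' x then 0 else ennreal (\<Prod>i=1..n. ?T (x i)))" for x
  have d: "d \<in> borel_measurable (leb n)"
    unfolding d_def using f borel_measurable_prod_Theta[OF \<rho>, of \<tau> n] by measurable
  have "(\<integral>\<^sup>+x. d x \<partial>leb n) = (\<integral>\<^sup>+x. 0 \<partial>leb n)"
    using ff' unfolding AE_Xi[OF \<rho>]
    by (intro nn_integral_cong_AE) (elim eventually_mono, metis d_def ennreal_0)
  then have d0: "(\<integral>\<^sup>+x. d x \<partial>leb n) = 0" by simp
  define Jn where "Jn p r = joined_args j n k I (complete_fibre j (\<Sum>i\<in>I. p i) r) p" for p r
  \<comment> \<open>With trivial outgoing weights the integrals of \<open>1\<close> are infinite,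
    but the last factor is \<open>0\<close>, and \<open>ennreal\<close> has infinity times zero
    equal to zero.\<close>
  have "(\<integral>\<^sup>+p. (\<Prod>i\<in>I - {i0}. 1) * (\<integral>\<^sup>+r. d (Jn p r) \<partial>leb j) \<partial>leb k) = (\<Prod>i\<in>I - {i0}. \<integral>\<^sup>+u. 1 \<partial>(lborel :: (real^2) measure)) * (\<integral>\<^sup>+x. d x \<partial>leb n)"
    unfolding Jn_def by (rule nn_integral_joined_args[where G="\<lambda>_ _. 1", OF jI(1-3) i0 jI(4) _ d]) simp
  then have "(\<integral>\<^sup>+p. (\<integral>\<^sup>+r. d (Jn p r) \<partial>leb j) \<partial>leb k) = 0" using d0 by simp
  moreover have "(\<lambda>p. \<integral>\<^sup>+r. d (Jn p r) \<partial>leb j) \<in> borel_measurable (leb k)"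
    unfolding Jn_def joined_args_eq_glue
    using J.borel_measurable_nn_integral_fst[OF measurable_compose[OF measurable_glue_joined[OF jI] d]] by simp
  ultimately have "AE p in leb k. (\<integral>\<^sup>+r. d (Jn p r) \<partial>leb j) = 0"
    by (simp add: nn_integral_0_iff_AE)
  then show ?thesis
    unfolding AE_Xi[OF \<rho>]
  proof eventually_elim
    case (elim p)
    show ?case
    proof
      assume nz: "(\<Prod>i=1..k. ?T (p i)) \<noteq> 0"
      define C where "C = (\<Prod>i\<in>{1..k} - I. ?T (p i))"
      have C: "C \<noteq> 0" using nz by (auto simp: C_def)
      let ?q = "\<Sum>i\<in>I. p i"
      let ?P = "\<lambda>r. \<Prod>i=1..Suc j. ?T ((complete_fibre j ?q r) i)"
      have m: "(\<lambda>r. g (Jn p r)) \<in> borel_measurable (leb j)" if "g \<in> borel_measurable (leb n)" for g :: "_ \<Rightarrow> 'z::topological_space"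
        unfolding Jn_def joined_args_eq_glue
      proof (rule measurable_compose[OF _ that[unfolded leb_def]])
        show "(\<lambda>r. glue j n ?q r (rest j n k I p)) \<in> measurable (leb j) (PiR2 {1..n})"
          unfolding leb_def using jI by (intro measurable_glue) (auto simp: space_PiM rest_def)
      qed
      have P: "?P \<in> borel_measurable (leb j)"
        by (intro borel_measurable_prod measurable_compose[OF borel_measurable_complete_fibre T])
      have "AE r in leb j. d (Jn p r) = 0"
        using elim m[OF d] by (simp add: nn_integral_0_iff_AE)
      then have "AE r in leb j. f (Jn p r) * complex_of_real (?P r) = f' (Jn p r) * complex_of_real (?P r)"
      proof eventually_elim
        case (elim r)
        \<comment> \<open>\<open>C \<noteq> 0\<close> for the untouched momenta, so a vanishing
          product means that the fibre factor is zero and the value of \<open>f\<close> there is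
          irrelevant.\<close>
        have "(\<Prod>i=1..n. ?T (Jn p r i)) = ?P r * C"
          unfolding Jn_def C_def by (rule prod_joined_args[OF jI])
        moreover have "0 \<le> (\<Prod>i=1..n. ?T (Jn p r i))" by (rule prod_Theta_nonneg[OF \<rho>])
        ultimately have "f (Jn p r) = f' (Jn p r) \<or> ?P r = 0"
          using elim C by (auto simp: d_def ennreal_eq_0_iff split: if_splits)
        then show ?case by auto
      qed
      then show "fibre_integral \<rho> \<tau> j ?q (\<lambda>r. f (joined_args j n k I r p)) = fibre_integral \<rho> \<tau> j ?q (\<lambda>r. f' (joined_args j n k I r p))"
        unfolding fibre_integral_def Let_def Jn_def[symmetric]
        by (intro integral_cong_AE borel_measurable_times borel_measurable_complex_of_real P m f)
    qed
  qed
qed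

lemma A_chaos_cong_AE:
  assumes \<rho>: "mollifier \<rho>" and f: "f \<in> borel_measurable (leb n)" "f' \<in> borel_measurable (leb n)"
    and ff': "AE x in Xi \<rho> \<tau> n. f x = f' x" and j: "j < n" "j < m"
  shows "AE p in Xi \<rho> \<tau> (n + m - (2 * j + 1)). A_chaos \<rho> \<tau> m j n f p = A_chaos \<rho> \<tau> m j n f' p"
proof (cases "m = 1")
  case True
  then have k: "n + m - (2 * j + 1) = n" using j by simp
  show ?thesis unfolding k using ff' by eventually_elim (simp add: A_chaos_def True)
next
  case False
  let ?k = "n + m - (2 * j + 1)"
  have "AE p in Xi \<rho> \<tau> ?k. \<forall>I\<in>{I. I \<subseteq> {1..?k} \<and> card I = m - j}.
      fibre_integral \<rho> \<tau> j (\<Sum>i\<in>I. p i) (\<lambda>r. f (joined_args j n ?k I r p)) =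
      fibre_integral \<rho> \<tau> j (\<Sum>i\<in>I. p i) (\<lambda>r. f' (joined_args j n ?k I r p))"
    using j by (intro AE_finite_allI fibre_integral_cong_AE[OF \<rho> f ff']) auto
  then show ?thesis
  proof eventually_elim
    case (elim p)
    then have "(\<Sum>I\<in>{I. I \<subseteq> {1..?k} \<and> card I = m - j}. complex_of_real (e1 \<bullet> (\<Sum>i\<in>I. p i)) * fibre_integral \<rho> \<tau> j (\<Sum>i\<in>I. p i) (\<lambda>r. f (joined_args j n ?k I r p)))
      = (\<Sum>I\<in>{I. I \<subseteq> {1..?k} \<and> card I = m - j}. complex_of_real (e1 \<bullet> (\<Sum>i\<in>I. p i)) * fibre_integral \<rho> \<tau> j (\<Sum>i\<in>I. p i) (\<lambda>r. f' (joined_args j n ?k I r p)))"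
      by (intro sum.cong refl) simp
    then show ?case
      using False unfolding A_chaos_def Let_def by (simp only: if_False)
  qed
qed

lemma H_normsq_A_op_cong_AE:
  assumes \<rho>: "mollifier \<rho>" and f: "f \<in> borel_measurable (leb n)" "f' \<in> borel_measurable (leb n)"
    and ff': "AE x in Xi \<rho> \<tau> n. f x = f' x"
  shows "H_normsq \<rho> \<tau> \<gamma> (fock_scale c (A_op \<rho> \<tau> m (homogeneous n f))) = H_normsq \<rho> \<tau> \<gamma> (fock_scale c (A_op \<rho> \<tau> m (homogeneous n f')))"
proof -
  have ae: "AE p in Xi \<rho> \<tau> k. A_op \<rho> \<tau> m (homogeneous n f) k p = A_op \<rho> \<tau> m (homogeneous n f') k p" for k
  proof -
    have "AE p in Xi \<rho> \<tau> k. \<forall>j\<in>{j. j < m \<and> j < n \<and> k + 2 * j + 1 = n + m}. A_chaos \<rho> \<tau> m j n f p = A_chaos \<rho> \<tau> m j n f' p"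
    proof (rule AE_finite_allI)
      fix j assume j: "j \<in> {j. j < m \<and> j < n \<and> k + 2 * j + 1 = n + m}"
      then have k: "k = n + m - (2 * j + 1)" by auto
      show "AE p in Xi \<rho> \<tau> k. A_chaos \<rho> \<tau> m j n f p = A_chaos \<rho> \<tau> m j n f' p"
        unfolding k by (rule A_chaos_cong_AE[OF \<rho> f ff']) (use j in auto)
    qed simp
    then show ?thesis
      unfolding A_op_homogeneous by (auto elim!: eventually_mono intro!: sum.cong)
  qed
  have "(\<integral>\<^sup>+p. ennreal ((1 + R_normsq \<tau> k p / 2) powr \<gamma> * (cmod (fock_scale c (A_op \<rho> \<tau> m (homogeneous n f)) k p))\<^sup>2) \<partial>Xi \<rho> \<tau> k) =
    (\<integral>\<^sup>+p. ennreal ((1 + R_normsq \<tau> k p / 2) powr \<gamma> * (cmod (fock_scale c (A_op \<rho> \<tau> m (homogeneous n f')) k p))\<^sup>2) \<partial>Xi \<rho> \<tau> k)" for k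
    by (rule nn_integral_cong_AE) (use ae[of k] in eventually_elim, simp add: fock_scale_def)
  then show ?thesis by (simp add: H_normsq_def)
qed

section \<open>Interpolation between the two norms and conclusion\<close>

lemma L2_normsq_homogeneous:
  "L2_normsq \<rho> \<tau> (sqrt_neg_nu_L0_e1 \<tau> (homogeneous n f)) =
    ennreal (fact n) * (\<integral>\<^sup>+p. ennreal (nu \<tau> * e1_normsq n p / 2 * (cmod (f p))\<^sup>2) \<partial>Xi \<rho> \<tau> n)"
proof -
  have "L2_normsq \<rho> \<tau> (sqrt_neg_nu_L0_e1 \<tau> (homogeneous n f)) =
    (\<Sum>k\<in>{n}. ennreal (fact k) * (\<integral>\<^sup>+p. ennreal ((cmod (sqrt_neg_nu_L0_e1 \<tau> (homogeneous n f) k p))\<^sup>2) \<partial>Xi \<rho> \<tau> k))"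
    unfolding L2_normsq_def by (rule suminf_finite) (auto simp: sqrt_neg_nu_L0_e1_def multiplier_def homogeneous_def)
  moreover have "(cmod (sqrt_neg_nu_L0_e1 \<tau> (homogeneous n f) n p))\<^sup>2 = nu \<tau> * e1_normsq n p / 2 * (cmod (f p))\<^sup>2" for p
    using nu_pos[of \<tau>] e1_normsq_nonneg[of n p]
    by (simp add: sqrt_neg_nu_L0_e1_def multiplier_def homogeneous_def L0_e1_symbol_def norm_mult power_mult_distrib)
  ultimately show ?thesis by simp
qed

lemma H_normsq_homogeneous:
  "H_normsq \<rho> \<tau> 1 (homogeneous n f) =
    ennreal (fact n) * (\<integral>\<^sup>+p. ennreal ((1 + R_normsq \<tau> n p / 2) * (cmod (f p))\<^sup>2) \<partial>Xi \<rho> \<tau> n)"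
proof -
  have "H_normsq \<rho> \<tau> 1 (homogeneous n f) =
    (\<Sum>k\<in>{n}. ennreal (fact k) * (\<integral>\<^sup>+p. ennreal ((1 + R_normsq \<tau> k p / 2) powr 1 * (cmod (homogeneous n f k p))\<^sup>2) \<partial>Xi \<rho> \<tau> k))"
    unfolding H_normsq_def by (rule suminf_finite) (auto simp: homogeneous_def)
  then show ?thesis
    using R_normsq_nonneg[of \<tau> n] by (simp add: homogeneous_def add_nonneg_nonneg)
qed

text \<open>Both norms contain half of the symbols in \<open>mixed_weight\<close>, so each symbol
  costs a factor \<open>2\<close>, and the powers \<alpha> and \<open>1 - \<alpha>\<close> of it
  combine to \<open>2\<close>. The factorial is treated the same way.\<close>

lemma weighted_mass_interpolation:
  assumes \<rho>: "mollifier \<rho>" and \<psi>: "\<psi> \<in> borel_measurable (leb n)" and \<alpha>: "0 < \<alpha>" "\<alpha> < 1"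
    and A: "L2_normsq \<rho> \<tau> (sqrt_neg_nu_L0_e1 \<tau> (homogeneous n \<psi>)) = ennreal A" "0 \<le> A"
    and B: "H_normsq \<rho> \<tau> 1 (homogeneous n \<psi>) = ennreal B" "0 \<le> B"
  shows "ennreal (fact n) * weighted_mass \<rho> \<tau> \<alpha> n \<psi> \<le> ennreal (2 * (A powr \<alpha> * B powr (1 - \<alpha>)))"
proof -
  let ?c = "2 / fact n :: real"
  have c0: "0 < ?c" by simp
  let ?f = "\<lambda>p. nu \<tau> * e1_normsq n p * (cmod (\<psi> p))\<^sup>2" and ?g = "\<lambda>p. R_normsq \<tau> n p * (cmod (\<psi> p))\<^sup>2"
  have fm: "?f \<in> borel_measurable (Xi \<rho> \<tau> n)" "?g \<in> borel_measurable (Xi \<rho> \<tau> n)"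
    unfolding borel_measurable_Xi
    by (intro borel_measurable_times borel_measurable_const borel_measurable_e1_normsq borel_measurable_R_normsq borel_measurable_cmod_sq \<psi>)+
  have f0: "0 \<le> ?f p" "0 \<le> ?g p" for p
    using nu_pos[of \<tau>] e1_normsq_nonneg[of n p] R_normsq_nonneg[of \<tau> n p] by auto
  have scale: "(\<integral>\<^sup>+p. ennreal (2 * h p) \<partial>Xi \<rho> \<tau> n) = ennreal (?c * X)"
    if "ennreal (fact n) * (\<integral>\<^sup>+p. ennreal (h p) \<partial>Xi \<rho> \<tau> n) = ennreal X" "h \<in> borel_measurable (leb n)" "0 \<le> X" "\<And>p. 0 \<le> h p" for h X
  proof -
    have "(\<integral>\<^sup>+p. ennreal (2 * h p) \<partial>Xi \<rho> \<tau> n) = (\<integral>\<^sup>+p. ennreal 2 * ennreal (h p) \<partial>Xi \<rho> \<tau> n)"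
      using that(4) by (intro nn_integral_cong ennreal_mult) auto
    also have "\<dots> = ennreal 2 * (\<integral>\<^sup>+p. ennreal (h p) \<partial>Xi \<rho> \<tau> n)"
      using that(2) by (intro nn_integral_cmult measurable_compose[OF _ measurable_ennreal]) (simp add: borel_measurable_Xi)
    also have "\<dots> = ennreal (?c * fact n) * (\<integral>\<^sup>+p. ennreal (h p) \<partial>Xi \<rho> \<tau> n)" by simp
    also have "ennreal (?c * fact n) = ennreal ?c * ennreal (fact n)" by (intro ennreal_mult) auto
    also have "ennreal ?c * ennreal (fact n) * (\<integral>\<^sup>+p. ennreal (h p) \<partial>Xi \<rho> \<tau> n) = ennreal ?c * ennreal X"
      using that(1) by (simp only: mult.assoc)
    also have "\<dots> = ennreal (?c * X)" using that(3) by (intro ennreal_mult[symmetric]) auto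
    finally show ?thesis .
  qed
  have "(\<integral>\<^sup>+p. ennreal (?f p) \<partial>Xi \<rho> \<tau> n) = (\<integral>\<^sup>+p. ennreal (2 * (nu \<tau> * e1_normsq n p / 2 * (cmod (\<psi> p))\<^sup>2)) \<partial>Xi \<rho> \<tau> n)"
    by simp
  also have "\<dots> = ennreal (?c * A)"
  proof (rule scale)
    show "ennreal (fact n) * (\<integral>\<^sup>+p. ennreal (nu \<tau> * e1_normsq n p / 2 * (cmod (\<psi> p))\<^sup>2) \<partial>Xi \<rho> \<tau> n) = ennreal A"
      using A(1) unfolding L2_normsq_homogeneous .
    show "(\<lambda>p. nu \<tau> * e1_normsq n p / 2 * (cmod (\<psi> p))\<^sup>2) \<in> borel_measurable (leb n)"
      by (intro borel_measurable_times borel_measurable_divide borel_measurable_const borel_measurable_e1_normsq borel_measurable_cmod_sq \<psi>)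
  qed (use A nu_pos[of \<tau>] e1_normsq_nonneg[of n] in auto)
  finally have fA: "(\<integral>\<^sup>+p. ennreal (?f p) \<partial>Xi \<rho> \<tau> n) \<le> ennreal (?c * A)" by simp
  have "(\<integral>\<^sup>+p. ennreal (?g p) \<partial>Xi \<rho> \<tau> n) \<le> (\<integral>\<^sup>+p. ennreal (2 * ((1 + R_normsq \<tau> n p / 2) * (cmod (\<psi> p))\<^sup>2)) \<partial>Xi \<rho> \<tau> n)"
    by (intro nn_integral_mono ennreal_leI) (auto simp: algebra_simps)
  also have "\<dots> = ennreal (?c * B)"
  proof (rule scale)
    show "ennreal (fact n) * (\<integral>\<^sup>+p. ennreal ((1 + R_normsq \<tau> n p / 2) * (cmod (\<psi> p))\<^sup>2) \<partial>Xi \<rho> \<tau> n) = ennreal B"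
      using B(1) unfolding H_normsq_homogeneous .
    show "(\<lambda>p. (1 + R_normsq \<tau> n p / 2) * (cmod (\<psi> p))\<^sup>2) \<in> borel_measurable (leb n)"
      by (intro borel_measurable_times borel_measurable_add borel_measurable_divide borel_measurable_const borel_measurable_R_normsq borel_measurable_cmod_sq \<psi>)
  qed (use B R_normsq_nonneg[of \<tau> n] in \<open>auto simp: add_nonneg_nonneg\<close>)
  finally have gB: "(\<integral>\<^sup>+p. ennreal (?g p) \<partial>Xi \<rho> \<tau> n) \<le> ennreal (?c * B)" .
  have "weighted_mass \<rho> \<tau> \<alpha> n \<psi> = (\<integral>\<^sup>+p. ennreal (?f p powr \<alpha> * ?g p powr (1 - \<alpha>)) \<partial>Xi \<rho> \<tau> n)"
    unfolding weighted_mass_Xi[OF \<rho> \<psi>]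
  proof (intro nn_integral_cong arg_cong[where f=ennreal])
    fix p
    let ?s = "(cmod (\<psi> p))\<^sup>2"
    have "?s powr \<alpha> * ?s powr (1 - \<alpha>) = ?s" by (simp add: powr_add[symmetric])
    then show "mixed_weight \<tau> \<alpha> n p * ?s = ?f p powr \<alpha> * ?g p powr (1 - \<alpha>)"
      using nu_pos[of \<tau>] e1_normsq_nonneg[of n p] R_normsq_nonneg[of \<tau> n p]
      by (simp add: mixed_weight_def powr_mult mult_ac)
  qed
  also have "\<dots> \<le> ennreal ((?c * A) powr \<alpha> * (?c * B) powr (1 - \<alpha>))"
    using A B by (intro nn_integral_powr_Holder fm f0 \<alpha> fA gB mult_nonneg_nonneg) auto
  also have "(?c * A) powr \<alpha> * (?c * B) powr (1 - \<alpha>) = ?c * (A powr \<alpha> * B powr (1 - \<alpha>))"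
  proof -
    have "?c powr \<alpha> * ?c powr (1 - \<alpha>) = ?c" using c0 by (simp only: powr_add[symmetric]) simp
    moreover have "(?c * A) powr \<alpha> = ?c powr \<alpha> * A powr \<alpha>" "(?c * B) powr (1 - \<alpha>) = ?c powr (1 - \<alpha>) * B powr (1 - \<alpha>)"
      using A B c0 by (intro powr_mult; simp)+
    ultimately show ?thesis by (simp only: mult_ac)
  qed
  finally have "ennreal (fact n) * weighted_mass \<rho> \<tau> \<alpha> n \<psi> \<le> ennreal (fact n) * ennreal (?c * (A powr \<alpha> * B powr (1 - \<alpha>)))"
    by (intro mult_left_mono) auto
  also have "\<dots> = ennreal (2 * (A powr \<alpha> * B powr (1 - \<alpha>)))"
    by (subst ennreal_mult[symmetric]) auto
  finally show ?thesis .
qed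

text \<open>The norm of a vector with infinite squared norm would read \<open>0\<close>, so
  finiteness is asserted separately. The constant is chosen after \<rho> and \<alpha>. The support
  parameter is called \<open>\<xi>\<close> because \<open>\<chi>\<close> is the binder of
  vectors.\<close>

theorem proposition4p1:
  fixes \<rho> :: "real^2 \<Rightarrow> real" and \<alpha> :: real
  assumes "mollifier \<rho>" and "0 < \<alpha>" and "\<alpha> < 1"
  shows "\<exists>C>0. \<forall>\<tau>>0. \<forall>m n :: nat. \<forall>\<xi>::real. \<forall>\<Phi>.
    m \<ge> 1 \<and> m \<noteq> 2 \<and> n \<ge> 1 \<and> 0 \<le> \<xi> \<and> \<xi> \<le> 1 \<and> \<Phi> \<in> GammaL2 \<rho> \<tau> n \<and>
    (AE p in Xi \<rho> \<tau> n. \<Phi> p \<noteq> 0 \<longrightarrow> R_normsq \<tau> n p \<le> \<tau> * \<xi>) \<longrightarrow>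
      H_normsq \<rho> \<tau> (- 1) (fock_scale (sqrt (fact m)) (A_op \<rho> \<tau> m (homogeneous n \<Phi>))) < \<infinity> \<and>
      H_norm \<rho> \<tau> (- 1) (fock_scale (sqrt (fact m)) (A_op \<rho> \<tau> m (homogeneous n \<Phi>)))
        \<le> C * (real n ^ 3 * real m ^ 3 + \<xi> * 4 ^ n * real m ^ n)
            * L2_norm \<rho> \<tau> (sqrt_neg_nu_L0_e1 \<tau> (homogeneous n \<Phi>)) powr \<alpha>
            * H_norm \<rho> \<tau> 1 (homogeneous n \<Phi>) powr (1 - \<alpha>)"
proof -
  define \<beta> where "\<beta> = max \<alpha> (1/2)"
  have \<beta>: "1/2 \<le> \<beta>" "\<beta> < 1" "\<alpha> \<le> \<beta>" "0 < \<beta>" using assms by (auto simp: \<beta>_def)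
  obtain L where L: "\<And>u. \<bar>(cosine_transform \<rho> u)\<^sup>2 - 1\<bar> \<le> L * norm u" "0 \<le> L"
    using mollifier_cosine_transform(4)[OF assms(1)] by blast
  \<comment> \<open>The cube of \<open>singularity_const\<close> serves \<open>m \<ge> 3\<close>,
    the summand with \<open>L\<close> serves \<open>m = 1\<close>, and the factor \<open>2\<close>
    comes from the interpolation.\<close>
  define D where "D = 2 * (singularity_const \<beta> ^ 3 + 2 * L\<^sup>2)"
  have "0 < singularity_const \<beta> ^ 3" using singularity_const_bounds(1)[OF \<beta>(1,2)] by simp
  then have D: "0 < D" by (simp add: D_def add_pos_nonneg)
  show ?thesis
  proof (intro exI[of _ "sqrt D"] conjI allI impI)
    show "0 < sqrt D" using D by simp
  next
    fix \<tau> :: real and m n :: nat and \<xi> :: real and \<Phi> :: chaos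
    assume \<tau>: "0 < \<tau>"
    assume hyp: "m \<ge> 1 \<and> m \<noteq> 2 \<and> n \<ge> 1 \<and> 0 \<le> \<xi> \<and> \<xi> \<le> 1 \<and> \<Phi> \<in> GammaL2 \<rho> \<tau> n \<and>
      (AE p in Xi \<rho> \<tau> n. \<Phi> p \<noteq> 0 \<longrightarrow> R_normsq \<tau> n p \<le> \<tau> * \<xi>)"
    then have mn: "1 \<le> m" "m \<noteq> 2" "1 \<le> n" and \<xi>: "0 \<le> \<xi>" "\<xi> \<le> 1" and \<Phi>: "\<Phi> \<in> borel_measurable (leb n)"
      and fin: "(\<integral>\<^sup>+p. ennreal ((cmod (\<Phi> p))\<^sup>2) \<partial>Xi \<rho> \<tau> n) < \<infinity>"
      and supp: "AE p in Xi \<rho> \<tau> n. \<Phi> p \<noteq> 0 \<longrightarrow> R_normsq \<tau> n p \<le> \<tau> * \<xi>"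
      by (auto simp: GammaL2_def)
    \<comment> \<open>The hypothesis confines the support only up to a null set; cutting off makes
      the condition hold everywhere and changes none of the norms.\<close>
    define \<psi> where "\<psi> p = (if R_normsq \<tau> n p \<le> \<tau> * \<xi> then \<Phi> p else 0)" for p
    have \<psi>: "\<psi> \<in> borel_measurable (leb n)" unfolding \<psi>_def using \<Phi> by measurable
    have \<Phi>\<psi>: "AE p in Xi \<rho> \<tau> n. \<Phi> p = \<psi> p" using supp by eventually_elim (auto simp: \<psi>_def)
    have \<psi>supp: "R_normsq \<tau> n p \<le> \<tau> * \<xi>" if "\<psi> p \<noteq> 0" for p using that by (auto simp: \<psi>_def split: if_splits)
    have A_eq: "L2_normsq \<rho> \<tau> (sqrt_neg_nu_L0_e1 \<tau> (homogeneous n \<Phi>)) = L2_normsq \<rho> \<tau> (sqrt_neg_nu_L0_e1 \<tau> (homogeneous n \<psi>))"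
      unfolding L2_normsq_homogeneous using \<Phi>\<psi> by (intro arg_cong2[where f="(*)"] refl nn_integral_cong_AE) (auto elim!: eventually_mono)
    have B_eq: "H_normsq \<rho> \<tau> 1 (homogeneous n \<Phi>) = H_normsq \<rho> \<tau> 1 (homogeneous n \<psi>)"
      unfolding H_normsq_homogeneous using \<Phi>\<psi> by (intro arg_cong2[where f="(*)"] refl nn_integral_cong_AE) (auto elim!: eventually_mono)
    have AB: "L2_normsq \<rho> \<tau> (sqrt_neg_nu_L0_e1 \<tau> (homogeneous n \<psi>)) \<le> H_normsq \<rho> \<tau> 1 (homogeneous n \<psi>)"
      unfolding L2_normsq_homogeneous H_normsq_homogeneous
    proof (intro mult_left_mono nn_integral_mono ennreal_leI mult_right_mono)
      show "nu \<tau> * e1_normsq n p / 2 \<le> 1 + R_normsq \<tau> n p / 2" for p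
        using nu_e1_normsq_le[OF \<tau>, of n p] by simp
    qed auto
    \<comment> \<open>On the support \<open>R_normsq\<close> is at most
      \<open>\<tau> * \<xi>\<close>, so a vector with finite \<open>L2\<close> norm also has a
      finite \<open>H\<close> norm of order \<open>1\<close>.\<close>
    have Bfin: "H_normsq \<rho> \<tau> 1 (homogeneous n \<psi>) < \<infinity>"
    proof -
      have "(\<integral>\<^sup>+p. ennreal ((1 + R_normsq \<tau> n p / 2) * (cmod (\<psi> p))\<^sup>2) \<partial>Xi \<rho> \<tau> n) \<le> (\<integral>\<^sup>+p. ennreal (1 + \<tau> * \<xi> / 2) * ennreal ((cmod (\<Phi> p))\<^sup>2) \<partial>Xi \<rho> \<tau> n)"
      proof (rule nn_integral_mono)
        fix p
        have t: "0 \<le> 1 + \<tau> * \<xi> / 2" using \<tau> \<xi> by (simp add: add_nonneg_nonneg)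
        have "(1 + R_normsq \<tau> n p / 2) * (cmod (\<psi> p))\<^sup>2 \<le> (1 + \<tau> * \<xi> / 2) * (cmod (\<Phi> p))\<^sup>2"
          using t by (auto simp: \<psi>_def intro!: mult_right_mono)
        then show "ennreal ((1 + R_normsq \<tau> n p / 2) * (cmod (\<psi> p))\<^sup>2) \<le> ennreal (1 + \<tau> * \<xi> / 2) * ennreal ((cmod (\<Phi> p))\<^sup>2)"
          using t by (subst ennreal_mult[symmetric]) (auto intro!: ennreal_leI)
      qed
      also have "\<dots> = ennreal (1 + \<tau> * \<xi> / 2) * (\<integral>\<^sup>+p. ennreal ((cmod (\<Phi> p))\<^sup>2) \<partial>Xi \<rho> \<tau> n)"
        by (intro nn_integral_cmult measurable_compose[OF _ measurable_ennreal]) (simp add: borel_measurable_Xi borel_measurable_cmod_sq[OF \<Phi>])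
      also have "\<dots> < \<infinity>" using fin by (simp add: ennreal_mult_less_top)
      finally show ?thesis unfolding H_normsq_homogeneous by (simp add: ennreal_mult_less_top)
    qed
    define A where "A = enn2real (L2_normsq \<rho> \<tau> (sqrt_neg_nu_L0_e1 \<tau> (homogeneous n \<psi>)))"
    define B where "B = enn2real (H_normsq \<rho> \<tau> 1 (homogeneous n \<psi>))"
    have B: "H_normsq \<rho> \<tau> 1 (homogeneous n \<psi>) = ennreal B" "0 \<le> B" using Bfin by (auto simp: B_def)
    have A: "L2_normsq \<rho> \<tau> (sqrt_neg_nu_L0_e1 \<tau> (homogeneous n \<psi>)) = ennreal A" "0 \<le> A"
      using order.strict_trans1[OF AB Bfin] by (auto simp: A_def)
    have AB': "A \<le> B" using AB A B by simp
    define X where "X = real n ^ 3 * real m ^ 3 + \<xi> * 4 ^ n * real m ^ n"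
    have X: "0 \<le> X" using \<xi> by (simp add: X_def)
    define H where "H = H_normsq \<rho> \<tau> (- 1) (fock_scale (sqrt (fact m)) (A_op \<rho> \<tau> m (homogeneous n \<Phi>)))"
    have "H = H_normsq \<rho> \<tau> (- 1) (fock_scale (sqrt (fact m)) (A_op \<rho> \<tau> m (homogeneous n \<psi>)))"
      unfolding H_def by (rule H_normsq_A_op_cong_AE[OF assms(1) \<Phi> \<psi> \<Phi>\<psi>])
    also have "\<dots> \<le> ennreal (fact n * ((singularity_const \<beta> ^ 3 + 2 * L\<^sup>2) * X\<^sup>2)) * weighted_mass \<rho> \<tau> \<beta> n \<psi>"
      unfolding X_def by (rule H_normsq_A_op_le[OF assms(1) \<tau> \<beta>(1,2) \<xi> mn \<psi> \<psi>supp L])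
    also have "\<dots> = ennreal (D / 2 * X\<^sup>2) * (ennreal (fact n) * weighted_mass \<rho> \<tau> \<beta> n \<psi>)"
    proof -
      have "fact n * ((singularity_const \<beta> ^ 3 + 2 * L\<^sup>2) * X\<^sup>2) = D / 2 * X\<^sup>2 * fact n"
        by (simp add: D_def)
      moreover have "ennreal (D / 2 * X\<^sup>2 * fact n) = ennreal (D / 2 * X\<^sup>2) * ennreal (fact n)"
        using D by (intro ennreal_mult) auto
      ultimately show ?thesis by (simp only: mult.assoc)
    qed
    also have "\<dots> \<le> ennreal (D / 2 * X\<^sup>2) * ennreal (2 * (A powr \<beta> * B powr (1 - \<beta>)))"
      using \<beta> by (intro mult_left_mono weighted_mass_interpolation[OF assms(1) \<psi> _ _ A B]) auto
    also have "\<dots> = ennreal (D * X\<^sup>2 * (A powr \<beta> * B powr (1 - \<beta>)))"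
      using D by (subst ennreal_mult[symmetric]) auto
    finally have H1: "H \<le> ennreal (D * X\<^sup>2 * (A powr \<beta> * B powr (1 - \<beta>)))" .
    \<comment> \<open>Because \<open>A \<le> B\<close>, the excess exponent
      \<open>\<beta> - \<alpha>\<close> can be moved from \<open>A\<close> to
      \<open>B\<close>.\<close>
    have interp: "A powr \<beta> * B powr (1 - \<beta>) \<le> A powr \<alpha> * B powr (1 - \<alpha>)"
    proof -
      have "A powr \<beta> * B powr (1 - \<beta>) = A powr \<alpha> * (A powr (\<beta> - \<alpha>) * B powr (1 - \<beta>))"
        by (simp add: mult.assoc[symmetric] powr_add[symmetric])
      also have "\<dots> \<le> A powr \<alpha> * (B powr (\<beta> - \<alpha>) * B powr (1 - \<beta>))"
        using A AB' \<beta> by (intro mult_left_mono mult_right_mono powr_mono2) auto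
      also have "\<dots> = A powr \<alpha> * B powr (1 - \<alpha>)" by (simp add: powr_add[symmetric])
      finally show ?thesis .
    qed
    have "H \<le> ennreal (D * X\<^sup>2 * (A powr \<alpha> * B powr (1 - \<alpha>)))"
      using H1 interp D by (elim order.trans) (intro ennreal_leI mult_left_mono, auto)
    then have H2: "enn2real H \<le> D * X\<^sup>2 * (A powr \<alpha> * B powr (1 - \<alpha>))"
      using D by (intro enn2real_leI) auto
    have "H < \<infinity>" using H1 order.strict_trans1 by fastforce
    then show "H_normsq \<rho> \<tau> (- 1) (fock_scale (sqrt (fact m)) (A_op \<rho> \<tau> m (homogeneous n \<Phi>))) < \<infinity>"
      by (simp add: H_def)
    have "sqrt (enn2real H) \<le> sqrt (D * X\<^sup>2 * (A powr \<alpha> * B powr (1 - \<alpha>)))"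
      using H2 by simp
    also have "\<dots> = sqrt D * X * sqrt A powr \<alpha> * sqrt B powr (1 - \<alpha>)"
    proof -
      have s: "sqrt (x powr a) = sqrt x powr a" if "0 \<le> x" for x a :: real
        using that by (simp add: powr_half_sqrt[symmetric] powr_powr mult.commute)
      show ?thesis using X A B by (simp add: real_sqrt_mult s mult.assoc)
    qed
    finally show "H_norm \<rho> \<tau> (- 1) (fock_scale (sqrt (fact m)) (A_op \<rho> \<tau> m (homogeneous n \<Phi>)))
        \<le> sqrt D * (real n ^ 3 * real m ^ 3 + \<xi> * 4 ^ n * real m ^ n)
            * L2_norm \<rho> \<tau> (sqrt_neg_nu_L0_e1 \<tau> (homogeneous n \<Phi>)) powr \<alpha>
            * H_norm \<rho> \<tau> 1 (homogeneous n \<Phi>) powr (1 - \<alpha>)"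
      unfolding H_norm_def L2_norm_def A_eq B_eq A_def[symmetric] B_def[symmetric] H_def[symmetric] X_def[symmetric] .
  qed
qed

end
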